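(* In the setting of the context (triangular array of experiments with conditional densities $p_j(\theta)$), suppose there exist $d\times d$ positive definite matrices $r_n$ and measurable functions $\dot\xi_{n,j}(\theta_0,\cdot):\mathfrak R_{n,1}\times\cdots\times\mathfrak R_{n,j}\to\mathbb R^d$ such that, writing $\dot\xi_j(\theta_0)=\dot\xi_{n,j}(\theta_0,\bar X_{j-1},\cdot):\mathfrak R_{n,j}\to\mathbb R^d$, $\xi_{n,j}(\theta_0,h)=\sqrt{p_j(\theta_0+r_nh)}-\sqrt{p_j(\theta_0)}$ and $$\eta_j=\Big(\frac{\dot\xi_j(\theta_0)}{\sqrt{p_j(\theta_0)}}1_{\{p_j(\theta_0)\neq0\}}\Big)(X_j),$$ the following hold. (A1) For every $h\in\mathbb R^d$, $\sum_{j=1}^{m_n}E_{\theta_0}\big[\int[\xi_{n,j}(\theta_0,h)-\frac12h^\top r_n\dot\xi_j(\theta_0)]^2d\mu_j\big]\to0$ as $n\to\infty$. (A2) $E_{\theta_0}[|\eta_j|^2|\mathcal F_{j-1}]<\infty$ and $E_{\theta_0}[\eta_j|\mathcal F_{j-1}]=0$, $P_{\theta_0,n}$-almost surely, for every $j\ge1$. (A3) For every $\epsilon>0$ and $h\in\mathbb R^d$, $\sum_{j=1}^{m_n}E_{\theta_0}[|h^\top r_n\eta_j|^21_{\{|h^\top r_n\eta_j|>\epsilon\}}]\to0$. (A4) For every $h\in\mathbb R^d$ there is a constant $K>0$ with $\sup_{n\ge1}\sum_{j=1}^{m_n}E_{\theta_0}[|h^\top r_n\eta_j|^2]\le K$.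 (A5) With $$T_n=r_n\sum_{j=1}^{m_n}E_{\theta_0}[\eta_j\eta_j^\top|\mathcal F_{j-1}]\,r_n,\qquad V_n=r_n\sum_{j=1}^{m_n}\eta_j,$$ there exists a random symmetric $d\times d$ matrix $T$, almost surely nonnegative definite, such that $\mathcal L((V_n,T_n)|P_{\theta_0,n})\to\mathcal L(T^{1/2}W,T)$, where $W\sim N(0,I_d)$ is independent of $T$. Then Condition (L) holds for $\{P_{\theta,n}\}_{\theta,n}$ at $\theta_0$ with these $T_n$ and $V_n$. If moreover $T$ is positive definite almost surely, then $\{P_{\theta,n}\}_{\theta,n}$ satisfies the LAMN condition at $\theta=\theta_0$ with $V_n$ and $$\tilde T_n=T_n1_{\{T_n\text{ is positive definite}\}}+I_d1_{\{T_n\text{ is not positive definite}\}}$$ in place of $T_n$.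
   Context: Setting. $\Theta\subset\mathbb R^d$ is open, $\theta_0\in\Theta$, $(m_n)$ is a sequence of positive integers. For each $n$, $\mathfrak R_{n,1},\dots,\mathfrak R_{n,m_n}$ are complete separable metric spaces, $\mathfrak R_n=\mathfrak R_{n,1}\times\cdots\times\mathfrak R_{n,m_n}$, and $\{P_{\theta,n}\}_{\theta\in\Theta}$ are probability measures on $(\mathfrak R_n,\mathcal B(\mathfrak R_n))$. $X_j:\mathfrak R_n\to\mathfrak R_{n,j}$ is the natural projection, $\bar X_j=(X_1,\dots,X_j)$, $\mathcal F_j=\sigma(\bar X_j)$ (with $\mathcal F_0$ trivial). There are $\sigma$-finite measures $\mu_j=\mu_{n,j}$ on $\mathfrak R_{n,j}$ with $P_{\theta,n}(X_1\in\cdot)\ll\mu_1$ and $P_{\theta,n}(X_j\in\cdot|\bar X_{j-1}=\bar x_{j-1})\ll\mu_j$ for all $\bar x_{j-1}$ and $2\le j\le m_n$; $p_j(\theta)$ is the corresponding (conditional) density with respect to $\mu_j$, i.e. $p_1(\theta)=dP_{\theta,n}(X_1\in\cdot)/d\mu_1$ and $p_j(\theta)=dP_{\theta,n}(X_j\in\cdot|\bar X_{j-1})/d\mu_j$ for $j\geq 2$. $E_\theta$ is expectation under $P_{\theta,n}$; $I_d$ is the identity matrix. Condition (L) at $\theta_0$ (with positive definite $d\times d$ matrices $r_n$): (1) there are measurable $d$-dimensional vectors $V_n(\theta_0)$ and measurable symmetric $d\times d$ matrices $T_n(\theta_0)$ on the $n$-th sample space with $P_{\theta_0,n}[T_n(\theta_0)\text{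 is nonnegative definite}]=1$ for every $n$ and $$\log\frac{dP_{\theta_0+r_nh,n}}{dP_{\theta_0,n}}-h^\top V_n(\theta_0)+\frac12h^\top T_n(\theta_0)h\to0$$ in $P_{\theta_0,n}$-probability for every $h\in\mathbb R^d$; (2) there is an almost surely nonnegative definite random matrix $T(\theta_0)$ with $\mathcal L(V_n(\theta_0),T_n(\theta_0)|P_{\theta_0,n})\to\mathcal L(T^{1/2}(\theta_0)W,T(\theta_0))$, where $W$ is $d$-dimensional standard normal independent of $T(\theta_0)$. LAMN condition at $\theta_0$: Condition (L) holds, $P_{\theta_0,n}[T_n(\theta_0)\text{ is positive definite}]=1$ for every $n$, and $T(\theta_0)$ is positive definite almost surely. *)

theory Defs
  imports "HOL-Probability.Probability"
begin

section \<open>Matrices\<close>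

definition nonneg_definite :: "real^'d^'d \<Rightarrow> bool" where
  "nonneg_definite A \<longleftrightarrow> transpose A = A \<and> (\<forall>x. 0 \<le> x \<bullet> (A *v x))"

definition pos_definite :: "real^'d^'d \<Rightarrow> bool" where
  "pos_definite A \<longleftrightarrow> transpose A = A \<and> (\<forall>x. x \<noteq> 0 \<longrightarrow> 0 < x \<bullet> (A *v x))"

text \<open>The square root is meaningful only for nonnegative definite \<open>A\<close>.\<close>

definition msqrt :: "real^'d^'d \<Rightarrow> real^'d^'d" where
  "msqrt A = (THE B. nonneg_definite B \<and> B ** B = A)"


section \<open>Densities, regular conditional distributions, convergence\<close>

definition borel_of :: "'a topology \<Rightarrow> 'a measure" where
  "borel_of X = sigma (topspace X) {U. openin X U}"

definition is_ac_density :: "'b measure \<Rightarrow> 'b measure \<Rightarrow> ('b \<Rightarrow> ennreal) \<Rightarrow> bool" where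
  "is_ac_density M N f \<longleftrightarrow> f \<in> borel_measurable M \<and>
     (\<exists>A\<in>null_sets M. \<forall>B\<in>sets M. emeasure N B = (\<integral>\<^sup>+x\<in>B. f x \<partial>M) + emeasure N (B \<inter> A))"

text \<open>The likelihood ratio \<open>dN/dM\<close>, i.e. the density of the absolutely continuous part in the
  Lebesgue decomposition of \<open>N\<close> with respect to \<open>M\<close>. It agrees with \<open>RN_deriv M N\<close> (\<open>M\<close>-almost
  everywhere) if \<open>N\<close> is absolutely continuous; \<open>RN_deriv\<close> itself is \<open>0\<close> by convention otherwise,
  and hence cannot be used here.\<close>

definition likelihood_ratio :: "'b measure \<Rightarrow> 'b measure \<Rightarrow> 'b \<Rightarrow> ennreal" where
  "likelihood_ratio N M = (SOME f. is_ac_density M N f)"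

text \<open>A log-likelihood ratio may be \<open>-\<infinity>\<close> with positive probability.\<close>

definition log_ennreal :: "ennreal \<Rightarrow> ereal" where
  "log_ennreal x = (if x = 0 then -\<infinity> else if x = \<infinity> then \<infinity> else ereal (ln (enn2real x)))"

text \<open>\<open>K\<close> is a regular version of the conditional distribution of \<open>Y\<close> (with values in \<open>B\<close>)
  given \<open>X\<close> (with values in \<open>A\<close>) under \<open>M\<close>.\<close>

definition regular_cond_dist ::
  "'b measure \<Rightarrow> 'x measure \<Rightarrow> ('b \<Rightarrow> 'x) \<Rightarrow> 'y measure \<Rightarrow> ('b \<Rightarrow> 'y) \<Rightarrow> ('x \<Rightarrow> 'y measure) \<Rightarrow> bool" where
  "regular_cond_dist M A X B Y K \<longleftrightarrow>
     X \<in> measurable M A \<and> Y \<in> measurable M B \<and> K \<in> measurable A (prob_algebra B) \<and>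
     (\<forall>S\<in>sets A. \<forall>S'\<in>sets B.
        emeasure M {\<omega>\<in>space M. X \<omega> \<in> S \<and> Y \<omega> \<in> S'} = (\<integral>\<^sup>+x\<in>S. emeasure (K x) S' \<partial>distr M A X))"

definition tendsto_zero_in_prob :: "(nat \<Rightarrow> 'b measure) \<Rightarrow> (nat \<Rightarrow> 'b \<Rightarrow> ereal) \<Rightarrow> bool" where
  "tendsto_zero_in_prob M Z \<longleftrightarrow>
     (\<forall>\<epsilon>>0. (\<lambda>n. measure (M n) {x\<in>space (M n). ereal \<epsilon> < \<bar>Z n x\<bar>}) \<longlonglongrightarrow> 0)"

text \<open>Convergence of the laws of \<open>Y n\<close> under \<open>M n\<close> to the law of \<open>Z\<close> under \<open>N\<close>.\<close>

definition converges_in_law ::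
  "(nat \<Rightarrow> 'b measure) \<Rightarrow> (nat \<Rightarrow> 'b \<Rightarrow> 'y::topological_space) \<Rightarrow> 'w measure \<Rightarrow> ('w \<Rightarrow> 'y) \<Rightarrow> bool" where
  "converges_in_law M Y N Z \<longleftrightarrow>
     (\<forall>f::'y \<Rightarrow> real. continuous_on UNIV f \<and> bounded (range f) \<longrightarrow>
        (\<lambda>n. \<integral>x. f (Y n x) \<partial>M n) \<longlonglongrightarrow> (\<integral>w. f (Z w) \<partial>N))"

definition std_normal_vector :: "'w measure \<Rightarrow> ('w \<Rightarrow> real^'d) \<Rightarrow> bool" where
  "std_normal_vector N W \<longleftrightarrow>
     distributed N lborel W (\<lambda>w. ennreal (\<Prod>i\<in>UNIV. std_normal_density (w $ i)))"


section \<open>Condition (L) and the LAMN condition\<close>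

text \<open>Convergence in law of \<open>(V n, T n)\<close> under \<open>M n\<close> to \<open>(msqrt Tlim W, Tlim)\<close>, where \<open>W\<close> is
  standard normal and independent of the almost surely nonnegative definite \<open>Tlim\<close>. The limit
  variables live on an arbitrary probability space \<open>N\<close>. Independence is stated through the generated
  \<open>\<sigma>\<close>-algebras because \<open>indep_var\<close> requires both variables to have the same type.\<close>

definition mixed_normal_limit ::
  "(nat \<Rightarrow> 'b measure) \<Rightarrow> (nat \<Rightarrow> 'b \<Rightarrow> real^'d) \<Rightarrow> (nat \<Rightarrow> 'b \<Rightarrow> real^'d^'d) \<Rightarrow>
   'w measure \<Rightarrow> ('w \<Rightarrow> real^'d^'d) \<Rightarrow> ('w \<Rightarrow> real^'d) \<Rightarrow> bool" where
  "mixed_normal_limit M V T N Tlim W \<longleftrightarrow>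
     prob_space N \<and>
     Tlim \<in> borel_measurable N \<and>
     (AE w in N. nonneg_definite (Tlim w)) \<and>
     std_normal_vector N W \<and>
     prob_space.indep_set N {Tlim -` A \<inter> space N |A. A \<in> sets borel}
       {W -` A \<inter> space N |A. A \<in> sets borel} \<and>
     converges_in_law M (\<lambda>n x. (V n x, T n x)) N (\<lambda>w. (msqrt (Tlim w) *v W w, Tlim w))"

definition condition_L ::
  "(real^'d \<Rightarrow> nat \<Rightarrow> 'b measure) \<Rightarrow> real^'d \<Rightarrow> (nat \<Rightarrow> real^'d^'d) \<Rightarrow>
   (nat \<Rightarrow> 'b \<Rightarrow> real^'d) \<Rightarrow> (nat \<Rightarrow> 'b \<Rightarrow> real^'d^'d) \<Rightarrow>
   'w measure \<Rightarrow> ('w \<Rightarrow> real^'d^'d) \<Rightarrow> ('w \<Rightarrow> real^'d) \<Rightarrow> bool" where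
  "condition_L P \<theta>\<^sub>0 r V T N Tlim W \<longleftrightarrow>
     (\<forall>n. pos_definite (r n)) \<and>
     (\<forall>n. V n \<in> borel_measurable (P \<theta>\<^sub>0 n)) \<and>
     (\<forall>n. T n \<in> borel_measurable (P \<theta>\<^sub>0 n)) \<and>
     (\<forall>n. \<forall>x\<in>space (P \<theta>\<^sub>0 n). transpose (T n x) = T n x) \<and>
     (\<forall>n. AE x in P \<theta>\<^sub>0 n. nonneg_definite (T n x)) \<and>
     (\<forall>h. tendsto_zero_in_prob (P \<theta>\<^sub>0)
        (\<lambda>n x. log_ennreal (likelihood_ratio (P (\<theta>\<^sub>0 + r n *v h) n) (P \<theta>\<^sub>0 n) x)
               - ereal (h \<bullet> V n x) + ereal (1/2 * (h \<bullet> (T n x *v h))))) \<and>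
     mixed_normal_limit (P \<theta>\<^sub>0) V T N Tlim W"

definition lamn_condition ::
  "(real^'d \<Rightarrow> nat \<Rightarrow> 'b measure) \<Rightarrow> real^'d \<Rightarrow> (nat \<Rightarrow> real^'d^'d) \<Rightarrow>
   (nat \<Rightarrow> 'b \<Rightarrow> real^'d) \<Rightarrow> (nat \<Rightarrow> 'b \<Rightarrow> real^'d^'d) \<Rightarrow>
   'w measure \<Rightarrow> ('w \<Rightarrow> real^'d^'d) \<Rightarrow> ('w \<Rightarrow> real^'d) \<Rightarrow> bool" where
  "lamn_condition P \<theta>\<^sub>0 r V T N Tlim W \<longleftrightarrow>
     condition_L P \<theta>\<^sub>0 r V T N Tlim W \<and>
     (\<forall>n. AE x in P \<theta>\<^sub>0 n. pos_definite (T n x)) \<and>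
     (AE w in N. pos_definite (Tlim w))"


section \<open>Triangular arrays with conditional densities\<close>

text \<open>Points of \<open>R n 1 \<times> \<dots> \<times> R n (m n)\<close> are the extensional functions on \<open>{1..m n}\<close>; the
  projection \<open>X\<^sub>j\<close> is \<open>\<lambda>x. x j\<close>, and \<open>(X\<^sub>1, \<dots>, X\<^sub>j)\<close> is \<open>\<lambda>x. restrict x {1..j}\<close>.\<close>

definition prod_borel :: "(nat \<Rightarrow> 'a metric) \<Rightarrow> nat set \<Rightarrow> (nat \<Rightarrow> 'a) measure" where
  "prod_borel S J = borel_of (product_topology (\<lambda>j. mtopology_of (S j)) J)"

text \<open>\<open>history_algebra S k j\<close> is \<open>\<F>\<^sub>j = \<sigma>(X\<^sub>1, \<dots>, X\<^sub>j)\<close> on \<open>S 1 \<times> \<dots> \<times> S k\<close>.\<close>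

definition history_algebra :: "(nat \<Rightarrow> 'a metric) \<Rightarrow> nat \<Rightarrow> nat \<Rightarrow> (nat \<Rightarrow> 'a) measure" where
  "history_algebra S k j =
     vimage_algebra (space (prod_borel S {1..k})) (\<lambda>x. restrict x {1..j}) (prod_borel S {1..j})"

text \<open>\<open>Q \<theta> n j\<close> is the conditional law of \<open>X\<^sub>j\<close> given \<open>(X\<^sub>1, \<dots>, X\<^bsub>j-1\<^esub>)\<close>. For \<open>j = 1\<close> the
  conditioning variable takes values in a one-point space, so \<open>Q \<theta> n 1\<close> is just the law of \<open>X\<^sub>1\<close>.
  The conditional density is regarded as a jointly measurable function \<open>p \<theta> n j\<close> of
  \<open>(x\<^sub>1, \<dots>, x\<^sub>j)\<close>; its value at the history \<open>x\<close> and the new point \<open>y\<close> is \<open>p \<theta> n j (x(j := y))\<close>.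
  Only the values of \<open>P\<close>, \<open>Q\<close> and \<open>p\<close> at parameters in \<open>\<Theta>\<close> are constrained.\<close>

locale density_array =
  fixes \<Theta> :: "(real^'d) set"
    and m :: "nat \<Rightarrow> nat"
    and R :: "nat \<Rightarrow> nat \<Rightarrow> 'a metric"
    and P :: "real^'d \<Rightarrow> nat \<Rightarrow> (nat \<Rightarrow> 'a) measure"
    and \<mu> :: "nat \<Rightarrow> nat \<Rightarrow> 'a measure"
    and Q :: "real^'d \<Rightarrow> nat \<Rightarrow> nat \<Rightarrow> (nat \<Rightarrow> 'a) \<Rightarrow> 'a measure"
    and p :: "real^'d \<Rightarrow> nat \<Rightarrow> nat \<Rightarrow> (nat \<Rightarrow> 'a) \<Rightarrow> real"
  assumes open_parameters: "open \<Theta>"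
    and m_pos: "\<And>n. 0 < m n"
    and complete: "\<And>n j. j \<in> {1..m n} \<Longrightarrow> mcomplete_of (R n j)"
    and separable: "\<And>n j. j \<in> {1..m n} \<Longrightarrow> separable_space (mtopology_of (R n j))"
    and prob_P: "\<And>\<theta> n. \<theta> \<in> \<Theta> \<Longrightarrow> prob_space (P \<theta> n)"
    and sets_P: "\<And>\<theta> n. \<theta> \<in> \<Theta> \<Longrightarrow> sets (P \<theta> n) = sets (prod_borel (R n) {1..m n})"
    and sigma_finite_\<mu>: "\<And>n j. j \<in> {1..m n} \<Longrightarrow> sigma_finite_measure (\<mu> n j)"
    and sets_\<mu>: "\<And>n j. j \<in> {1..m n} \<Longrightarrow> sets (\<mu> n j) = sets (borel_of (mtopology_of (R n j)))"
    and cond_law: "\<And>\<theta> n j. \<theta> \<in> \<Theta> \<Longrightarrow> j \<in> {1..m n} \<Longrightarrow>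
      regular_cond_dist (P \<theta> n) (prod_borel (R n) {1..<j}) (\<lambda>x. restrict x {1..<j})
        (borel_of (mtopology_of (R n j))) (\<lambda>x. x j) (Q \<theta> n j)"
    and cond_law_ac: "\<And>\<theta> n j x. \<theta> \<in> \<Theta> \<Longrightarrow> j \<in> {1..m n} \<Longrightarrow>
      x \<in> space (prod_borel (R n) {1..<j}) \<Longrightarrow> absolutely_continuous (\<mu> n j) (Q \<theta> n j x)"
    and p_measurable: "\<And>\<theta> n j. \<theta> \<in> \<Theta> \<Longrightarrow> j \<in> {1..m n} \<Longrightarrow>
      p \<theta> n j \<in> borel_measurable (prod_borel (R n) {1..j})"
    and p_nonneg: "\<And>\<theta> n j x. \<theta> \<in> \<Theta> \<Longrightarrow> j \<in> {1..m n} \<Longrightarrow>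
      x \<in> space (prod_borel (R n) {1..j}) \<Longrightarrow> 0 \<le> p \<theta> n j x"
    and p_density: "\<And>\<theta> n j x. \<theta> \<in> \<Theta> \<Longrightarrow> j \<in> {1..m n} \<Longrightarrow>
      x \<in> space (prod_borel (R n) {1..<j}) \<Longrightarrow>
      Q \<theta> n j x = density (\<mu> n j) (\<lambda>y. ennreal (p \<theta> n j (x(j := y))))"

text \<open>\<open>xi p \<theta>\<^sub>0 r h n j\<close> is \<open>\<xi>\<^bsub>n,j\<^esub>(\<theta>\<^sub>0, h)\<close> as a function of \<open>(x\<^sub>1, \<dots>, x\<^sub>j)\<close>.\<close>

definition xi ::
  "(real^'d \<Rightarrow> nat \<Rightarrow> nat \<Rightarrow> (nat \<Rightarrow> 'a) \<Rightarrow> real) \<Rightarrow> real^'d \<Rightarrow> (nat \<Rightarrow> real^'d^'d) \<Rightarrow> real^'d \<Rightarrow>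
   nat \<Rightarrow> nat \<Rightarrow> (nat \<Rightarrow> 'a) \<Rightarrow> real" where
  "xi p \<theta>\<^sub>0 r h n j x = sqrt (p (\<theta>\<^sub>0 + r n *v h) n j x) - sqrt (p \<theta>\<^sub>0 n j x)"

text \<open>In the remaining definitions \<open>xd n j\<close> stands for the derivative \<open>\<xi>\<close>-dot at \<open>\<theta>\<^sub>0\<close>, a
  function of \<open>(x\<^sub>1, \<dots>, x\<^sub>j)\<close>.\<close>

definition eta ::
  "(real^'d \<Rightarrow> nat \<Rightarrow> nat \<Rightarrow> (nat \<Rightarrow> 'a) \<Rightarrow> real) \<Rightarrow> real^'d \<Rightarrow>
   (nat \<Rightarrow> nat \<Rightarrow> (nat \<Rightarrow> 'a) \<Rightarrow> real^'d) \<Rightarrow> nat \<Rightarrow> nat \<Rightarrow> (nat \<Rightarrow> 'a) \<Rightarrow> real^'d" where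
  "eta p \<theta>\<^sub>0 xd n j x =
     (let x' = restrict x {1..j}
      in if p \<theta>\<^sub>0 n j x' \<noteq> 0 then (1 / sqrt (p \<theta>\<^sub>0 n j x')) *\<^sub>R xd n j x' else 0)"

definition score ::
  "(nat \<Rightarrow> nat) \<Rightarrow> (real^'d \<Rightarrow> nat \<Rightarrow> nat \<Rightarrow> (nat \<Rightarrow> 'a) \<Rightarrow> real) \<Rightarrow> real^'d \<Rightarrow>
   (nat \<Rightarrow> nat \<Rightarrow> (nat \<Rightarrow> 'a) \<Rightarrow> real^'d) \<Rightarrow> (nat \<Rightarrow> real^'d^'d) \<Rightarrow>
   nat \<Rightarrow> (nat \<Rightarrow> 'a) \<Rightarrow> real^'d" where
  "score m p \<theta>\<^sub>0 xd r n x = r n *v (\<Sum>j\<in>{1..m n}. eta p \<theta>\<^sub>0 xd n j x)"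

text \<open>The conditional expectation of a matrix is taken entrywise.\<close>

definition cond_information ::
  "(nat \<Rightarrow> nat) \<Rightarrow> (nat \<Rightarrow> nat \<Rightarrow> 'a metric) \<Rightarrow> (real^'d \<Rightarrow> nat \<Rightarrow> (nat \<Rightarrow> 'a) measure) \<Rightarrow>
   (real^'d \<Rightarrow> nat \<Rightarrow> nat \<Rightarrow> (nat \<Rightarrow> 'a) \<Rightarrow> real) \<Rightarrow> real^'d \<Rightarrow>
   (nat \<Rightarrow> nat \<Rightarrow> (nat \<Rightarrow> 'a) \<Rightarrow> real^'d) \<Rightarrow> (nat \<Rightarrow> real^'d^'d) \<Rightarrow>
   nat \<Rightarrow> (nat \<Rightarrow> 'a) \<Rightarrow> real^'d^'d" where
  "cond_information m R P p \<theta>\<^sub>0 xd r n x =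
     r n ** (\<Sum>j\<in>{1..m n}. \<chi> a b.
        real_cond_exp (P \<theta>\<^sub>0 n) (history_algebra (R n) (m n) (j - 1))
          (\<lambda>z. eta p \<theta>\<^sub>0 xd n j z $ a * eta p \<theta>\<^sub>0 xd n j z $ b) x) ** r n"

end

theory Submission
  imports Defs
begin

text \<open>
  Fix \<open>h\<close>, write \<open>Z\<^sub>j = sqrt (p\<^sub>j(\<theta>\<^sub>0 + r h) / p\<^sub>j(\<theta>\<^sub>0)) - 1\<close> at the observed point and
  \<open>u\<^sub>j = h \<bullet> r \<eta>\<^sub>j\<close>. The likelihood ratio is the product of the \<open>(1 + Z\<^sub>j)\<^sup>2\<close> (\<open>likelihood_ratio_product\<close>),
  so its logarithm is the sum of the \<open>2 ln (1 + Z\<^sub>j)\<close>. Differentiability in quadratic mean says that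
  the total second moment of the errors \<open>Z\<^sub>j - u\<^sub>j / 2\<close> vanishes in the limit. Then with high probability no
  increment is large, and Taylor's formula replaces the logarithm by the sum of \<open>2 Z\<^sub>j - Z\<^sub>j\<^sup>2\<close>.

  The sum of the \<open>Z\<^sub>j\<^sup>2\<close> is close to a quarter of the sum of the \<open>u\<^sub>j\<^sup>2\<close>, and the latter may be replaced by
  its conditional version by a law of large numbers under the Lindeberg condition
  (\<open>sum_compensated_square_vanishes\<close>). The linear term is more delicate: \<open>Z\<^sub>j\<close> is close to \<open>u\<^sub>j / 2\<close>, which
  is conditionally centred, but the small drifts of the \<open>Z\<^sub>j\<close> add up. They can be computed, since
  \<open>1 - (1 + Z\<^sub>j)\<^sup>2 = - 2 Z\<^sub>j - Z\<^sub>j\<^sup>2\<close> and the conditional expectation of the left-hand side is the mass that the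
  alternative conditional law puts where \<open>p\<^sub>j(\<theta>\<^sub>0)\<close> vanishes. If this mass is negligible, the drift of
  \<open>2 Z\<^sub>j\<close> is the conditional expectation of \<open>- Z\<^sub>j\<^sup>2\<close>. What remains of \<open>Z\<^sub>j - u\<^sub>j / 2\<close> after
  removal of the drift is a martingale difference, and the variance of the sum vanishes. Altogether the
  linear and the quadratic term each contribute minus a quarter of the conditional variance of the \<open>u\<^sub>j\<close>,
  which gives the factor \<open>1/2\<close> in front of \<open>h \<bullet> T h\<close>. This part (locale \<open>increment_array\<close>) uses
  nothing but a filtration and the two arrays.

  The mass on the zero set of \<open>p\<^sub>j(\<theta>\<^sub>0)\<close> is negligible because differentiability is assumed in the directions
  \<open>h\<close> and \<open>- h\<close>: there both square roots are nonnegative and nearly equal to \<open>a\<close> and \<open>- a\<close> for the same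
  \<open>a\<close>, so that they are all small (\<open>singular_mass_le\<close>).

  For the second claim, positive definiteness is an open condition among symmetric matrices. Since the limit
  satisfies it almost surely, the probability that \<open>T\<^sub>n\<close> violates it tends to \<open>0\<close>
  (\<open>not_pos_definite_vanishes\<close>), and a modification on such events affects neither convergence in law nor
  convergence in probability.
\<close>

section \<open>Convergence to zero in mean and in probability\<close>

lemma tendsto_zero_le:
  fixes a b :: "nat \<Rightarrow> real"
  assumes "\<And>n. 0 \<le> a n" "\<And>n. a n \<le> b n" "b \<longlonglongrightarrow> 0"
  shows "a \<longlonglongrightarrow> 0"
  by (rule tendsto_sandwich[OF _ _ tendsto_const assms(3)]) (simp_all add: assms)

text \<open>In both notions the probability space may change with \<open>n\<close>, as it does for a triangular array.\<close>

definition vanishes_in_mean :: "(nat \<Rightarrow> 'b measure) \<Rightarrow> (nat \<Rightarrow> 'b \<Rightarrow> real) \<Rightarrow> bool" where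
  "vanishes_in_mean M X \<longleftrightarrow>
     (\<forall>n. integrable (M n) (X n)) \<and> (\<lambda>n. \<integral>x. \<bar>X n x\<bar> \<partial>M n) \<longlonglongrightarrow> 0"

definition vanishes_in_prob :: "(nat \<Rightarrow> 'b measure) \<Rightarrow> (nat \<Rightarrow> 'b \<Rightarrow> real) \<Rightarrow> bool" where
  "vanishes_in_prob M X \<longleftrightarrow> (\<forall>n. X n \<in> borel_measurable (M n)) \<and>
     (\<forall>\<epsilon>>0. (\<lambda>n. measure (M n) {x\<in>space (M n). \<epsilon> < \<bar>X n x\<bar>}) \<longlonglongrightarrow> 0)"

lemma vanishes_in_mean_integrable: "vanishes_in_mean M X \<Longrightarrow> integrable (M n) (X n)"
  by (simp add: vanishes_in_mean_def)

lemma vanishes_in_mean_bound: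
  assumes "\<And>n. integrable (M n) (X n)" "\<And>n. (\<integral>x. \<bar>X n x\<bar> \<partial>M n) \<le> b n" "b \<longlonglongrightarrow> 0"
  shows "vanishes_in_mean M X"
  unfolding vanishes_in_mean_def
  by (intro conjI allI assms(1) tendsto_zero_le[OF _ assms(2,3)]) simp

lemma vanishes_in_mean_cmult:
  assumes "vanishes_in_mean M X"
  shows "vanishes_in_mean M (\<lambda>n x. c * X n x)"
proof (rule vanishes_in_mean_bound)
  show "integrable (M n) (\<lambda>x. c * X n x)" for n
    using assms by (simp add: vanishes_in_mean_def)
  show "(\<integral>x. \<bar>c * X n x\<bar> \<partial>M n) \<le> \<bar>c\<bar> * (\<integral>x. \<bar>X n x\<bar> \<partial>M n)" for n
    by (simp add: abs_mult)
  show "(\<lambda>n. \<bar>c\<bar> * (\<integral>x. \<bar>X n x\<bar> \<partial>M n)) \<longlonglongrightarrow> 0"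
    using assms by (auto simp: vanishes_in_mean_def intro!: tendsto_eq_intros)
qed

lemma vanishes_in_mean_add:
  assumes "vanishes_in_mean M X" "vanishes_in_mean M Y"
  shows "vanishes_in_mean M (\<lambda>n x. X n x + Y n x)"
proof (rule vanishes_in_mean_bound)
  have [simp]: "integrable (M n) (X n)" "integrable (M n) (Y n)" for n
    using assms by (simp_all add: vanishes_in_mean_def)
  show "integrable (M n) (\<lambda>x. X n x + Y n x)" for n by simp
  show "(\<integral>x. \<bar>X n x + Y n x\<bar> \<partial>M n) \<le> (\<integral>x. \<bar>X n x\<bar> \<partial>M n) + (\<integral>x. \<bar>Y n x\<bar> \<partial>M n)" for n
  proof -
    have "(\<integral>x. \<bar>X n x + Y n x\<bar> \<partial>M n) \<le> (\<integral>x. \<bar>X n x\<bar> + \<bar>Y n x\<bar> \<partial>M n)"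
      by (intro integral_mono) auto
    then show ?thesis by simp
  qed
  show "(\<lambda>n. (\<integral>x. \<bar>X n x\<bar> \<partial>M n) + (\<integral>x. \<bar>Y n x\<bar> \<partial>M n)) \<longlonglongrightarrow> 0"
    using assms by (auto simp: vanishes_in_mean_def intro!: tendsto_eq_intros)
qed

lemma vanishes_in_mean_AE:
  assumes "vanishes_in_mean M X" "\<And>n. Y n \<in> borel_measurable (M n)" "\<And>n. AE x in M n. X n x = Y n x"
  shows "vanishes_in_mean M Y"
proof -
  have "integrable (M n) (Y n)" for n
    using integrable_cong_AE_imp[of "M n" "X n" "Y n"] assms
    by (auto simp: vanishes_in_mean_def elim: AE_mp)
  moreover have "(\<integral>x. \<bar>Y n x\<bar> \<partial>M n) = (\<integral>x. \<bar>X n x\<bar> \<partial>M n)" for n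
  proof (rule integral_cong_AE)
    show "AE x in M n. \<bar>Y n x\<bar> = \<bar>X n x\<bar>" using assms(3)[of n] by eventually_elim simp
    have "integrable (M n) (X n)" using assms(1) by (rule vanishes_in_mean_integrable)
    then show "(\<lambda>x. \<bar>X n x\<bar>) \<in> borel_measurable (M n)" by simp
    show "(\<lambda>x. \<bar>Y n x\<bar>) \<in> borel_measurable (M n)" using assms(2)[of n] by simp
  qed
  ultimately show ?thesis using assms(1) by (simp add: vanishes_in_mean_def)
qed

lemma vanishes_in_mean_imp_prob:
  assumes "vanishes_in_mean M X" "\<And>n. finite_measure (M n)"
  shows "vanishes_in_prob M X"
  unfolding vanishes_in_prob_def
proof (intro conjI allI impI)
  have int: "integrable (M n) (X n)" for n using assms(1) by (rule vanishes_in_mean_integrable)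
  then show [measurable]: "X n \<in> borel_measurable (M n)" for n by simp
  fix \<epsilon> :: real assume "0 < \<epsilon>"
  have "measure (M n) {x\<in>space (M n). \<epsilon> < \<bar>X n x\<bar>} \<le> (\<integral>x. \<bar>X n x\<bar> \<partial>M n) / \<epsilon>" for n
  proof -
    interpret finite_measure "M n" by fact
    have "measure (M n) {x\<in>space (M n). \<epsilon> < \<bar>X n x\<bar>} \<le> measure (M n) {x\<in>space (M n). \<epsilon> \<le> \<bar>X n x\<bar>}"
      by (intro finite_measure_mono) auto
    also have "\<dots> \<le> (\<integral>x. \<bar>X n x\<bar> \<partial>M n) / \<epsilon>"
      by (intro integral_Markov_inequality_measure[where A="space (M n)"])
        (use int \<open>0 < \<epsilon>\<close> in auto)
    finally show ?thesis .
  qed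
  moreover have "(\<lambda>n. (\<integral>x. \<bar>X n x\<bar> \<partial>M n) / \<epsilon>) \<longlonglongrightarrow> 0"
    using assms(1) by (intro tendsto_divide_zero) (simp add: vanishes_in_mean_def)
  ultimately show "(\<lambda>n. measure (M n) {x\<in>space (M n). \<epsilon> < \<bar>X n x\<bar>}) \<longlonglongrightarrow> 0"
    by (intro tendsto_zero_le[OF measure_nonneg])
qed

lemma vanishes_in_probD:
  "vanishes_in_prob M X \<Longrightarrow> 0 < \<epsilon> \<Longrightarrow> (\<lambda>n. measure (M n) {x\<in>space (M n). \<epsilon> < \<bar>X n x\<bar>}) \<longlonglongrightarrow> 0"
  by (simp add: vanishes_in_prob_def)

lemma vanishes_in_prob_add:
  assumes "vanishes_in_prob M X" "vanishes_in_prob M Y" "\<And>n. finite_measure (M n)"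
  shows "vanishes_in_prob M (\<lambda>n x. X n x + Y n x)"
  unfolding vanishes_in_prob_def
proof (intro conjI allI impI)
  have [measurable]: "X n \<in> borel_measurable (M n)" "Y n \<in> borel_measurable (M n)" for n
    using assms by (auto simp: vanishes_in_prob_def)
  then show "(\<lambda>x. X n x + Y n x) \<in> borel_measurable (M n)" for n by simp
  fix \<epsilon> :: real assume \<epsilon>: "0 < \<epsilon>"
  let ?A = "\<lambda>n. {x\<in>space (M n). \<epsilon>/2 < \<bar>X n x\<bar>}" and ?B = "\<lambda>n. {x\<in>space (M n). \<epsilon>/2 < \<bar>Y n x\<bar>}"
  have "measure (M n) {x\<in>space (M n). \<epsilon> < \<bar>X n x + Y n x\<bar>} \<le> measure (M n) (?A n) + measure (M n) (?B n)" for n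
  proof -
    interpret finite_measure "M n" by fact
    have "measure (M n) {x\<in>space (M n). \<epsilon> < \<bar>X n x + Y n x\<bar>} \<le> measure (M n) (?A n \<union> ?B n)"
      by (intro finite_measure_mono) (auto simp: field_simps)
    also have "\<dots> \<le> measure (M n) (?A n) + measure (M n) (?B n)"
      by (intro measure_Un_le) auto
    finally show ?thesis .
  qed
  moreover have "(\<lambda>n. measure (M n) (?A n) + measure (M n) (?B n)) \<longlonglongrightarrow> 0"
  proof (rule tendsto_add_zero)
    show "(\<lambda>n. measure (M n) (?A n)) \<longlonglongrightarrow> 0" "(\<lambda>n. measure (M n) (?B n)) \<longlonglongrightarrow> 0"
      by (rule vanishes_in_probD half_gt_zero assms \<epsilon>)+
  qed
  ultimately show "(\<lambda>n. measure (M n) {x\<in>space (M n). \<epsilon> < \<bar>X n x + Y n x\<bar>}) \<longlonglongrightarrow> 0"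
    by (intro tendsto_zero_le[OF measure_nonneg])
qed

text \<open>The limit arguments below have this shape: \<open>\<delta>\<close> is a truncation level or a weight, and for each fixed
  \<open>\<delta>\<close> all but \<open>\<delta> * C\<close> of the bound vanishes.\<close>

lemma tendsto_zero_if_small_multiples:
  fixes a :: "nat \<Rightarrow> real"
  assumes nonneg: "\<And>n. 0 \<le> a n"
    and bound: "\<And>\<delta> n. 0 < \<delta> \<Longrightarrow> a n \<le> \<delta> * C + b \<delta> n"
    and lim: "\<And>\<delta>. 0 < \<delta> \<Longrightarrow> b \<delta> \<longlonglongrightarrow> 0"
  shows "a \<longlonglongrightarrow> 0"
proof (rule order_tendstoI)
  fix e :: real
  show "\<forall>\<^sub>F n in sequentially. e < a n" if "e < 0"
    using nonneg that by (auto intro!: always_eventually elim: less_le_trans)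
  assume "0 < e"
  define \<delta> where "\<delta> = e / (2 * (\<bar>C\<bar> + 1))"
  have \<delta>: "0 < \<delta>" using \<open>0 < e\<close> by (simp add: \<delta>_def)
  have "\<delta> * C \<le> \<delta> * (\<bar>C\<bar> + 1)" using \<delta> by (intro mult_left_mono) auto
  also have "\<dots> = e / 2" by (simp add: \<delta>_def field_simps)
  finally have C: "\<delta> * C \<le> e / 2" .
  have "\<forall>\<^sub>F n in sequentially. b \<delta> n < e / 2"
    using lim[OF \<delta>] \<open>0 < e\<close> by (intro order_tendstoD(2)) auto
  then show "\<forall>\<^sub>F n in sequentially. a n < e"
  proof eventually_elim
    case (elim n)
    then show ?case using bound[OF \<delta>, of n] C by linarith
  qed
qed


section \<open>Square integrable martingale differences\<close>

lemma integrable_mult_if_square_integrable: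
  fixes f g :: "'b \<Rightarrow> real"
  assumes [measurable]: "f \<in> borel_measurable M" "g \<in> borel_measurable M"
    and "integrable M (\<lambda>x. (f x)\<^sup>2)" "integrable M (\<lambda>x. (g x)\<^sup>2)"
  shows "integrable M (\<lambda>x. f x * g x)"
proof (rule Bochner_Integration.integrable_bound)
  show "integrable M (\<lambda>x. (f x)\<^sup>2 + (g x)\<^sup>2)" using assms by simp
  have "\<bar>a * b\<bar> \<le> \<bar>a\<^sup>2 + b\<^sup>2\<bar>" for a b :: real
  proof -
    have "0 \<le> (\<bar>a\<bar> - \<bar>b\<bar>)\<^sup>2" "0 \<le> a\<^sup>2 + b\<^sup>2" by simp_all
    then have "2 * (\<bar>a\<bar> * \<bar>b\<bar>) \<le> a\<^sup>2 + b\<^sup>2" by (simp add: power2_diff)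
    moreover have "0 \<le> \<bar>a\<bar> * \<bar>b\<bar>" by simp
    ultimately show ?thesis unfolding abs_mult using \<open>0 \<le> a\<^sup>2 + b\<^sup>2\<close> by linarith
  qed
  then show "AE x in M. norm (f x * g x) \<le> norm ((f x)\<^sup>2 + (g x)\<^sup>2)" by simp
qed simp

lemma square_integrable_diff:
  fixes f g :: "'b \<Rightarrow> real"
  assumes [measurable]: "f \<in> borel_measurable M" "g \<in> borel_measurable M"
    and "integrable M (\<lambda>x. (f x)\<^sup>2)" "integrable M (\<lambda>x. (g x)\<^sup>2)"
  shows "integrable M (\<lambda>x. (f x - g x)\<^sup>2)"
proof -
  have "integrable M (\<lambda>x. (f x)\<^sup>2 + (g x)\<^sup>2 - 2 * (f x * g x))"
    using assms(3,4) integrable_mult_if_square_integrable[OF assms] by simp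
  then show ?thesis by (simp add: power2_diff mult.assoc)
qed

text \<open>The variance of \<open>\<bar>X\<bar>\<close> is nonnegative.\<close>

lemma (in prob_space) expectation_abs_le_sqrt:
  assumes [measurable]: "X \<in> borel_measurable M" and "integrable M (\<lambda>x. (X x)\<^sup>2)"
  shows "expectation (\<lambda>x. \<bar>X x\<bar>) \<le> sqrt (expectation (\<lambda>x. (X x)\<^sup>2))"
proof -
  have "integrable M X" using assms by (rule square_integrable_imp_integrable)
  then have "0 \<le> expectation (\<lambda>x. (X x)\<^sup>2) - (expectation (\<lambda>x. \<bar>X x\<bar>))\<^sup>2"
    using assms(2) variance_positive[of "\<lambda>x. \<bar>X x\<bar>"] variance_eq[of "\<lambda>x. \<bar>X x\<bar>"] by simp
  then show ?thesis by (intro real_le_rsqrt) simp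
qed

context finite_measure_subalgebra
begin

lemma real_cond_exp_square_integrable:
  assumes [measurable]: "X \<in> borel_measurable M" and X2: "integrable M (\<lambda>x. (X x)\<^sup>2)"
  shows "integrable M (\<lambda>x. (real_cond_exp M F X x)\<^sup>2)"
proof (rule integrable_convex_cond_exp[where I=UNIV])
  show "integrable M X" using assms by (rule square_integrable_imp_integrable)
  show "convex_on UNIV (\<lambda>x::real. x\<^sup>2)" by (rule convex_power2)
qed (use X2 emeasure_finite in auto)

lemma expectation_abs_real_cond_exp_le:
  assumes int: "integrable M X"
  shows "(\<integral>x. \<bar>real_cond_exp M F X x\<bar> \<partial>M) \<le> (\<integral>x. \<bar>X x\<bar> \<partial>M)"
proof -
  have [measurable]: "X \<in> borel_measurable M" using int by simp
  have "(\<integral>x. \<bar>real_cond_exp M F X x\<bar> \<partial>M) \<le> (\<integral>x. real_cond_exp M F (\<lambda>x. \<bar>X x\<bar>) x \<partial>M)"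
  proof (rule integral_mono_AE)
    have "AE x in M. real_cond_exp M F X x \<le> real_cond_exp M F (\<lambda>x. \<bar>X x\<bar>) x"
      using int by (intro real_cond_exp_mono) auto
    moreover have "AE x in M. - real_cond_exp M F X x \<le> real_cond_exp M F (\<lambda>x. \<bar>X x\<bar>) x"
    proof -
      have "AE x in M. real_cond_exp M F (\<lambda>x. -1 * X x) x \<le> real_cond_exp M F (\<lambda>x. \<bar>X x\<bar>) x"
        using int by (intro real_cond_exp_mono) auto
      with real_cond_exp_cmult[OF int, of "-1"] show ?thesis by eventually_elim simp
    qed
    ultimately show "AE x in M. \<bar>real_cond_exp M F X x\<bar> \<le> real_cond_exp M F (\<lambda>x. \<bar>X x\<bar>) x"
      by eventually_elim simp
  qed (use int real_cond_exp_int(1) in auto)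
  also have "\<dots> = (\<integral>x. \<bar>X x\<bar> \<partial>M)" using int by (intro real_cond_exp_int) auto
  finally show ?thesis .
qed

text \<open>Conditional expectation is the orthogonal projection onto the square integrable functions of the past, so
  subtracting it leaves something centred and does not increase the second moment.\<close>

lemma real_cond_exp_residual:
  assumes [measurable]: "X \<in> borel_measurable M" and X2: "integrable M (\<lambda>x. (X x)\<^sup>2)"
  shows "AE x in M. real_cond_exp M F (\<lambda>x. X x - real_cond_exp M F X x) x = 0"
    and "(\<integral>x. (X x - real_cond_exp M F X x)\<^sup>2 \<partial>M) \<le> (\<integral>x. (X x)\<^sup>2 \<partial>M)"
proof -
  let ?C = "real_cond_exp M F X"
  have X: "integrable M X" using assms by (rule square_integrable_imp_integrable)
  note C2 = real_cond_exp_square_integrable[OF assms]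
  have C: "integrable M ?C" using X by (rule real_cond_exp_int)
  show "AE x in M. real_cond_exp M F (\<lambda>x. X x - ?C x) x = 0"
    using real_cond_exp_diff[OF X C] real_cond_exp_F_meas[OF C borel_measurable_cond_exp] by eventually_elim simp
  have CX: "integrable M (\<lambda>x. ?C x * X x)"
    by (intro integrable_mult_if_square_integrable C2 X2) auto
  have "(\<integral>x. ?C x * X x \<partial>M) = (\<integral>x. (?C x)\<^sup>2 \<partial>M)"
    using real_cond_exp_intg(2)[OF CX] by (simp add: power2_eq_square)
  moreover have "(\<integral>x. (X x - ?C x)\<^sup>2 \<partial>M) = (\<integral>x. (X x)\<^sup>2 \<partial>M) + (\<integral>x. (?C x)\<^sup>2 \<partial>M) - 2 * (\<integral>x. ?C x * X x \<partial>M)"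
    unfolding power2_diff using X2 C2 CX by (simp add: mult.assoc mult.commute[of "X _"])
  moreover have "0 \<le> (\<integral>x. (?C x)\<^sup>2 \<partial>M)" by simp
  ultimately show "(\<integral>x. (X x - ?C x)\<^sup>2 \<partial>M) \<le> (\<integral>x. (X x)\<^sup>2 \<partial>M)" by linarith
qed

end

locale finite_filtration = prob_space M for M :: "'b measure" +
  fixes F :: "nat \<Rightarrow> 'b measure" and k :: nat
  assumes filtration_subalgebra: "j \<le> k \<Longrightarrow> subalgebra M (F j)"
    and filtration_mono: "i \<le> j \<Longrightarrow> j \<le> k \<Longrightarrow> subalgebra (F j) (F i)"
begin

lemma finite_measure_subalgebra: "j \<le> k \<Longrightarrow> finite_measure_subalgebra M (F j)"
  by (simp add: finite_measure_axioms finite_measure_subalgebra_axioms.intro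
      finite_measure_subalgebra_def filtration_subalgebra)

lemma measurable_filtration:
  "f \<in> borel_measurable (F i) \<Longrightarrow> i \<le> j \<Longrightarrow> j \<le> k \<Longrightarrow> f \<in> borel_measurable (F j)"
  using filtration_mono measurable_from_subalg by blast

text \<open>The differences are orthogonal: the sum up to time \<open>i\<close> belongs to the past of the next difference, and
  conditioning on that past annihilates the product.\<close>

lemma martingale_second_moment:
  fixes D :: "nat \<Rightarrow> 'b \<Rightarrow> real"
  assumes adapted: "\<And>j. j \<in> {1..k} \<Longrightarrow> D j \<in> borel_measurable (F j)"
    and square: "\<And>j. j \<in> {1..k} \<Longrightarrow> integrable M (\<lambda>x. (D j x)\<^sup>2)"
    and centred: "\<And>j. j \<in> {1..k} \<Longrightarrow> AE x in M. real_cond_exp M (F (j - 1)) (D j) x = 0"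
  shows "integrable M (\<lambda>x. (\<Sum>j=1..k. D j x)\<^sup>2) \<and>
    expectation (\<lambda>x. (\<Sum>j=1..k. D j x)\<^sup>2) = (\<Sum>j=1..k. expectation (\<lambda>x. (D j x)\<^sup>2))"
proof -
  let ?S = "\<lambda>i x. \<Sum>j\<in>{1..i}. D j x"
  have "integrable M (\<lambda>x. (?S i x)\<^sup>2) \<and>
      expectation (\<lambda>x. (?S i x)\<^sup>2) = (\<Sum>j\<in>{1..i}. expectation (\<lambda>x. (D j x)\<^sup>2))" if "i \<le> k" for i
    using that
  proof (induction i)
    case 0
    then show ?case by simp
  next
    case (Suc i)
    interpret G: finite_measure_subalgebra M "F i"
      using Suc.prems by (intro finite_measure_subalgebra) auto
    have D: "D (Suc i) \<in> borel_measurable M"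
      using Suc.prems by (intro measurable_from_subalg[OF filtration_subalgebra[OF Suc.prems]] adapted) simp
    have S': "?S i \<in> borel_measurable (F i)"
    proof (rule borel_measurable_sum)
      fix j assume "j \<in> {1..i}"
      then show "D j \<in> borel_measurable (F i)"
        using Suc.prems by (intro measurable_filtration[OF adapted[of j]]) auto
    qed
    have S: "?S i \<in> borel_measurable M" using G.subalg S' by (rule measurable_from_subalg)
    have S2: "integrable M (\<lambda>x. (?S i x)\<^sup>2)" and D2: "integrable M (\<lambda>x. (D (Suc i) x)\<^sup>2)"
      using Suc square by auto
    have SD: "integrable M (\<lambda>x. ?S i x * D (Suc i) x)"
      by (intro integrable_mult_if_square_integrable S D S2 D2)
    have "expectation (\<lambda>x. ?S i x * D (Suc i) x)
        = expectation (\<lambda>x. ?S i x * real_cond_exp M (F i) (D (Suc i)) x)"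
      using G.real_cond_exp_intg(2)[OF SD S' D] by simp
    also have "\<dots> = expectation (\<lambda>x. 0)"
      using centred[of "Suc i"] Suc.prems S by (intro integral_cong_AE) auto
    finally have zero: "expectation (\<lambda>x. ?S i x * D (Suc i) x) = 0" by simp
    have eq: "(?S (Suc i) x)\<^sup>2 = (?S i x)\<^sup>2 + (D (Suc i) x)\<^sup>2 + 2 * (?S i x * D (Suc i) x)" for x
      by (simp add: power2_sum algebra_simps)
    show ?case unfolding eq using S2 D2 SD zero Suc by simp
  qed
  then show ?thesis by simp
qed

lemma expectation_abs_martingale_le:
  fixes X :: "nat \<Rightarrow> 'b \<Rightarrow> real"
  assumes adapted: "\<And>j. j \<in> {1..k} \<Longrightarrow> X j \<in> borel_measurable (F j)"
    and square: "\<And>j. j \<in> {1..k} \<Longrightarrow> integrable M (\<lambda>x. (X j x)\<^sup>2)"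
  shows "expectation (\<lambda>x. \<bar>\<Sum>j=1..k. X j x - real_cond_exp M (F (j - 1)) (X j) x\<bar>)
    \<le> sqrt (\<Sum>j=1..k. expectation (\<lambda>x. (X j x)\<^sup>2))"
proof -
  define D where "D = (\<lambda>j x. X j x - real_cond_exp M (F (j - 1)) (X j) x)"
  have X: "X j \<in> borel_measurable M" if "j \<in> {1..k}" for j
    using that by (intro measurable_from_subalg[OF filtration_subalgebra adapted]) auto
  have sub: "finite_measure_subalgebra M (F (j - 1))" if "j \<in> {1..k}" for j
    using that by (intro finite_measure_subalgebra) auto
  have D_meas: "D j \<in> borel_measurable (F j)" if "j \<in> {1..k}" for j
    unfolding D_def using that
    by (intro borel_measurable_diff adapted measurable_filtration[OF borel_measurable_cond_exp]) auto
  have D2: "integrable M (\<lambda>x. (D j x)\<^sup>2)" if "j \<in> {1..k}" for j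
    unfolding D_def
    using finite_measure_subalgebra.real_cond_exp_square_integrable[OF sub[OF that] X[OF that] square[OF that]]
    by (intro square_integrable_diff X square that) auto
  have le: "expectation (\<lambda>x. (D j x)\<^sup>2) \<le> expectation (\<lambda>x. (X j x)\<^sup>2)" if "j \<in> {1..k}" for j
    unfolding D_def
    using finite_measure_subalgebra.real_cond_exp_residual(2)[OF sub[OF that] X[OF that] square[OF that]] .
  have D0: "AE x in M. real_cond_exp M (F (j - 1)) (D j) x = 0" if "j \<in> {1..k}" for j
    unfolding D_def
    using finite_measure_subalgebra.real_cond_exp_residual(1)[OF sub[OF that] X[OF that] square[OF that]] .
  note S = martingale_second_moment[of D, OF D_meas D2 D0]
  have "expectation (\<lambda>x. \<bar>\<Sum>j=1..k. D j x\<bar>) \<le> sqrt (expectation (\<lambda>x. (\<Sum>j=1..k. D j x)\<^sup>2))"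
  proof (rule expectation_abs_le_sqrt)
    show "(\<lambda>x. \<Sum>j=1..k. D j x) \<in> borel_measurable M"
      using measurable_from_subalg[OF filtration_subalgebra D_meas] by (intro borel_measurable_sum) simp
  qed (use S in blast)
  also have "\<dots> \<le> sqrt (\<Sum>j=1..k. expectation (\<lambda>x. (X j x)\<^sup>2))"
    using S le by (auto intro!: real_sqrt_le_mono sum_mono)
  finally show ?thesis by (simp add: D_def)
qed

end


section \<open>The quadratic expansion of a product of squared increments\<close>

text \<open>The expression inside the absolute value vanishes at \<open>0\<close> and has derivative \<open>2 t\<^sup>2 / (1 + t)\<close> at
  \<open>t\<close>, which is at most \<open>4 z\<^sup>2\<close> between \<open>0\<close> and \<open>z\<close>.\<close>

lemma ln_one_plus_quadratic_bound:
  fixes z :: real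
  assumes "\<bar>z\<bar> \<le> 1/2"
  shows "\<bar>2 * ln (1 + z) - 2 * z + z\<^sup>2\<bar> \<le> 4 * \<bar>z\<bar> * z\<^sup>2"
proof (cases "z = 0")
  case False
  define g where "g = (\<lambda>t::real. 2 * ln (1 + t) - 2 * t + t\<^sup>2)"
  have deriv: "(g has_real_derivative 2 * t\<^sup>2 / (1 + t)) (at t)" if "\<bar>t\<bar> \<le> 1/2" for t
    unfolding g_def using that
    by (auto intro!: derivative_eq_intros simp: field_simps power2_eq_square)
  have "\<exists>t. \<bar>t\<bar> \<le> \<bar>z\<bar> \<and> g z - g 0 = z * (2 * t\<^sup>2 / (1 + t))"
  proof (cases "0 < z")
    case True
    obtain t where t: "0 < t" "t < z" "g z - g 0 = (z - 0) * (2 * t\<^sup>2 / (1 + t))"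
      using MVT2[OF True, of g "\<lambda>t. 2 * t\<^sup>2 / (1 + t)"] deriv assms by force
    then show ?thesis by (intro exI[of _ t]) auto
  next
    case z: False
    then have "z < 0" using \<open>z \<noteq> 0\<close> by simp
    obtain t where t: "z < t" "t < 0" "g 0 - g z = (0 - z) * (2 * t\<^sup>2 / (1 + t))"
      using MVT2[OF \<open>z < 0\<close>, of g "\<lambda>t. 2 * t\<^sup>2 / (1 + t)"] deriv assms by force
    then show ?thesis by (intro exI[of _ t]) auto
  qed
  then obtain t where t: "\<bar>t\<bar> \<le> \<bar>z\<bar>" "g z - g 0 = z * (2 * t\<^sup>2 / (1 + t))" by blast
  have t2: "t\<^sup>2 \<le> z\<^sup>2" using t(1) by (rule abs_le_square_iff[THEN iffD1])
  have "1/2 \<le> 1 + t" using t(1) assms by linarith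
  then have "2 * t\<^sup>2 / (1 + t) \<le> 2 * t\<^sup>2 / (1/2)" by (intro divide_left_mono) auto
  then have 1: "2 * t\<^sup>2 / (1 + t) \<le> 4 * z\<^sup>2" using t2 by simp
  have "\<bar>g z\<bar> = \<bar>z\<bar> * (2 * t\<^sup>2 / (1 + t))"
    using t(2) \<open>1/2 \<le> 1 + t\<close> by (simp add: g_def abs_mult)
  also have "\<dots> \<le> \<bar>z\<bar> * (4 * z\<^sup>2)" using 1 by (intro mult_left_mono) auto
  finally show ?thesis by (simp add: g_def)
qed simp

lemma abs_mult_le_squares:
  fixes a b \<delta> :: real
  assumes "0 < \<delta>"
  shows "\<bar>a\<bar> * \<bar>b\<bar> \<le> a\<^sup>2 / \<delta> + \<delta> * b\<^sup>2"
proof -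
  have "0 \<le> (\<bar>a\<bar> - \<delta> * \<bar>b\<bar>)\<^sup>2" by simp
  then have "2 * (\<delta> * (\<bar>a\<bar> * \<bar>b\<bar>)) \<le> a\<^sup>2 + \<delta>\<^sup>2 * b\<^sup>2"
    by (simp add: power2_diff power_mult_distrib algebra_simps)
  moreover have "0 \<le> \<delta> * (\<bar>a\<bar> * \<bar>b\<bar>)" using assms by simp
  ultimately have "\<delta> * (\<bar>a\<bar> * \<bar>b\<bar>) \<le> a\<^sup>2 + \<delta>\<^sup>2 * b\<^sup>2" by linarith
  then show ?thesis using assms by (simp add: field_simps power2_eq_square)
qed

text \<open>\<open>(1 + Z n j)\<^sup>2\<close> plays the role of a conditional likelihood ratio and \<open>u n j / 2\<close> that of the derivative
  of its root. Accordingly the conditional expectation of \<open>1 - (1 + Z n j)\<^sup>2\<close> is the mass that the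
  alternative puts outside the support of the base measure. The two assumptions on this mass determine the
  drift of \<open>Z\<close>.\<close>

locale increment_array =
  fixes M :: "nat \<Rightarrow> 'b measure" and F :: "nat \<Rightarrow> nat \<Rightarrow> 'b measure" and m :: "nat \<Rightarrow> nat"
    and Z u :: "nat \<Rightarrow> nat \<Rightarrow> 'b \<Rightarrow> real" and K :: real
  assumes filtration: "finite_filtration (M n) (F n) (m n)"
    and Z_adapted: "j \<in> {1..m n} \<Longrightarrow> Z n j \<in> borel_measurable (F n j)"
    and u_adapted: "j \<in> {1..m n} \<Longrightarrow> u n j \<in> borel_measurable (F n j)"
    and Z_square: "j \<in> {1..m n} \<Longrightarrow> integrable (M n) (\<lambda>x. (Z n j x)\<^sup>2)"
    and u_square: "j \<in> {1..m n} \<Longrightarrow> integrable (M n) (\<lambda>x. (u n j x)\<^sup>2)"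
    and approximation: "(\<lambda>n. \<Sum>j=1..m n. \<integral>x. (Z n j x - u n j x / 2)\<^sup>2 \<partial>M n) \<longlonglongrightarrow> 0"
    and u_centred: "j \<in> {1..m n} \<Longrightarrow> AE x in M n. real_cond_exp (M n) (F n (j - 1)) (u n j) x = 0"
    and lindeberg: "0 < \<epsilon> \<Longrightarrow>
      (\<lambda>n. \<Sum>j=1..m n. \<integral>x. (if \<epsilon> < \<bar>u n j x\<bar> then (u n j x)\<^sup>2 else 0) \<partial>M n) \<longlonglongrightarrow> 0"
    and bounded_variance: "(\<Sum>j=1..m n. \<integral>x. (u n j x)\<^sup>2 \<partial>M n) \<le> K"
    and mass_loss: "j \<in> {1..m n} \<Longrightarrow>
      AE x in M n. 0 \<le> real_cond_exp (M n) (F n (j - 1)) (\<lambda>x. 1 - (1 + Z n j x)\<^sup>2) x"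
    and mass_loss_vanishes: "(\<lambda>n. \<Sum>j=1..m n. \<integral>x. 1 - (1 + Z n j x)\<^sup>2 \<partial>M n) \<longlonglongrightarrow> 0"
begin

abbreviation cexp :: "nat \<Rightarrow> nat \<Rightarrow> ('b \<Rightarrow> real) \<Rightarrow> 'b \<Rightarrow> real" where
  "cexp n j \<equiv> real_cond_exp (M n) (F n (j - 1))"

abbreviation d :: "nat \<Rightarrow> nat \<Rightarrow> 'b \<Rightarrow> real" where
  "d n j \<equiv> \<lambda>x. Z n j x - u n j x / 2"

abbreviation gap :: "nat \<Rightarrow> nat \<Rightarrow> 'b \<Rightarrow> real" where
  "gap n j x \<equiv> (Z n j x)\<^sup>2 - (u n j x)\<^sup>2 / 4"

abbreviation large :: "real \<Rightarrow> nat \<Rightarrow> nat \<Rightarrow> 'b \<Rightarrow> real" where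
  "large \<delta> n j x \<equiv> (if \<delta> < \<bar>u n j x\<bar> then (u n j x)\<^sup>2 else 0)"

lemma prob_M: "prob_space (M n)"
  using filtration finite_filtration.axioms(1) by blast

lemma finite_M: "finite_measure (M n)"
  by (rule prob_space.finite_measure[OF prob_M])

lemma sub_F: "j \<in> {1..m n} \<Longrightarrow> finite_measure_subalgebra (M n) (F n (j - 1))"
  by (rule finite_filtration.finite_measure_subalgebra[OF filtration]) auto

lemma Z_meas: "j \<in> {1..m n} \<Longrightarrow> Z n j \<in> borel_measurable (M n)"
  using measurable_from_subalg[OF finite_filtration.filtration_subalgebra[OF filtration] Z_adapted] by simp

lemma u_meas: "j \<in> {1..m n} \<Longrightarrow> u n j \<in> borel_measurable (M n)"
  using measurable_from_subalg[OF finite_filtration.filtration_subalgebra[OF filtration] u_adapted] by simp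

lemma Z_int: "j \<in> {1..m n} \<Longrightarrow> integrable (M n) (Z n j)"
  by (rule finite_measure.square_integrable_imp_integrable[OF finite_M Z_meas Z_square])

lemma u_int: "j \<in> {1..m n} \<Longrightarrow> integrable (M n) (u n j)"
  by (rule finite_measure.square_integrable_imp_integrable[OF finite_M u_meas u_square])

lemma d_square: "j \<in> {1..m n} \<Longrightarrow> integrable (M n) (\<lambda>x. (d n j x)\<^sup>2)"
  using u_square[of j n]
  by (intro square_integrable_diff Z_meas Z_square borel_measurable_divide u_meas) (auto simp: power_divide)

text \<open>With \<open>d = Z - u / 2\<close> one has \<open>Z\<^sup>2 - u\<^sup>2 / 4 = d\<^sup>2 + d u\<close>. The mixed product is split with weight
  \<open>\<delta>\<close>, because the squares of \<open>u\<close> are only bounded in total while those of \<open>d\<close> vanish.\<close>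

lemma sum_squares_close:
  "(\<lambda>n. \<Sum>j=1..m n. \<integral>x. \<bar>gap n j x\<bar> \<partial>M n) \<longlonglongrightarrow> 0"
proof (rule tendsto_zero_if_small_multiples[where C=K and
      b="\<lambda>\<delta> n. (1 + 1/\<delta>) * (\<Sum>j=1..m n. \<integral>x. (d n j x)\<^sup>2 \<partial>M n)"])
  fix \<delta> :: real and n assume \<delta>: "0 < \<delta>"
  have "(\<integral>x. \<bar>gap n j x\<bar> \<partial>M n)
      \<le> \<delta> * (\<integral>x. (u n j x)\<^sup>2 \<partial>M n) + (1 + 1/\<delta>) * (\<integral>x. (d n j x)\<^sup>2 \<partial>M n)" if j: "j \<in> {1..m n}" for j
  proof -
    have "(\<integral>x. \<bar>gap n j x\<bar> \<partial>M n)
        \<le> (\<integral>x. \<delta> * (u n j x)\<^sup>2 + (1 + 1/\<delta>) * (d n j x)\<^sup>2 \<partial>M n)"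
    proof (rule integral_mono)
      fix x
      have "\<bar>gap n j x\<bar> = \<bar>(d n j x)\<^sup>2 + d n j x * u n j x\<bar>"
        by (simp add: power2_eq_square algebra_simps)
      also have "\<dots> \<le> (d n j x)\<^sup>2 + \<bar>d n j x\<bar> * \<bar>u n j x\<bar>"
        by (rule order_trans[OF abs_triangle_ineq]) (simp add: abs_mult)
      also have "\<dots> \<le> (d n j x)\<^sup>2 + ((d n j x)\<^sup>2 / \<delta> + \<delta> * (u n j x)\<^sup>2)"
        using abs_mult_le_squares[OF \<delta>] by (intro add_left_mono)
      finally show "\<bar>gap n j x\<bar> \<le> \<delta> * (u n j x)\<^sup>2 + (1 + 1/\<delta>) * (d n j x)\<^sup>2"
        by (simp add: algebra_simps)
    qed (use j Z_square u_square d_square in auto)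
    then show ?thesis using j u_square d_square by simp
  qed
  then have "(\<Sum>j=1..m n. \<integral>x. \<bar>gap n j x\<bar> \<partial>M n)
      \<le> (\<Sum>j=1..m n. \<delta> * (\<integral>x. (u n j x)\<^sup>2 \<partial>M n) + (1 + 1/\<delta>) * (\<integral>x. (d n j x)\<^sup>2 \<partial>M n))"
    by (rule sum_mono)
  also have "\<dots> = \<delta> * (\<Sum>j=1..m n. \<integral>x. (u n j x)\<^sup>2 \<partial>M n)
      + (1 + 1/\<delta>) * (\<Sum>j=1..m n. \<integral>x. (d n j x)\<^sup>2 \<partial>M n)"
    by (simp add: sum.distrib sum_distrib_left)
  also have "\<dots> \<le> \<delta> * K + (1 + 1/\<delta>) * (\<Sum>j=1..m n. \<integral>x. (d n j x)\<^sup>2 \<partial>M n)"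
    using \<delta> bounded_variance by (intro add_right_mono mult_left_mono) auto
  finally show "(\<Sum>j=1..m n. \<integral>x. \<bar>gap n j x\<bar> \<partial>M n)
      \<le> \<delta> * K + (1 + 1/\<delta>) * (\<Sum>j=1..m n. \<integral>x. (d n j x)\<^sup>2 \<partial>M n)" .
next
  fix \<delta> :: real
  show "(\<lambda>n. (1 + 1/\<delta>) * (\<Sum>j=1..m n. \<integral>x. (d n j x)\<^sup>2 \<partial>M n)) \<longlonglongrightarrow> 0"
    using tendsto_mult_left[OF approximation, of "1 + 1/\<delta>"] by simp
qed (auto intro!: sum_nonneg)

lemma vanishes_in_mean_sum_bound:
  fixes Y :: "nat \<Rightarrow> nat \<Rightarrow> 'b \<Rightarrow> real"
  assumes int: "\<And>n j. j \<in> {1..m n} \<Longrightarrow> integrable (M n) (Y n j)"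
    and le: "\<And>n j. j \<in> {1..m n} \<Longrightarrow> (\<integral>x. \<bar>Y n j x\<bar> \<partial>M n) \<le> b n j"
    and lim: "(\<lambda>n. \<Sum>j=1..m n. b n j) \<longlonglongrightarrow> 0"
  shows "vanishes_in_mean M (\<lambda>n x. \<Sum>j=1..m n. Y n j x)"
proof (rule vanishes_in_mean_bound[OF _ _ lim])
  show "integrable (M n) (\<lambda>x. \<Sum>j=1..m n. Y n j x)" for n using int by auto
  fix n
  have "(\<integral>x. \<bar>\<Sum>j=1..m n. Y n j x\<bar> \<partial>M n) \<le> (\<integral>x. (\<Sum>j=1..m n. \<bar>Y n j x\<bar>) \<partial>M n)"
    using int by (intro integral_mono integrable_abs Bochner_Integration.integrable_sum sum_abs)
  also have "\<dots> = (\<Sum>j=1..m n. \<integral>x. \<bar>Y n j x\<bar> \<partial>M n)"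
    using int by (intro Bochner_Integration.integral_sum) auto
  also have "\<dots> \<le> (\<Sum>j=1..m n. b n j)" using le by (rule sum_mono)
  finally show "(\<integral>x. \<bar>\<Sum>j=1..m n. Y n j x\<bar> \<partial>M n) \<le> (\<Sum>j=1..m n. b n j)" .
qed

lemma sum_square_difference_vanishes:
  "vanishes_in_mean M (\<lambda>n x. \<Sum>j=1..m n. gap n j x)"
  using Z_square u_square by (intro vanishes_in_mean_sum_bound[OF _ order_refl sum_squares_close]) auto

lemma sum_conditional_square_difference_vanishes:
  "vanishes_in_mean M (\<lambda>n x. \<Sum>j=1..m n. cexp n j (gap n j) x)"
proof (rule vanishes_in_mean_sum_bound[OF _ _ sum_squares_close])
  fix n j assume j: "j \<in> {1..m n}"
  interpret finite_measure_subalgebra "M n" "F n (j - 1)" by (rule sub_F[OF j])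
  have int: "integrable (M n) (gap n j)" using Z_square u_square j by auto
  then show "integrable (M n) (cexp n j (gap n j))" by (rule real_cond_exp_int)
  show "(\<integral>x. \<bar>cexp n j (gap n j) x\<bar> \<partial>M n)
      \<le> (\<integral>x. \<bar>gap n j x\<bar> \<partial>M n)"
    using int by (rule expectation_abs_real_cond_exp_le)
qed

lemma mass_loss_int: "j \<in> {1..m n} \<Longrightarrow> integrable (M n) (\<lambda>x. 1 - (1 + Z n j x)\<^sup>2)"
proof -
  assume j: "j \<in> {1..m n}"
  interpret finite_measure "M n" by (rule finite_M)
  have "integrable (M n) (\<lambda>x. - (2 * Z n j x) - (Z n j x)\<^sup>2)" using Z_int Z_square j by auto
  then show ?thesis by (simp add: power2_sum algebra_simps)
qed

text \<open>The conditional mass loss is nonnegative, so its mean absolute value is just its expectation.\<close>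

lemma sum_conditional_mass_loss_vanishes:
  "vanishes_in_mean M (\<lambda>n x. \<Sum>j=1..m n. cexp n j (\<lambda>x. 1 - (1 + Z n j x)\<^sup>2) x)"
proof (rule vanishes_in_mean_sum_bound[OF _ _ mass_loss_vanishes])
  fix n j assume j: "j \<in> {1..m n}"
  interpret finite_measure_subalgebra "M n" "F n (j - 1)" by (rule sub_F[OF j])
  note int = mass_loss_int[OF j]
  show "integrable (M n) (cexp n j (\<lambda>x. 1 - (1 + Z n j x)\<^sup>2))" using int by (rule real_cond_exp_int)
  have "(\<integral>x. \<bar>cexp n j (\<lambda>x. 1 - (1 + Z n j x)\<^sup>2) x\<bar> \<partial>M n) = (\<integral>x. cexp n j (\<lambda>x. 1 - (1 + Z n j x)\<^sup>2) x \<partial>M n)"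
    using mass_loss[OF j] by (intro integral_cong_AE) auto
  also have "\<dots> = (\<integral>x. 1 - (1 + Z n j x)\<^sup>2 \<partial>M n)" using int by (rule real_cond_exp_int)
  finally show "(\<integral>x. \<bar>cexp n j (\<lambda>x. 1 - (1 + Z n j x)\<^sup>2) x\<bar> \<partial>M n) \<le> (\<integral>x. 1 - (1 + Z n j x)\<^sup>2 \<partial>M n)" by simp
qed

text \<open>The sum is a martingale whose second moment is at most the total second moment of the errors.\<close>

lemma sum_compensated_error_vanishes:
  "vanishes_in_mean M (\<lambda>n x. \<Sum>j=1..m n. d n j x - cexp n j (d n j) x)"
proof (rule vanishes_in_mean_bound)
  fix n
  have d_adapted: "d n j \<in> borel_measurable (F n j)" if "j \<in> {1..m n}" for j
    using Z_adapted[OF that] u_adapted[OF that] by measurable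
  have d_int: "integrable (M n) (d n j)" if "j \<in> {1..m n}" for j
    using Z_int[OF that] u_int[OF that] by simp
  show "integrable (M n) (\<lambda>x. \<Sum>j=1..m n. d n j x - cexp n j (d n j) x)"
  proof (intro Bochner_Integration.integrable_sum Bochner_Integration.integrable_diff)
    fix j assume j: "j \<in> {1..m n}"
    interpret finite_measure_subalgebra "M n" "F n (j - 1)" by (rule sub_F[OF j])
    show "integrable (M n) (cexp n j (d n j))" using d_int[OF j] by (rule real_cond_exp_int)
  qed (use Z_int u_int in auto)
  show "(\<integral>x. \<bar>\<Sum>j=1..m n. d n j x - cexp n j (d n j) x\<bar> \<partial>M n)
      \<le> sqrt (\<Sum>j=1..m n. \<integral>x. (d n j x)\<^sup>2 \<partial>M n)"
    using finite_filtration.expectation_abs_martingale_le[OF filtration, of n "d n", OF d_adapted d_square] .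
next
  show "(\<lambda>n. sqrt (\<Sum>j=1..m n. \<integral>x. (d n j x)\<^sup>2 \<partial>M n)) \<longlonglongrightarrow> 0"
    using tendsto_real_sqrt[OF approximation] by simp
qed

text \<open>A law of large numbers. The squares themselves need not have second moments, so each of them is split
  according to whether \<open>\<bar>u\<bar>\<close> exceeds \<open>\<delta>\<close>. The compensated small parts form a martingale with
  second moment at most \<open>\<delta>\<^sup>2 K\<close>, and the large parts have small expectation by the Lindeberg condition.\<close>

lemma sum_compensated_square_vanishes:
  "vanishes_in_mean M (\<lambda>n x. \<Sum>j=1..m n. (u n j x)\<^sup>2 - cexp n j (\<lambda>x. (u n j x)\<^sup>2) x)"
  (is "vanishes_in_mean M ?X")
  unfolding vanishes_in_mean_def
proof
  show X_int: "\<forall>n. integrable (M n) (?X n)"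
  proof (intro allI Bochner_Integration.integrable_sum Bochner_Integration.integrable_diff)
    fix n j assume j: "j \<in> {1..m n}"
    interpret finite_measure_subalgebra "M n" "F n (j - 1)" by (rule sub_F[OF j])
    show "integrable (M n) (cexp n j (\<lambda>x. (u n j x)\<^sup>2))" using u_square[OF j] by (rule real_cond_exp_int)
  qed (use u_square in auto)
  show "(\<lambda>n. \<integral>x. \<bar>?X n x\<bar> \<partial>M n) \<longlonglongrightarrow> 0"
  proof (rule tendsto_zero_if_small_multiples[where C="sqrt K" and
        b="\<lambda>\<delta> n. 2 * (\<Sum>j=1..m n. \<integral>x. (large \<delta> n j x) \<partial>M n)"])
    fix \<delta> :: real and n assume \<delta>: "0 < \<delta>"
    interpret finite_filtration "M n" "F n" "m n" by (rule filtration)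
    define v where "v = (\<lambda>j x. if \<delta> < \<bar>u n j x\<bar> then 0 else (u n j x)\<^sup>2)"
    define w where "w = (\<lambda>j x. large \<delta> n j x)"
    let ?V = "\<lambda>x. \<Sum>j=1..m n. v j x - cexp n j (v j) x"
    let ?W = "\<lambda>x. \<Sum>j=1..m n. \<bar>w j x\<bar> + \<bar>cexp n j (w j) x\<bar>"
    have v_adapted: "v j \<in> borel_measurable (F n j)" and w_adapted: "w j \<in> borel_measurable (F n j)"
      if "j \<in> {1..m n}" for j
      unfolding v_def w_def using u_adapted[OF that] by measurable
    have v_meas: "v j \<in> borel_measurable (M n)" and w_meas: "w j \<in> borel_measurable (M n)" if "j \<in> {1..m n}" for j
      unfolding v_def w_def using u_meas[OF that] by measurable
    have v_le: "(v j x)\<^sup>2 \<le> \<delta>\<^sup>2 * (u n j x)\<^sup>2" for j x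
    proof (cases "\<delta> < \<bar>u n j x\<bar>")
      case False
      then have "(u n j x)\<^sup>2 \<le> \<delta>\<^sup>2" using \<delta> by (intro abs_le_square_iff[THEN iffD1]) simp
      then have "(u n j x)\<^sup>2 * (u n j x)\<^sup>2 \<le> \<delta>\<^sup>2 * (u n j x)\<^sup>2" by (rule mult_right_mono) simp
      with False show ?thesis by (simp add: v_def power2_eq_square)
    qed (simp add: v_def)
    have v_int: "integrable (M n) (v j)" and w_int: "integrable (M n) (w j)" if "j \<in> {1..m n}" for j
      by (rule Bochner_Integration.integrable_bound[OF u_square[OF that] v_meas[OF that]]; simp add: v_def)
         (rule Bochner_Integration.integrable_bound[OF u_square[OF that] w_meas[OF that]]; simp add: w_def)
    have v2_int: "integrable (M n) (\<lambda>x. (v j x)\<^sup>2)" if "j \<in> {1..m n}" for j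
      by (rule Bochner_Integration.integrable_bound[where f="\<lambda>x. \<delta>\<^sup>2 * (u n j x)\<^sup>2"])
         (use u_square[OF that] v_meas[OF that] v_le in auto)
    have v2_le: "(\<integral>x. (v j x)\<^sup>2 \<partial>M n) \<le> \<delta>\<^sup>2 * (\<integral>x. (u n j x)\<^sup>2 \<partial>M n)" if "j \<in> {1..m n}" for j
      using integral_mono[OF v2_int[OF that], of "\<lambda>x. \<delta>\<^sup>2 * (u n j x)\<^sup>2"] v_le u_square[OF that] by simp
    have sub: "finite_measure_subalgebra (M n) (F n (j - 1))" if "j \<in> {1..m n}" for j
      using that by (rule sub_F)
    have cv_int: "integrable (M n) (cexp n j (v j))" and cw_int: "integrable (M n) (cexp n j (w j))"
      if j: "j \<in> {1..m n}" for j
    proof -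
      interpret finite_measure_subalgebra "M n" "F n (j - 1)" by (rule sub_F[OF j])
      show "integrable (M n) (cexp n j (v j))" "integrable (M n) (cexp n j (w j))"
        by (rule real_cond_exp_int(1)[OF v_int[OF j]], rule real_cond_exp_int(1)[OF w_int[OF j]])
    qed
    have split: "AE x in M n. (u n j x)\<^sup>2 - cexp n j (\<lambda>x. (u n j x)\<^sup>2) x
        = (v j x - cexp n j (v j) x) + (w j x - cexp n j (w j) x)" if j: "j \<in> {1..m n}" for j
    proof -
      interpret finite_measure_subalgebra "M n" "F n (j - 1)" by (rule sub_F[OF j])
      have eq: "(u n j x)\<^sup>2 = v j x + w j x" for x by (simp add: v_def w_def)
      show ?thesis unfolding eq using real_cond_exp_add[OF v_int[OF j] w_int[OF j]] by eventually_elim simp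
    qed
    have "AE x in M n. \<forall>j\<in>{1..m n}. (u n j x)\<^sup>2 - cexp n j (\<lambda>x. (u n j x)\<^sup>2) x
        = (v j x - cexp n j (v j) x) + (w j x - cexp n j (w j) x)"
      using split by (intro AE_finite_allI) auto
    then have "AE x in M n. \<bar>?X n x\<bar> \<le> \<bar>?V x\<bar>
        + ?W x"
    proof eventually_elim
      case (elim x)
      then have "?X n x = (?V x) + (\<Sum>j=1..m n. w j x - cexp n j (w j) x)"
        by (simp add: sum.distrib)
      moreover have "\<bar>\<Sum>j=1..m n. w j x - cexp n j (w j) x\<bar> \<le> ?W x"
        by (rule order_trans[OF sum_abs sum_mono]) (rule abs_triangle_ineq4)
      ultimately show ?case by linarith
    qed
    then have "(\<integral>x. \<bar>?X n x\<bar> \<partial>M n) \<le> (\<integral>x. \<bar>?V x\<bar>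
        + ?W x \<partial>M n)"
    proof (intro integral_mono_AE)
      show "integrable (M n) (\<lambda>x. \<bar>?X n x\<bar>)" using X_int by (intro integrable_abs) blast
      show "integrable (M n) (\<lambda>x. \<bar>?V x\<bar>
          + ?W x)"
        by (intro Bochner_Integration.integrable_add integrable_abs Bochner_Integration.integrable_sum
            Bochner_Integration.integrable_diff v_int w_int cv_int cw_int)
    qed
    also have "\<dots> = (\<integral>x. \<bar>?V x\<bar> \<partial>M n)
        + (\<Sum>j=1..m n. (\<integral>x. \<bar>w j x\<bar> \<partial>M n) + (\<integral>x. \<bar>cexp n j (w j) x\<bar> \<partial>M n))"
    proof -
      have "(\<integral>x. ?W x \<partial>M n)
          = (\<Sum>j=1..m n. \<integral>x. \<bar>w j x\<bar> + \<bar>cexp n j (w j) x\<bar> \<partial>M n)"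
        by (intro Bochner_Integration.integral_sum Bochner_Integration.integrable_add integrable_abs w_int cw_int)
      also have "\<dots> = (\<Sum>j=1..m n. (\<integral>x. \<bar>w j x\<bar> \<partial>M n) + (\<integral>x. \<bar>cexp n j (w j) x\<bar> \<partial>M n))"
        by (intro sum.cong refl Bochner_Integration.integral_add integrable_abs w_int cw_int)
      finally show ?thesis
        by (subst Bochner_Integration.integral_add)
           (intro integrable_abs Bochner_Integration.integrable_sum Bochner_Integration.integrable_add
              Bochner_Integration.integrable_diff v_int cv_int w_int cw_int | simp)+
    qed
    also have "\<dots> \<le> \<delta> * sqrt K + 2 * (\<Sum>j=1..m n. \<integral>x. w j x \<partial>M n)"
    proof (rule add_mono)
      have "(\<integral>x. \<bar>?V x\<bar> \<partial>M n) \<le> sqrt (\<Sum>j=1..m n. \<integral>x. (v j x)\<^sup>2 \<partial>M n)"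
        by (rule expectation_abs_martingale_le[OF v_adapted v2_int])
      also have "\<dots> \<le> sqrt (\<delta>\<^sup>2 * K)"
      proof (rule real_sqrt_le_mono)
        have "(\<Sum>j=1..m n. \<integral>x. (v j x)\<^sup>2 \<partial>M n) \<le> \<delta>\<^sup>2 * (\<Sum>j=1..m n. \<integral>x. (u n j x)\<^sup>2 \<partial>M n)"
          unfolding sum_distrib_left by (rule sum_mono[OF v2_le])
        also have "\<dots> \<le> \<delta>\<^sup>2 * K" using bounded_variance by (intro mult_left_mono) auto
        finally show "(\<Sum>j=1..m n. \<integral>x. (v j x)\<^sup>2 \<partial>M n) \<le> \<delta>\<^sup>2 * K" .
      qed
      also have "\<dots> = \<delta> * sqrt K" using \<delta> by (simp add: real_sqrt_mult)
      finally show "(\<integral>x. \<bar>?V x\<bar> \<partial>M n) \<le> \<delta> * sqrt K" .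
      have w_abs: "\<bar>w j x\<bar> = w j x" for j x by (simp add: w_def)
      have "(\<integral>x. \<bar>w j x\<bar> \<partial>M n) + (\<integral>x. \<bar>cexp n j (w j) x\<bar> \<partial>M n) \<le> 2 * (\<integral>x. w j x \<partial>M n)" if j: "j \<in> {1..m n}" for j
        using finite_measure_subalgebra.expectation_abs_real_cond_exp_le[OF sub_F[OF j] w_int[OF j]]
        unfolding w_abs by simp
      then show "(\<Sum>j=1..m n. (\<integral>x. \<bar>w j x\<bar> \<partial>M n) + (\<integral>x. \<bar>cexp n j (w j) x\<bar> \<partial>M n))
          \<le> 2 * (\<Sum>j=1..m n. \<integral>x. w j x \<partial>M n)"
        unfolding sum_distrib_left by (rule sum_mono)
    qed
    finally show "(\<integral>x. \<bar>?X n x\<bar> \<partial>M n) \<le> \<delta> * sqrt K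
        + 2 * (\<Sum>j=1..m n. \<integral>x. (large \<delta> n j x) \<partial>M n)"
      unfolding w_def .
  next
    fix \<delta> :: real assume "0 < \<delta>"
    then show "(\<lambda>n. 2 * (\<Sum>j=1..m n. \<integral>x. (large \<delta> n j x) \<partial>M n)) \<longlonglongrightarrow> 0"
      using tendsto_mult_left[OF lindeberg, of \<delta> 2] by simp
  qed simp
qed

text \<open>Since \<open>1 - (1 + Z)\<^sup>2 = - 2 Z - Z\<^sup>2\<close>, the conditional expectation of \<open>2 Z\<close> is that of \<open>- Z\<^sup>2\<close>
  minus the mass loss. Inserting this drift writes the left-hand side as a combination of the five sums that have
  been shown to vanish.\<close>

lemma quadratic_expansion_vanishes:
  "vanishes_in_mean M (\<lambda>n x. (\<Sum>j=1..m n. 2 * Z n j x - (Z n j x)\<^sup>2)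
     - (\<Sum>j=1..m n. u n j x) + 1/2 * (\<Sum>j=1..m n. cexp n j (\<lambda>x. (u n j x)\<^sup>2) x))"
  (is "vanishes_in_mean M ?B")
proof (rule vanishes_in_mean_AE)
  let ?A = "\<lambda>n x. 2 * (\<Sum>j=1..m n. d n j x - cexp n j (d n j) x)
     + ((- 1) * (\<Sum>j=1..m n. cexp n j (\<lambda>x. 1 - (1 + Z n j x)\<^sup>2) x)
     + ((- 1) * (\<Sum>j=1..m n. gap n j x)
     + ((- 1/4) * (\<Sum>j=1..m n. (u n j x)\<^sup>2 - cexp n j (\<lambda>x. (u n j x)\<^sup>2) x)
     + (- 1) * (\<Sum>j=1..m n. cexp n j (gap n j) x))))"
  show "vanishes_in_mean M ?A"
    by (intro vanishes_in_mean_add vanishes_in_mean_cmult sum_compensated_error_vanishes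
        sum_conditional_mass_loss_vanishes sum_square_difference_vanishes sum_compensated_square_vanishes
        sum_conditional_square_difference_vanishes)
  fix n
  show "?B n \<in> borel_measurable (M n)"
    using Z_meas u_meas by (intro borel_measurable_add borel_measurable_diff borel_measurable_times
        borel_measurable_sum borel_measurable_power borel_measurable_const borel_measurable_cond_exp2) auto
  let ?E = "\<lambda>j x. cexp n j (d n j) x = cexp n j (Z n j) x \<and>
      cexp n j (\<lambda>x. 1 - (1 + Z n j x)\<^sup>2) x = - 2 * cexp n j (Z n j) x - cexp n j (\<lambda>x. (Z n j x)\<^sup>2) x \<and>
      cexp n j (gap n j) x
        = cexp n j (\<lambda>x. (Z n j x)\<^sup>2) x - cexp n j (\<lambda>x. (u n j x)\<^sup>2) x / 4"
  have ae: "AE x in M n. ?E j x"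
    if j: "j \<in> {1..m n}" for j
  proof -
    interpret finite_measure_subalgebra "M n" "F n (j - 1)" by (rule sub_F[OF j])
    have Z: "integrable (M n) (Z n j)" and u: "integrable (M n) (u n j)"
      and Z2: "integrable (M n) (\<lambda>x. (Z n j x)\<^sup>2)" and u2: "integrable (M n) (\<lambda>x. (u n j x)\<^sup>2)"
      using j Z_int u_int Z_square u_square by auto
    have eq: "1 - (1 + Z n j x)\<^sup>2 = - 2 * Z n j x - (Z n j x)\<^sup>2" for x
      by (simp add: power2_sum)
    have "AE x in M n. cexp n j (d n j) x = cexp n j (Z n j) x - cexp n j (\<lambda>x. u n j x / 2) x"
      using Z u by (intro real_cond_exp_diff) auto
    moreover have "AE x in M n. cexp n j (\<lambda>x. u n j x / 2) x = cexp n j (u n j) x / 2"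
      using u by (rule real_cond_exp_cdiv)
    moreover have "AE x in M n. cexp n j (\<lambda>x. - 2 * Z n j x - (Z n j x)\<^sup>2) x
        = cexp n j (\<lambda>x. - 2 * Z n j x) x - cexp n j (\<lambda>x. (Z n j x)\<^sup>2) x"
      using Z Z2 by (intro real_cond_exp_diff) auto
    moreover have "AE x in M n. cexp n j (\<lambda>x. - 2 * Z n j x) x = - 2 * cexp n j (Z n j) x"
      using Z by (rule real_cond_exp_cmult)
    moreover have "AE x in M n. cexp n j (gap n j) x
        = cexp n j (\<lambda>x. (Z n j x)\<^sup>2) x - cexp n j (\<lambda>x. (u n j x)\<^sup>2 / 4) x"
      using Z2 u2 by (intro real_cond_exp_diff) auto
    moreover have "AE x in M n. cexp n j (\<lambda>x. (u n j x)\<^sup>2 / 4) x = cexp n j (\<lambda>x. (u n j x)\<^sup>2) x / 4"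
      using u2 by (rule real_cond_exp_cdiv)
    ultimately show ?thesis using u_centred[OF j] unfolding eq by eventually_elim simp
  qed
  have "AE x in M n. \<forall>j\<in>{1..m n}. ?E j x"
    using ae by (intro AE_finite_allI) auto
  then show "AE x in M n. ?A n x = ?B n x"
  proof eventually_elim
    case (elim x)
    show ?case
      unfolding sum_distrib_left sum.distrib[symmetric] sum_subtractf[symmetric]
    proof (rule sum.cong)
      fix j assume "j \<in> {1..m n}"
      note j = elim[rule_format, OF this]
      show "2 * (d n j x - cexp n j (d n j) x) + ((- 1) * cexp n j (\<lambda>x. 1 - (1 + Z n j x)\<^sup>2) x
          + ((- 1) * (gap n j x)
          + ((- 1/4) * ((u n j x)\<^sup>2 - cexp n j (\<lambda>x. (u n j x)\<^sup>2) x)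
          + (- 1) * cexp n j (gap n j) x)))
        = 2 * Z n j x - (Z n j x)\<^sup>2 - u n j x + 1/2 * cexp n j (\<lambda>x. (u n j x)\<^sup>2) x"
        unfolding j[THEN conjunct1] j[THEN conjunct2, THEN conjunct1] j[THEN conjunct2, THEN conjunct2]
        by (simp add: field_simps)
    qed simp
  qed
qed

text \<open>If \<open>\<bar>Z\<bar> > \<delta>\<close>, then either \<open>\<bar>u\<bar> > \<delta>\<close> or the approximation error exceeds \<open>\<delta> / 2\<close>. Both
  events have small total probability by Chebyshev's inequality, the first one by the Lindeberg condition.\<close>

lemma large_increment_vanishes:
  assumes \<delta>: "0 < \<delta>"
  shows "(\<lambda>n. measure (M n) {x\<in>space (M n). \<exists>j\<in>{1..m n}. \<delta> < \<bar>Z n j x\<bar>}) \<longlonglongrightarrow> 0"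
proof (rule tendsto_zero_le[OF measure_nonneg])
  let ?b = "\<lambda>n. 4 / \<delta>\<^sup>2 * (\<Sum>j=1..m n. \<integral>x. (d n j x)\<^sup>2 \<partial>M n)
    + 1 / \<delta>\<^sup>2 * (\<Sum>j=1..m n. \<integral>x. (large \<delta> n j x) \<partial>M n)"
  show "?b \<longlonglongrightarrow> 0"
    using tendsto_add[OF tendsto_mult_left[OF approximation, of "4 / \<delta>\<^sup>2"]
        tendsto_mult_left[OF lindeberg[OF \<delta>], of "1 / \<delta>\<^sup>2"]] by simp
  fix n
  interpret prob_space "M n" by (rule prob_M)
  have [measurable]: "Measurable.pred (M n) (\<lambda>x. \<exists>j\<in>{1..m n}. \<delta> < \<bar>Z n j x\<bar>)"
  proof (rule pred_intros_finite(4))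
    fix j assume "j \<in> {1..m n}"
    from Z_meas[OF this] show "Measurable.pred (M n) (\<lambda>x. \<delta> < \<bar>Z n j x\<bar>)" by measurable
  qed simp
  let ?A = "{x\<in>space (M n). \<exists>j\<in>{1..m n}. \<delta> < \<bar>Z n j x\<bar>}"
  let ?w = "\<lambda>j x. large \<delta> n j x"
  have w_int: "integrable (M n) (?w j)" if "j \<in> {1..m n}" for j
    using u_square[OF that] u_meas[OF that]
    by (intro Bochner_Integration.integrable_bound[OF u_square[OF that]]) auto
  have w_nonneg: "0 \<le> ?w j x" for j x by simp
  have "?A \<inter> space (M n) = ?A" by blast
  then have "measure (M n) ?A = (\<integral>x. indicator ?A x \<partial>M n)"
    by (simp only: Bochner_Integration.integral_indicator)
  also have "\<dots> \<le> (\<integral>x. (\<Sum>j=1..m n. 4 / \<delta>\<^sup>2 * (d n j x)\<^sup>2 + 1 / \<delta>\<^sup>2 * ?w j x) \<partial>M n)"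
  proof (rule integral_mono)
    have "?A \<in> sets (M n)" by measurable
    then show "integrable (M n) (\<lambda>x. indicator ?A x :: real)"
      by (intro integrable_real_indicator) (auto simp: emeasure_eq_measure)
    show "integrable (M n) (\<lambda>x. \<Sum>j=1..m n. 4 / \<delta>\<^sup>2 * (d n j x)\<^sup>2 + 1 / \<delta>\<^sup>2 * ?w j x)"
      by (intro Bochner_Integration.integrable_sum Bochner_Integration.integrable_add integrable_mult_right
          d_square w_int)
    fix x
    have nonneg: "0 \<le> 4 / \<delta>\<^sup>2 * (d n j x)\<^sup>2 + 1 / \<delta>\<^sup>2 * ?w j x" for j
      by (intro add_nonneg_nonneg mult_nonneg_nonneg) auto
    show "indicator ?A x \<le> (\<Sum>j=1..m n. 4 / \<delta>\<^sup>2 * (d n j x)\<^sup>2 + 1 / \<delta>\<^sup>2 * ?w j x)"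
    proof (cases "x \<in> ?A")
      case True
      then obtain j where j: "j \<in> {1..m n}" "\<delta> < \<bar>Z n j x\<bar>" by blast
      have "1 \<le> 4 / \<delta>\<^sup>2 * (d n j x)\<^sup>2 + 1 / \<delta>\<^sup>2 * ?w j x"
      proof (cases "\<delta> < \<bar>u n j x\<bar>")
        case True
        then have "\<delta>\<^sup>2 \<le> (u n j x)\<^sup>2" using \<delta> by (intro abs_le_square_iff[THEN iffD1]) simp
        then have "1 \<le> 1 / \<delta>\<^sup>2 * (u n j x)\<^sup>2" using \<delta> by (simp add: field_simps)
        moreover have "0 \<le> 4 / \<delta>\<^sup>2 * (d n j x)\<^sup>2" by simp
        ultimately show ?thesis by (subst if_P[OF True]) linarith
      next
        case False
        then have "\<bar>\<delta> / 2\<bar> \<le> \<bar>d n j x\<bar>" using j(2) \<delta> by linarith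
        then have "(\<delta> / 2)\<^sup>2 \<le> (d n j x)\<^sup>2" by (rule abs_le_square_iff[THEN iffD1])
        then have "1 \<le> 4 / \<delta>\<^sup>2 * (d n j x)\<^sup>2" using \<delta> by (simp add: field_simps power_divide)
        then show ?thesis using False by simp
      qed
      also have "\<dots> \<le> (\<Sum>j=1..m n. 4 / \<delta>\<^sup>2 * (d n j x)\<^sup>2 + 1 / \<delta>\<^sup>2 * ?w j x)"
        using member_le_sum[OF j(1), of "\<lambda>j. 4 / \<delta>\<^sup>2 * (d n j x)\<^sup>2 + 1 / \<delta>\<^sup>2 * ?w j x"] nonneg by blast
      finally show ?thesis using True by simp
    next
      case False
      then show ?thesis using nonneg by (simp add: sum_nonneg del: times_divide_eq_left)
    qed
  qed
  also have "\<dots> = ?b n"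
  proof -
    have "(\<integral>x. 4 / \<delta>\<^sup>2 * (d n j x)\<^sup>2 + 1 / \<delta>\<^sup>2 * ?w j x \<partial>M n)
        = 4 / \<delta>\<^sup>2 * (\<integral>x. (d n j x)\<^sup>2 \<partial>M n) + 1 / \<delta>\<^sup>2 * (\<integral>x. ?w j x \<partial>M n)" if j: "j \<in> {1..m n}" for j
    proof -
      have "(\<integral>x. 4 / \<delta>\<^sup>2 * (d n j x)\<^sup>2 + 1 / \<delta>\<^sup>2 * ?w j x \<partial>M n)
          = (\<integral>x. 4 / \<delta>\<^sup>2 * (d n j x)\<^sup>2 \<partial>M n) + (\<integral>x. 1 / \<delta>\<^sup>2 * ?w j x \<partial>M n)"
        by (intro Bochner_Integration.integral_add integrable_mult_right d_square[OF j] w_int[OF j])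
      then show ?thesis by (simp only: integral_mult_right_zero)
    qed
    moreover have "(\<integral>x. (\<Sum>j=1..m n. 4 / \<delta>\<^sup>2 * (d n j x)\<^sup>2 + 1 / \<delta>\<^sup>2 * ?w j x) \<partial>M n)
        = (\<Sum>j=1..m n. \<integral>x. 4 / \<delta>\<^sup>2 * (d n j x)\<^sup>2 + 1 / \<delta>\<^sup>2 * ?w j x \<partial>M n)"
      by (intro Bochner_Integration.integral_sum Bochner_Integration.integrable_add integrable_mult_right
          d_square w_int)
    ultimately show ?thesis by (simp only: sum_distrib_left sum.distrib cong: sum.cong)
  qed
  finally show "measure (M n) ?A \<le> ?b n" .
qed

text \<open>As long as all increments are at most \<open>\<delta>\<close>, the remainder is at most \<open>4 \<delta>\<close> times the sum of the
  \<open>Z\<^sup>2\<close>, and the expectation of that sum stays bounded.\<close>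

lemma logarithm_remainder_vanishes:
  "vanishes_in_prob M (\<lambda>n x. \<Sum>j=1..m n. 2 * ln (1 + Z n j x) - 2 * Z n j x + (Z n j x)\<^sup>2)"
  (is "vanishes_in_prob M ?R")
  unfolding vanishes_in_prob_def
proof (intro conjI allI impI)
  show meas: "?R n \<in> borel_measurable (M n)" for n
    using Z_meas by (intro borel_measurable_add borel_measurable_diff borel_measurable_times
        borel_measurable_sum borel_measurable_power borel_measurable_const borel_measurable_ln) auto
  fix \<epsilon> :: real assume \<epsilon>: "0 < \<epsilon>"
  let ?s = "\<lambda>n. \<Sum>j=1..m n. \<integral>x. \<bar>gap n j x\<bar> \<partial>M n"
  let ?A = "\<lambda>\<delta> n. {x\<in>space (M n). \<exists>j\<in>{1..m n}. min \<delta> (1/2) < \<bar>Z n j x\<bar>}"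
  show "(\<lambda>n. measure (M n) {x\<in>space (M n). \<epsilon> < \<bar>?R n x\<bar>}) \<longlonglongrightarrow> 0"
  proof (rule tendsto_zero_if_small_multiples[where C="K / \<epsilon>" and
        b="\<lambda>\<delta> n. 4 * \<delta> / \<epsilon> * ?s n + measure (M n) (?A \<delta> n)"])
    fix \<delta> :: real assume \<delta>: "0 < \<delta>"
    have "(\<lambda>n. measure (M n) (?A \<delta> n)) \<longlonglongrightarrow> 0"
      using \<delta> by (intro large_increment_vanishes) simp
    then show "(\<lambda>n. 4 * \<delta> / \<epsilon> * ?s n + measure (M n) (?A \<delta> n)) \<longlonglongrightarrow> 0"
      using tendsto_add[OF tendsto_mult_left[OF sum_squares_close, of "4 * \<delta> / \<epsilon>"]] by fastforce
    fix n
    interpret prob_space "M n" by (rule prob_M)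
    let ?S = "\<lambda>x. \<Sum>j=1..m n. (Z n j x)\<^sup>2"
    have S_int: "integrable (M n) ?S" using Z_square by auto
    then have [measurable]: "?S \<in> borel_measurable (M n)" by simp
    have [measurable]: "Measurable.pred (M n) (\<lambda>x. \<exists>j\<in>{1..m n}. min \<delta> (1/2) < \<bar>Z n j x\<bar>)"
    proof (rule pred_intros_finite(4))
      fix j assume "j \<in> {1..m n}"
      from Z_meas[OF this] show "Measurable.pred (M n) (\<lambda>x. min \<delta> (1/2) < \<bar>Z n j x\<bar>)" by measurable
    qed simp
    let ?B = "{x\<in>space (M n). \<epsilon> / (4 * \<delta>) \<le> ?S x}"
    have B_sets: "?B \<in> sets (M n)" by measurable
    have A_sets: "?A \<delta> n \<in> sets (M n)" by measurable
    have "measure (M n) {x\<in>space (M n). \<epsilon> < \<bar>?R n x\<bar>} \<le> measure (M n) (?B \<union> ?A \<delta> n)"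
    proof (rule finite_measure_mono)
      show "{x\<in>space (M n). \<epsilon> < \<bar>?R n x\<bar>} \<subseteq> ?B \<union> ?A \<delta> n"
      proof
        fix x assume x: "x \<in> {x\<in>space (M n). \<epsilon> < \<bar>?R n x\<bar>}"
        show "x \<in> ?B \<union> ?A \<delta> n"
        proof (cases "x \<in> ?A \<delta> n")
          case False
          then have small: "\<bar>Z n j x\<bar> \<le> \<delta>" "\<bar>Z n j x\<bar> \<le> 1/2" if "j \<in> {1..m n}" for j
            using x that by (auto simp: not_less)
          have "\<epsilon> < \<bar>?R n x\<bar>" using x by simp
          also have "\<dots> \<le> (\<Sum>j=1..m n. \<bar>2 * ln (1 + Z n j x) - 2 * Z n j x + (Z n j x)\<^sup>2\<bar>)"
            by (rule sum_abs)
          also have "\<dots> \<le> (\<Sum>j=1..m n. 4 * \<delta> * (Z n j x)\<^sup>2)"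
          proof (rule sum_mono)
            fix j assume j: "j \<in> {1..m n}"
            have "4 * \<bar>Z n j x\<bar> * (Z n j x)\<^sup>2 \<le> 4 * \<delta> * (Z n j x)\<^sup>2"
              using small(1)[OF j] by (intro mult_right_mono) auto
            then show "\<bar>2 * ln (1 + Z n j x) - 2 * Z n j x + (Z n j x)\<^sup>2\<bar> \<le> 4 * \<delta> * (Z n j x)\<^sup>2"
              using ln_one_plus_quadratic_bound[OF small(2)[OF j]] by linarith
          qed
          also have "\<dots> = 4 * \<delta> * ?S x" by (simp add: sum_distrib_left)
          finally have "\<epsilon> / (4 * \<delta>) \<le> ?S x" using \<delta> by (simp add: field_simps)
          then show ?thesis using x by simp
        qed simp
      qed
    qed (intro sets.Un B_sets A_sets)
    also have "\<dots> \<le> measure (M n) ?B + measure (M n) (?A \<delta> n)" by (intro measure_Un_le B_sets A_sets)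
    also have "measure (M n) ?B \<le> (\<integral>x. ?S x \<partial>M n) / (\<epsilon> / (4 * \<delta>))"
      using S_int \<epsilon> \<delta> by (intro integral_Markov_inequality_measure[where A="space (M n)"]) (auto intro!: sum_nonneg)
    also have "(\<integral>x. ?S x \<partial>M n) \<le> ?s n + K / 4"
    proof -
      have "(\<integral>x. ?S x \<partial>M n) = (\<Sum>j=1..m n. \<integral>x. (Z n j x)\<^sup>2 \<partial>M n)"
        using Z_square by simp
      also have "\<dots> \<le> (\<Sum>j=1..m n. (\<integral>x. \<bar>gap n j x\<bar> \<partial>M n) + (\<integral>x. (u n j x)\<^sup>2 \<partial>M n) / 4)"
      proof (rule sum_mono)
        fix j assume j: "j \<in> {1..m n}"
        have "(\<integral>x. (Z n j x)\<^sup>2 \<partial>M n) \<le> (\<integral>x. \<bar>gap n j x\<bar> + (u n j x)\<^sup>2 / 4 \<partial>M n)"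
          using Z_square[OF j] u_square[OF j] by (intro integral_mono) auto
        then show "(\<integral>x. (Z n j x)\<^sup>2 \<partial>M n)
            \<le> (\<integral>x. \<bar>gap n j x\<bar> \<partial>M n) + (\<integral>x. (u n j x)\<^sup>2 \<partial>M n) / 4"
          using Z_square[OF j] u_square[OF j] by simp
      qed
      also have "\<dots> \<le> ?s n + K / 4"
        using bounded_variance[of n] by (simp add: sum.distrib sum_divide_distrib[symmetric])
      finally show ?thesis .
    qed
    also have "(?s n + K / 4) / (\<epsilon> / (4 * \<delta>)) = \<delta> * (K / \<epsilon>) + 4 * \<delta> / \<epsilon> * ?s n"
      using \<epsilon> \<delta> by (simp add: field_simps)
    finally show "measure (M n) {x\<in>space (M n). \<epsilon> < \<bar>?R n x\<bar>}
        \<le> \<delta> * (K / \<epsilon>) + (4 * \<delta> / \<epsilon> * ?s n + measure (M n) (?A \<delta> n))"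
      using \<epsilon> \<delta> by (simp add: divide_right_mono)
  qed simp
qed

theorem logarithm_expansion:
  "vanishes_in_prob M (\<lambda>n x. (\<Sum>j=1..m n. 2 * ln (1 + Z n j x))
     - (\<Sum>j=1..m n. u n j x) + 1/2 * (\<Sum>j=1..m n. cexp n j (\<lambda>x. (u n j x)\<^sup>2) x))"
proof -
  have "vanishes_in_prob M (\<lambda>n x. (\<Sum>j=1..m n. 2 * ln (1 + Z n j x) - 2 * Z n j x + (Z n j x)\<^sup>2)
     + ((\<Sum>j=1..m n. 2 * Z n j x - (Z n j x)\<^sup>2)
     - (\<Sum>j=1..m n. u n j x) + 1/2 * (\<Sum>j=1..m n. cexp n j (\<lambda>x. (u n j x)\<^sup>2) x)))"
    by (intro vanishes_in_prob_add logarithm_remainder_vanishes vanishes_in_mean_imp_prob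
        quadratic_expansion_vanishes finite_M)
  then show ?thesis by (simp add: sum.distrib sum_subtractf algebra_simps)
qed

end


section \<open>Borel sets of finite products of separable metric spaces\<close>

lemma space_borel_of: "space (borel_of X) = topspace X"
  unfolding borel_of_def using openin_subset by (auto simp: space_measure_of_conv)

lemma sets_borel_of: "sets (borel_of X) = sigma_sets (topspace X) {U. openin X U}"
  unfolding borel_of_def using openin_subset by (subst sets_measure_of) auto

lemma openin_imp_sets_borel_of: "openin X U \<Longrightarrow> U \<in> sets (borel_of X)"
  by (simp add: sets_borel_of)

lemma continuous_map_imp_measurable_borel_of:
  assumes "continuous_map X Y f"
  shows "f \<in> measurable (borel_of X) (borel_of Y)"
proof (rule measurable_sigma_sets[OF sets_borel_of])
  show "{U. openin Y U} \<subseteq> Pow (topspace Y)" using openin_subset by auto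
  show "f \<in> space (borel_of X) \<rightarrow> topspace Y"
    using assms by (auto simp: space_borel_of continuous_map_def)
  show "f -` U \<inter> space (borel_of X) \<in> sets (borel_of X)" if "U \<in> {U. openin Y U}" for U
  proof (rule openin_imp_sets_borel_of)
    have "openin X {x \<in> topspace X. f x \<in> U}" using assms that by (auto simp: continuous_map_def)
    then show "openin X (f -` U \<inter> space (borel_of X))"
      by (simp add: space_borel_of vimage_def Int_def conj_commute)
  qed
qed

text \<open>Separability makes the Borel sets of the product topology generated by boxes: an open set is the
  union of those boxes inside it whose sides are balls of a common radius \<open>1 / (k + 1)\<close> with centres in
  countable dense sets, and there are only countably many of these.\<close>

lemma openin_product_in_sets_PiM:
  fixes S :: "'i \<Rightarrow> 'a metric"
  assumes fin: "finite J" and sep: "\<And>j. j \<in> J \<Longrightarrow> separable_space (mtopology_of (S j))"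
    and U: "openin (product_topology (\<lambda>j. mtopology_of (S j)) J) U"
  shows "U \<in> sets (Pi\<^sub>M J (\<lambda>j. borel_of (mtopology_of (S j))))"
proof -
  have "\<forall>j\<in>J. \<exists>C. countable C \<and> C \<subseteq> mspace (S j) \<and> mtopology_of (S j) closure_of C = mspace (S j)"
    using sep by (simp add: separable_space_def)
  then obtain D where D: "\<And>j. j \<in> J \<Longrightarrow> countable (D j)" "\<And>j. j \<in> J \<Longrightarrow> D j \<subseteq> mspace (S j)"
    "\<And>j. j \<in> J \<Longrightarrow> mtopology_of (S j) closure_of D j = mspace (S j)"
    by metis
  define box where "box = (\<lambda>(c, k::nat). \<Pi>\<^sub>E j\<in>J. mball_of (S j) (c j) (1 / real (Suc k)))"
  define I where "I = {i \<in> (\<Pi>\<^sub>E j\<in>J. D j) \<times> UNIV. box i \<subseteq> U}"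
  have openin_ball: "openin (mtopology_of (S j)) (mball_of (S j) y e)" for j y e
    unfolding mtopology_of_def mball_of_def by (rule Metric_space.openin_mball) simp
  have "countable I"
    unfolding I_def using countable_PiE[OF fin D(1)] by (intro countable_Collect countable_SIGMA) auto
  moreover have "box i \<in> sets (Pi\<^sub>M J (\<lambda>j. borel_of (mtopology_of (S j))))" for i
    unfolding box_def by (cases i) (auto intro!: sets_PiM_I_finite fin openin_imp_sets_borel_of openin_ball)
  ultimately have "(\<Union>i\<in>I. box i) \<in> sets (Pi\<^sub>M J (\<lambda>j. borel_of (mtopology_of (S j))))"
    by (intro sets.countable_UN') auto
  moreover have "U \<subseteq> (\<Union>i\<in>I. box i)"
  proof
    fix x assume "x \<in> U"
    then obtain V where V: "\<And>j. j \<in> J \<Longrightarrow> openin (mtopology_of (S j)) (V j)"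
      "x \<in> Pi\<^sub>E J V" "Pi\<^sub>E J V \<subseteq> U"
      using U unfolding openin_product_topology_alt by meson
    have "\<exists>e>0. mball_of (S j) (x j) e \<subseteq> V j" if "j \<in> J" for j
    proof -
      have "x j \<in> V j" using V(2) that by auto
      then show ?thesis
        using V(1)[OF that] unfolding mtopology_of_def mball_of_def
        by (simp add: Metric_space.openin_mtopology)
    qed
    then obtain e where e: "\<And>j. j \<in> J \<Longrightarrow> 0 < e j" "\<And>j. j \<in> J \<Longrightarrow> mball_of (S j) (x j) (e j) \<subseteq> V j"
      by metis
    define e' where "e' = Min (insert 1 (e ` J))"
    have "0 < e'" unfolding e'_def using fin e(1) by (subst Min_gr_iff) auto
    \<comment> \<open>One half of \<open>e'\<close> is spent on the centre of the ball and one half on its radius.\<close>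
    then obtain k where k: "1 / real (Suc k) < e' / 2"
      using reals_Archimedean[of "e' / 2"] by (auto simp: field_simps)
    have e'_le: "e' \<le> e j" if "j \<in> J" for j unfolding e'_def using fin that by (intro Min_le) auto
    have x_in: "x j \<in> mspace (S j)" if "j \<in> J" for j
      using openin_subset[OF V(1)[OF that]] V(2) that by auto
    have "\<exists>c. c \<in> D j \<and> c \<in> mball_of (S j) (x j) (1 / real (Suc k))" if "j \<in> J" for j
    proof -
      have "x j \<in> mtopology_of (S j) closure_of D j" using D(3)[OF that] x_in[OF that] by simp
      moreover have "mdist (S j) (x j) (x j) = 0" using x_in[OF that] by (subst mdist_zero) auto
      then have "x j \<in> mball_of (S j) (x j) (1 / real (Suc k))"
        using x_in[OF that] by (simp del: mdist_zero)
      ultimately show ?thesis using openin_ball unfolding in_closure_of by blast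
    qed
    then obtain c where c: "\<And>j. j \<in> J \<Longrightarrow> c j \<in> D j"
      "\<And>j. j \<in> J \<Longrightarrow> c j \<in> mball_of (S j) (x j) (1 / real (Suc k))"
      by metis
    let ?c = "restrict c J"
    have "x \<in> box (?c, k)"
      using c(2) V(2) by (auto simp: box_def mdist_commute PiE_iff extensional_def)
    moreover have "box (?c, k) \<subseteq> U"
    proof
      fix y assume y: "y \<in> box (?c, k)"
      have "y j \<in> V j" if j: "j \<in> J" for j
      proof -
        have y_j: "y j \<in> mspace (S j)" "mdist (S j) (c j) (y j) < 1 / real (Suc k)"
          using y j by (auto simp: box_def PiE_iff)
        have c_j: "c j \<in> mspace (S j)" "mdist (S j) (x j) (c j) < 1 / real (Suc k)"
          using c(2)[OF j] by auto
        have "mdist (S j) (x j) (y j) \<le> mdist (S j) (x j) (c j) + mdist (S j) (c j) (y j)"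
          using x_in[OF j] y_j(1) c_j(1) by (intro mdist_triangle)
        then have "mdist (S j) (x j) (y j) < e j" using y_j c_j k e'_le[OF j] by linarith
        then have "y j \<in> mball_of (S j) (x j) (e j)" using x_in[OF j] y_j by simp
        then show ?thesis using e(2)[OF j] by blast
      qed
      then have "y \<in> Pi\<^sub>E J V" using y by (auto simp: box_def PiE_iff)
      then show "y \<in> U" using V(3) by blast
    qed
    ultimately have "(?c, k) \<in> I" using c(1) by (auto simp: I_def)
    then show "x \<in> (\<Union>i\<in>I. box i)" using \<open>x \<in> box (?c, k)\<close> by blast
  qed
  moreover have "(\<Union>i\<in>I. box i) \<subseteq> U" by (auto simp: I_def)
  ultimately show ?thesis by (metis subset_antisym)
qed

lemma sets_prod_borel:
  assumes "finite J" and "\<And>j. j \<in> J \<Longrightarrow> separable_space (mtopology_of (S j))"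
  shows "sets (prod_borel S J) = sets (Pi\<^sub>M J (\<lambda>j. borel_of (mtopology_of (S j))))" (is "_ = sets ?P")
proof
  have space: "topspace (product_topology (\<lambda>j. mtopology_of (S j)) J) = space ?P"
    by (simp add: space_PiM space_borel_of)
  show "sets (prod_borel S J) \<subseteq> sets ?P"
    unfolding prod_borel_def sets_borel_of space
    using openin_product_in_sets_PiM[OF assms] by (intro sets.sigma_sets_subset) auto
  have "(\<lambda>x. x) \<in> measurable (prod_borel S J) ?P"
  proof (rule measurable_PiM_single')
    show "(\<lambda>x. x j) \<in> measurable (prod_borel S J) (borel_of (mtopology_of (S j)))" if "j \<in> J" for j
      unfolding prod_borel_def using that
      by (intro continuous_map_imp_measurable_borel_of continuous_map_product_projection)
    show "(\<lambda>x. x) \<in> space (prod_borel S J) \<rightarrow> (\<Pi>\<^sub>E j\<in>J. space (borel_of (mtopology_of (S j))))"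
      by (simp add: prod_borel_def space_borel_of)
  qed
  moreover have "space (prod_borel S J) = space ?P" unfolding prod_borel_def space_borel_of by (rule space)
  ultimately show "sets ?P \<subseteq> sets (prod_borel S J)"
    using sets.sets_into_space by (fastforce simp: measurable_def)
qed


section \<open>Integration against a regular conditional distribution\<close>

text \<open>The definition of a regular conditional distribution only prescribes the probabilities of measurable rectangles.
  These are stable under intersection and generate the product \<open>\<sigma>\<close>-algebra, so they determine the joint law.\<close>

lemma regular_cond_dist_nn_integral:
  assumes cond: "regular_cond_dist M A X B Y K" and "prob_space M"
    and g: "g \<in> borel_measurable (A \<Otimes>\<^sub>M B)"
  shows "(\<integral>\<^sup>+\<omega>. g (X \<omega>, Y \<omega>) \<partial>M) = (\<integral>\<^sup>+\<omega>. (\<integral>\<^sup>+y. g (X \<omega>, y) \<partial>K (X \<omega>)) \<partial>M)"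
proof -
  interpret prob_space M by fact
  have X[measurable]: "X \<in> measurable M A" and Y[measurable]: "Y \<in> measurable M B"
    and K': "K \<in> measurable A (prob_algebra B)"
    and rect: "\<And>S S'. S \<in> sets A \<Longrightarrow> S' \<in> sets B \<Longrightarrow>
        emeasure M {\<omega>\<in>space M. X \<omega> \<in> S \<and> Y \<omega> \<in> S'} = (\<integral>\<^sup>+x\<in>S. emeasure (K x) S' \<partial>distr M A X)"
    using cond by (auto simp: regular_cond_dist_def)
  have K[measurable]: "K \<in> measurable A (subprob_algebra B)" using K' by (rule measurable_prob_algebraD)
  let ?D = "distr M A X"
  interpret D: prob_space ?D by (rule prob_space_distr) fact
  let ?L = "\<lambda>x. distr (K x) (A \<Otimes>\<^sub>M B) (Pair x)"
  have L[measurable]: "?L \<in> measurable ?D (subprob_algebra (A \<Otimes>\<^sub>M B))"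
    using measurable_distr2[OF _ K, of Pair "A \<Otimes>\<^sub>M B"] by simp
  have sets_K: "sets (K x) = sets B" if "x \<in> space A" for x
    using measurable_space[OF K that] by (simp add: space_subprob_algebra)
  have Pair_meas: "Pair x \<in> measurable (K x) (A \<Otimes>\<^sub>M B)" if "x \<in> space A" for x
    using that measurable_Pair1'[OF that, of B] by (simp add: measurable_cong_sets[OF sets_K[OF that] refl])
  have "distr M (A \<Otimes>\<^sub>M B) (\<lambda>\<omega>. (X \<omega>, Y \<omega>)) = ?D \<bind> ?L" (is "?J = ?R")
  proof (rule measure_eqI_generator_eq[OF Int_stable_pair_measure_generator[of A B]])
    let ?E = "{a \<times> b |a b. a \<in> sets A \<and> b \<in> sets B}" and ?\<Omega> = "space A \<times> space B"
    show "?E \<subseteq> Pow ?\<Omega>" by (rule pair_measure_closed)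
    show "sets ?J = sigma_sets ?\<Omega> ?E" by (simp add: sets_pair_measure)
    have "sets ?R = sets (A \<Otimes>\<^sub>M B)"
      using D.not_empty by (intro sets_bind[where N="A \<Otimes>\<^sub>M B"]) simp_all
    then show "sets ?R = sigma_sets ?\<Omega> ?E" by (simp add: sets_pair_measure)
    show "range (\<lambda>i::nat. ?\<Omega>) \<subseteq> ?E" "(\<Union>i::nat. ?\<Omega>) = ?\<Omega>" by auto
    have "prob_space ?J" by (rule prob_space_distr) simp
    then show "emeasure ?J ?\<Omega> \<noteq> \<infinity>" for i :: nat
      using finite_measure.emeasure_finite prob_space.finite_measure by fastforce
    fix Z assume "Z \<in> ?E"
    then obtain S S' where S[measurable]: "S \<in> sets A" and S'[measurable]: "S' \<in> sets B" and Z: "Z = S \<times> S'" by auto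
    have "emeasure ?J Z = emeasure M {\<omega>\<in>space M. X \<omega> \<in> S \<and> Y \<omega> \<in> S'}"
      unfolding Z by (subst emeasure_distr) (auto intro!: arg_cong[where f="emeasure M"])
    also have "\<dots> = (\<integral>\<^sup>+x\<in>S. emeasure (K x) S' \<partial>?D)" by (rule rect[OF S S'])
    also have "\<dots> = (\<integral>\<^sup>+x. emeasure (?L x) Z \<partial>?D)"
    proof (rule nn_integral_cong)
      fix x assume "x \<in> space ?D"
      then have x: "x \<in> space A" by simp
      have "emeasure (?L x) Z = emeasure (K x) (Pair x -` Z \<inter> space (K x))"
        unfolding Z by (rule emeasure_distr[OF Pair_meas[OF x]]) simp
      also have "Pair x -` Z \<inter> space (K x) = (if x \<in> S then S' else {})"
        using sets.sets_into_space[OF S'] sets_eq_imp_space_eq[OF sets_K[OF x]] by (auto simp: Z)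
      finally show "emeasure (K x) S' * indicator S x = emeasure (?L x) Z" by simp
    qed
    also have "\<dots> = emeasure ?R Z"
      unfolding Z using D.not_empty by (intro emeasure_bind[symmetric, OF _ L]) auto
    finally show "emeasure ?J Z = emeasure ?R Z" .
  qed
  moreover have "(\<integral>\<^sup>+z. g z \<partial>?J) = (\<integral>\<^sup>+\<omega>. g (X \<omega>, Y \<omega>) \<partial>M)"
    using g by (intro nn_integral_distr) simp_all
  ultimately have "(\<integral>\<^sup>+\<omega>. g (X \<omega>, Y \<omega>) \<partial>M) = (\<integral>\<^sup>+z. g z \<partial>?R)" by simp
  also have "\<dots> = (\<integral>\<^sup>+x. \<integral>\<^sup>+z. g z \<partial>?L x \<partial>?D)" by (rule nn_integral_bind[OF g L])
  also have "\<dots> = (\<integral>\<^sup>+x. \<integral>\<^sup>+y. g (x, y) \<partial>K x \<partial>?D)"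
    by (intro nn_integral_cong) (simp add: nn_integral_distr[OF Pair_meas] g)
  also have "\<dots> = (\<integral>\<^sup>+\<omega>. (\<integral>\<^sup>+y. g (X \<omega>, y) \<partial>K (X \<omega>)) \<partial>M)"
  proof (rule nn_integral_distr[OF X])
    show "(\<lambda>x. \<integral>\<^sup>+y. g (x, y) \<partial>K x) \<in> borel_measurable ?D"
      using nn_integral_measurable_subprob_algebra2[OF _ K, of "\<lambda>x y. g (x, y)"] g by simp
  qed
  finally show ?thesis .
qed


section \<open>Disintegration and likelihood ratios in a density array\<close>

text \<open>On the complement of both exceptional null sets, either density integrates to \<open>N\<close>. Hence the
  arbitrary choice in the definition of the likelihood ratio is immaterial.\<close>

lemma is_ac_density_unique:
  assumes "finite_measure M" "finite_measure N" and sets: "sets N = sets M"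
    and f: "is_ac_density M N f" and g: "is_ac_density M N g"
  shows "AE x in M. f x = g x"
proof -
  interpret M: finite_measure M by fact
  interpret N: finite_measure N by fact
  obtain A where A: "A \<in> null_sets M"
      "\<And>B. B \<in> sets M \<Longrightarrow> emeasure N B = (\<integral>\<^sup>+x\<in>B. f x \<partial>M) + emeasure N (B \<inter> A)"
    using f by (auto simp: is_ac_density_def)
  obtain A' where A': "A' \<in> null_sets M"
      "\<And>B. B \<in> sets M \<Longrightarrow> emeasure N B = (\<integral>\<^sup>+x\<in>B. g x \<partial>M) + emeasure N (B \<inter> A')"
    using g by (auto simp: is_ac_density_def)
  have [measurable]: "f \<in> borel_measurable M" "g \<in> borel_measurable M" "A \<in> sets M" "A' \<in> sets M"
    using f g A A' by (auto simp: is_ac_density_def)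
  have N_AA': "AE x in M. x \<notin> A \<union> A'" using A(1) A'(1) by (intro AE_not_in null_sets.Un)
  show ?thesis
  proof (rule M.density_unique_finite_measure)
    fix B assume [measurable]: "B \<in> sets M"
    let ?B = "B - (A \<union> A')"
    have "(\<integral>\<^sup>+x. f x * indicator B x \<partial>M) = (\<integral>\<^sup>+x\<in>?B. f x \<partial>M)"
      using N_AA' by (intro nn_integral_cong_AE) (auto simp: indicator_def)
    also have "\<dots> = emeasure N ?B"
    proof -
      have "?B \<inter> A = {}" by auto
      then show ?thesis using A(2)[of ?B] by simp
    qed
    also have "\<dots> = (\<integral>\<^sup>+x\<in>?B. g x \<partial>M)"
    proof -
      have "?B \<inter> A' = {}" by auto
      then show ?thesis using A'(2)[of ?B] by simp
    qed
    also have "\<dots> = (\<integral>\<^sup>+x. g x * indicator B x \<partial>M)"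
      using N_AA' by (intro nn_integral_cong_AE) (auto simp: indicator_def)
    finally show "(\<integral>\<^sup>+x. f x * indicator B x \<partial>M) = (\<integral>\<^sup>+x. g x * indicator B x \<partial>M)" .
  qed auto
qed

text \<open>Integrate over the set where the conditional expectation is negative.\<close>

lemma (in finite_measure_subalgebra) real_cond_exp_nonneg_if_set_integrals_nonneg:
  assumes int: "integrable M f"
    and nonneg: "\<And>A. A \<in> sets F \<Longrightarrow> 0 \<le> (\<integral>x\<in>A. f x \<partial>M)"
  shows "AE x in M. 0 \<le> real_cond_exp M F f x"
proof -
  let ?c = "real_cond_exp M F f"
  define A where "A = {x\<in>space M. ?c x < 0}"
  have "space F = space M" using subalg by (simp add: subalgebra_def)
  then have A: "A \<in> sets F" unfolding A_def by (metis borel_measurable_cond_exp borel_measurable_iff_less)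
  then have [measurable]: "A \<in> sets M" using subalg by (auto simp: subalgebra_def)
  have "0 \<le> (\<integral>x\<in>A. ?c x \<partial>M)" using nonneg[OF A] real_cond_exp_intA[OF int A] by simp
  moreover have int_A: "integrable M (\<lambda>x. indicator A x * ?c x)"
    using integrable_mult_indicator[OF \<open>A \<in> sets M\<close> real_cond_exp_int(1)[OF int]] by simp
  moreover have le: "indicator A x * ?c x \<le> 0" for x by (auto simp: A_def indicator_def)
  ultimately have "(\<integral>x. - (indicator A x * ?c x) \<partial>M) = 0"
    using Bochner_Integration.integral_nonneg[of M "\<lambda>x. - (indicator A x * ?c x)"] by (simp add: set_lebesgue_integral_def)
  then have "AE x in M. - (indicator A x * ?c x) = 0"
    using int_A le by (subst (asm) integral_nonneg_eq_0_iff_AE) auto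
  then show ?thesis
    by (rule AE_mp) (auto simp: A_def indicator_def not_less intro!: AE_I2)
qed

context density_array
begin

lemma sets_histories:
  assumes "J \<subseteq> {1..m n}"
  shows "sets (prod_borel (R n) J) = sets (Pi\<^sub>M J (\<lambda>j. borel_of (mtopology_of (R n j))))"
proof (rule sets_prod_borel)
  show "finite J" using assms finite_atLeastAtMost by (rule finite_subset)
  show "separable_space (mtopology_of (R n j))" if "j \<in> J" for j
    using that assms by (intro separable[of _ n]) blast
qed

abbreviation "\<B> n j \<equiv> borel_of (mtopology_of (R n j))"

lemma space_histories: "space (prod_borel (R n) J) = (\<Pi>\<^sub>E j\<in>J. mspace (R n j))"
  by (simp add: prod_borel_def space_borel_of)

lemma restrict_histories:
  assumes "J \<subseteq> L" "L \<subseteq> {1..m n}"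
  shows "(\<lambda>x. restrict x J) \<in> measurable (prod_borel (R n) L) (prod_borel (R n) J)"
proof -
  have "J \<subseteq> {1..m n}" using assms by auto
  show ?thesis
    unfolding measurable_cong_sets[OF sets_histories[OF assms(2)] sets_histories[OF \<open>J \<subseteq> {1..m n}\<close>]]
    by (rule measurable_restrict_subset[OF assms(1)])
qed

lemma restrict_measurable:
  assumes "\<theta> \<in> \<Theta>" "J \<subseteq> {1..m n}"
  shows "(\<lambda>x. restrict x J) \<in> measurable (P \<theta> n) (prod_borel (R n) J)"
  unfolding measurable_cong_sets[OF sets_P[OF assms(1)] refl]
  using assms(2) by (intro restrict_histories) auto

lemma space_P: "\<theta> \<in> \<Theta> \<Longrightarrow> space (P \<theta> n) = space (prod_borel (R n) {1..m n})"
  by (rule sets_eq_imp_space_eq[OF sets_P])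

lemma upd_measurable:
  assumes j: "j \<in> {1..m n}"
  shows "(\<lambda>(x, y). x(j := y)) \<in>
    measurable (prod_borel (R n) {1..<j} \<Otimes>\<^sub>M \<B> n j) (prod_borel (R n) {1..j})"
proof -
  let ?B = "\<B> n"
  have "{1..j} = insert j {1..<j}" using j by auto
  then have upd: "(\<lambda>(x, y). x(j := y)) \<in> measurable (Pi\<^sub>M {1..<j} ?B \<Otimes>\<^sub>M ?B j) (Pi\<^sub>M {1..j} ?B)"
    using measurable_add_dim[of j "{1..<j}" ?B] by simp
  have dom: "sets (prod_borel (R n) {1..<j} \<Otimes>\<^sub>M ?B j) = sets (Pi\<^sub>M {1..<j} ?B \<Otimes>\<^sub>M ?B j)"
    using j by (intro sets_pair_measure_cong sets_histories refl) auto
  have ran: "sets (prod_borel (R n) {1..j}) = sets (Pi\<^sub>M {1..j} ?B)"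
    using j by (intro sets_histories) auto
  show ?thesis unfolding measurable_cong_sets[OF dom ran] by (rule upd)
qed

text \<open>The spaces in which \<open>(X\<^sub>1, \<dots>, X\<^sub>j)\<close> and \<open>(X\<^sub>1, \<dots>, X\<^bsub>j-1\<^esub>)\<close> take their values.\<close>

abbreviation hist where "hist n j \<equiv> prod_borel (R n) {1..j}"
abbreviation past where "past n j \<equiv> prod_borel (R n) {1..<j}"

lemma section_measurable:
  assumes j: "j \<in> {1..m n}" and x: "x \<in> space (past n j)"
    and f: "f \<in> borel_measurable (hist n j)"
  shows "(\<lambda>y. f (x(j := y))) \<in> borel_measurable (\<mu> n j)"
proof -
  have "(\<lambda>y. x(j := y)) \<in> measurable (\<B> n j) (hist n j)"
    using measurable_compose[OF measurable_Pair1'[OF x] upd_measurable[OF j]] by simp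
  then show ?thesis
    using measurable_compose[OF _ f] unfolding measurable_cong_sets[OF sets_\<mu>[OF j] refl] by blast
qed

lemma section_integral_measurable:
  assumes j: "j \<in> {1..m n}" and f: "f \<in> borel_measurable (hist n j)"
  shows "(\<lambda>x. \<integral>\<^sup>+y. f (x(j := y)) \<partial>\<mu> n j) \<in> borel_measurable (past n j)"
proof -
  interpret sigma_finite_measure "\<mu> n j" using j by (rule sigma_finite_\<mu>)
  have dom: "sets (past n j \<Otimes>\<^sub>M \<mu> n j)
      = sets (past n j \<Otimes>\<^sub>M \<B> n j)"
    by (intro sets_pair_measure_cong refl sets_\<mu> j)
  have "(\<lambda>(x, y). x(j := y)) \<in> measurable (past n j \<Otimes>\<^sub>M \<mu> n j) (hist n j)"
    unfolding measurable_cong_sets[OF dom refl] by (rule upd_measurable[OF j])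
  from measurable_compose[OF this f]
  show ?thesis by (intro borel_measurable_nn_integral) (simp add: case_prod_beta')
qed

lemma upd_in_histories:
  assumes j: "j \<in> {1..m n}" and x: "x \<in> space (past n j)" and y: "y \<in> space (\<mu> n j)"
  shows "x(j := y) \<in> space (hist n j)"
proof -
  have "space (\<mu> n j) = space (\<B> n j)"
    by (rule sets_eq_imp_space_eq[OF sets_\<mu>[OF j]])
  then show ?thesis
    using measurable_space[OF upd_measurable[OF j], of "(x, y)"] x y by (simp add: space_pair_measure)
qed

lemma section_density_integral:
  assumes \<theta>: "\<theta> \<in> \<Theta>" and j: "j \<in> {1..m n}" and x: "x \<in> space (past n j)"
  shows "(\<integral>\<^sup>+y. ennreal (p \<theta> n j (x(j := y))) \<partial>\<mu> n j) = 1"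
proof -
  have "Q \<theta> n j \<in> measurable (past n j) (prob_algebra (\<B> n j))"
    using cond_law[OF \<theta> j] by (simp add: regular_cond_dist_def)
  from measurable_space[OF this x] have "prob_space (Q \<theta> n j x)" by (simp add: space_prob_algebra)
  then have "emeasure (Q \<theta> n j x) (space (Q \<theta> n j x)) = 1" by (rule prob_space.emeasure_space_1)
  moreover have "(\<lambda>y. ennreal (p \<theta> n j (x(j := y)))) \<in> borel_measurable (\<mu> n j)"
    using section_measurable[OF j x p_measurable[OF \<theta> j]] by simp
  ultimately show ?thesis
    unfolding p_density[OF \<theta> j x] by (simp add: emeasure_density cong: nn_integral_cong_simp)
qed

abbreviation extend :: "(nat \<Rightarrow> 'a) \<Rightarrow> nat \<Rightarrow> 'a \<Rightarrow> nat \<Rightarrow> 'a" where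
  "extend x j y \<equiv> (restrict x {1..<j})(j := y)"

text \<open>The factor \<open>c\<close> depends on the past only. It makes the formula usable both for induction on the
  number of coordinates and, with an indicator, for conditional expectations.\<close>

lemma disintegration:
  fixes c f :: "(nat \<Rightarrow> 'a) \<Rightarrow> ennreal"
  assumes \<theta>: "\<theta> \<in> \<Theta>" and j: "j \<in> {1..m n}"
    and c: "c \<in> borel_measurable (past n j)"
    and f: "f \<in> borel_measurable (hist n j)"
  shows "(\<integral>\<^sup>+x. c (restrict x {1..<j}) * f (restrict x {1..j}) \<partial>P \<theta> n) =
    (\<integral>\<^sup>+x. c (restrict x {1..<j}) * (\<integral>\<^sup>+y. f (extend x j y)
        * ennreal (p \<theta> n j (extend x j y)) \<partial>\<mu> n j) \<partial>P \<theta> n)"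
proof -
  let ?A = "past n j" and ?B = "\<B> n j"
  let ?g = "\<lambda>(x, y). c x * f (x(j := y))"
  have "(\<lambda>z. f (case z of (x, y) \<Rightarrow> x(j := y))) \<in> borel_measurable (?A \<Otimes>\<^sub>M ?B)"
    by (rule measurable_compose[OF upd_measurable[OF j] f])
  moreover have "(\<lambda>z. c (fst z)) \<in> borel_measurable (?A \<Otimes>\<^sub>M ?B)"
    by (rule measurable_compose[OF measurable_fst c])
  ultimately have g: "?g \<in> borel_measurable (?A \<Otimes>\<^sub>M ?B)"
    by (simp add: case_prod_beta' borel_measurable_times)
  have split: "restrict x {1..j} = (restrict x {1..<j})(j := x j)" for x :: "nat \<Rightarrow> 'a"
    using j by (auto simp: restrict_def fun_eq_iff)
  have "(\<integral>\<^sup>+x. c (restrict x {1..<j}) * f (restrict x {1..j}) \<partial>P \<theta> n)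
      = (\<integral>\<^sup>+x. (\<integral>\<^sup>+y. c (restrict x {1..<j}) * f (extend x j y) \<partial>Q \<theta> n j (restrict x {1..<j})) \<partial>P \<theta> n)"
    using regular_cond_dist_nn_integral[OF cond_law[OF \<theta> j] prob_P[OF \<theta>] g] unfolding split by simp
  also have "\<dots> = (\<integral>\<^sup>+x. c (restrict x {1..<j}) * (\<integral>\<^sup>+y. f (extend x j y)
        * ennreal (p \<theta> n j (extend x j y)) \<partial>\<mu> n j) \<partial>P \<theta> n)"
  proof (rule nn_integral_cong)
    fix x assume "x \<in> space (P \<theta> n)"
    then have x: "restrict x {1..<j} \<in> space ?A"
      using j by (intro measurable_space[OF restrict_measurable[OF \<theta>]]) auto
    let ?x = "restrict x {1..<j}"
    have [measurable]: "(\<lambda>y. f (?x(j := y))) \<in> borel_measurable (\<mu> n j)"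
      "(\<lambda>y. p \<theta> n j (?x(j := y))) \<in> borel_measurable (\<mu> n j)"
      by (rule section_measurable[OF j x f], rule section_measurable[OF j x p_measurable[OF \<theta> j]])
    have "(\<integral>\<^sup>+y. c ?x * f (?x(j := y)) \<partial>Q \<theta> n j ?x)
        = (\<integral>\<^sup>+y. ennreal (p \<theta> n j (?x(j := y))) * (c ?x * f (?x(j := y))) \<partial>\<mu> n j)"
      unfolding p_density[OF \<theta> j x] by (rule nn_integral_density) measurable
    also have "\<dots> = (\<integral>\<^sup>+y. c ?x * (f (?x(j := y)) * ennreal (p \<theta> n j (?x(j := y)))) \<partial>\<mu> n j)"
      by (intro nn_integral_cong) (simp add: mult_ac)
    also have "\<dots> = c ?x * (\<integral>\<^sup>+y. f (?x(j := y)) * ennreal (p \<theta> n j (?x(j := y))) \<partial>\<mu> n j)"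
      by (rule nn_integral_cmult) measurable
    finally show "(\<integral>\<^sup>+y. c ?x * f (?x(j := y)) \<partial>Q \<theta> n j ?x)
        = c ?x * (\<integral>\<^sup>+y. f (?x(j := y)) * ennreal (p \<theta> n j (?x(j := y))) \<partial>\<mu> n j)" .
  qed
  finally show ?thesis .
qed

lemmas disintegration_1 = disintegration[where c="\<lambda>_. 1", OF _ _ borel_measurable_const, unfolded mult_1]

text \<open>Peel off the last coordinate by disintegration: there \<open>a\<close> times one density equals \<open>b\<close> times the
  other, and the inner integral, being a function of the remaining coordinates, is absorbed into \<open>g\<close>.\<close>

lemma change_of_measure:
  fixes a b :: "nat \<Rightarrow> (nat \<Rightarrow> 'a) \<Rightarrow> ennreal" and g :: "(nat \<Rightarrow> 'a) \<Rightarrow> ennreal"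
  assumes \<theta>: "\<theta> \<in> \<Theta>" and \<theta>': "\<theta>' \<in> \<Theta>"
    and a: "\<And>j. j \<in> {1..m n} \<Longrightarrow> a j \<in> borel_measurable (hist n j)"
    and b: "\<And>j. j \<in> {1..m n} \<Longrightarrow> b j \<in> borel_measurable (hist n j)"
    and ab: "\<And>j z. j \<in> {1..m n} \<Longrightarrow> z \<in> space (hist n j) \<Longrightarrow>
      a j z * ennreal (p \<theta> n j z) = b j z * ennreal (p \<theta>' n j z)"
    and k: "k \<le> m n" and g: "g \<in> borel_measurable (hist n k)"
  shows "(\<integral>\<^sup>+x. (\<Prod>j=1..k. a j (restrict x {1..j})) * g (restrict x {1..k}) \<partial>P \<theta> n)
    = (\<integral>\<^sup>+x. (\<Prod>j=1..k. b j (restrict x {1..j})) * g (restrict x {1..k}) \<partial>P \<theta>' n)"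
  using k g
proof (induction k arbitrary: g)
  case 0
  have eq: "restrict x {1..0} = (\<lambda>_. undefined)" for x :: "nat \<Rightarrow> 'a" by (auto simp: restrict_def)
  show ?case
    unfolding eq using prob_space.emeasure_space_1[OF prob_P[OF \<theta>]] prob_space.emeasure_space_1[OF prob_P[OF \<theta>']]
    by simp
next
  case (Suc k)
  let ?j = "Suc k"
  have j: "?j \<in> {1..m n}" and k: "k \<le> m n" using Suc.prems by auto
  have less: "{1..<?j} = {1..k}" by auto
  let ?g = "\<lambda>x. \<integral>\<^sup>+y. a ?j (x(?j := y)) * g (x(?j := y)) * ennreal (p \<theta> n ?j (x(?j := y))) \<partial>\<mu> n ?j"
  have step: "(\<integral>\<^sup>+x. (\<Prod>i\<in>{1..?j}. e i (restrict x {1..i})) * g (restrict x {1..?j}) \<partial>P \<theta>'' n)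
      = (\<integral>\<^sup>+x. (\<Prod>i\<in>{1..k}. e i (restrict x {1..i})) * ?g (restrict x {1..k}) \<partial>P \<theta>'' n)"
    if \<theta>'': "\<theta>'' \<in> \<Theta>" and e: "\<And>i. i \<in> {1..m n} \<Longrightarrow> e i \<in> borel_measurable (hist n i)"
      and ae: "\<And>z. z \<in> space (hist n ?j) \<Longrightarrow>
        a ?j z * ennreal (p \<theta> n ?j z) = e ?j z * ennreal (p \<theta>'' n ?j z)"
    for e :: "nat \<Rightarrow> (nat \<Rightarrow> 'a) \<Rightarrow> ennreal" and \<theta>''
  proof -
    let ?c = "\<lambda>x. \<Prod>i\<in>{1..k}. e i (restrict x {1..i})"
    have c: "?c \<in> borel_measurable (hist n k)"
      using k by (intro borel_measurable_prod_ennreal measurable_compose[OF restrict_histories e]) auto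
    have rr: "?c (restrict x {1..k}) = ?c x" for x
      by (intro prod.cong refl arg_cong2[where f=e] refl) (auto simp: restrict_def fun_eq_iff)
    have "(\<integral>\<^sup>+x. (\<Prod>i\<in>{1..?j}. e i (restrict x {1..i})) * g (restrict x {1..?j}) \<partial>P \<theta>'' n)
        = (\<integral>\<^sup>+x. ?c (restrict x {1..k}) * (e ?j (restrict x {1..?j}) * g (restrict x {1..?j})) \<partial>P \<theta>'' n)"
      unfolding rr by (simp add: mult.assoc)
    also have "\<dots> = (\<integral>\<^sup>+x. ?c (restrict x {1..k}) * (\<integral>\<^sup>+y. e ?j ((restrict x {1..k})(?j := y))
        * g ((restrict x {1..k})(?j := y)) * ennreal (p \<theta>'' n ?j ((restrict x {1..k})(?j := y))) \<partial>\<mu> n ?j) \<partial>P \<theta>'' n)"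
      using disintegration[OF \<theta>'' j, of ?c "\<lambda>z. e ?j z * g z"] c e[OF j] Suc.prems unfolding less by simp
    also have "\<dots> = (\<integral>\<^sup>+x. ?c (restrict x {1..k}) * ?g (restrict x {1..k}) \<partial>P \<theta>'' n)"
    proof (rule nn_integral_cong)
      fix x assume x: "x \<in> space (P \<theta>'' n)"
      let ?x = "restrict x {1..k}"
      have "?x \<in> space (hist n k)"
        using k x by (intro measurable_space[OF restrict_measurable[OF \<theta>'']]) auto
      then have z: "?x(?j := y) \<in> space (hist n ?j)" if "y \<in> space (\<mu> n ?j)" for y
        using upd_in_histories[OF j _ that] unfolding less by blast
      have swap: "a * b * c = a' * b * c'" if "a' * c' = a * c" for a b c a' c' :: ennreal
        using arg_cong[OF that, of "\<lambda>t. t * b"] by (simp add: mult_ac)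
      have "(\<integral>\<^sup>+y. e ?j (?x(?j := y)) * g (?x(?j := y)) * ennreal (p \<theta>'' n ?j (?x(?j := y))) \<partial>\<mu> n ?j) = ?g ?x"
        by (rule nn_integral_cong) (rule swap[OF ae[OF z]])
      then show "?c ?x * (\<integral>\<^sup>+y. e ?j (?x(?j := y)) * g (?x(?j := y)) * ennreal (p \<theta>'' n ?j (?x(?j := y))) \<partial>\<mu> n ?j)
          = ?c ?x * ?g ?x" by (simp only:)
    qed
    finally show ?thesis unfolding rr .
  qed
  have g': "?g \<in> borel_measurable (hist n k)"
    using section_integral_measurable[OF j, of "\<lambda>z. a ?j z * g z * ennreal (p \<theta> n ?j z)"]
      a[OF j] Suc.prems(2) p_measurable[OF \<theta> j] unfolding less by simp
  show ?case
    by (rule trans[OF step[OF \<theta> a refl] trans[OF Suc.IH[OF k g'] step[OF \<theta>' b ab[OF j], symmetric]]])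
qed

text \<open>The set where the density vanishes has conditional probability \<open>0\<close> given any past.\<close>

lemma density_positive_AE:
  assumes \<theta>: "\<theta> \<in> \<Theta>" and j: "j \<in> {1..m n}"
  shows "AE x in P \<theta> n. 0 < p \<theta> n j (restrict x {1..j})"
proof -
  let ?f = "\<lambda>z. if p \<theta> n j z = 0 then 1 else 0 :: ennreal"
  have [measurable]: "p \<theta> n j \<in> borel_measurable (hist n j)" by (rule p_measurable[OF \<theta> j])
  have f: "?f \<in> borel_measurable (hist n j)" by measurable
  have r: "(\<lambda>x. restrict x {1..j}) \<in> measurable (P \<theta> n) (hist n j)"
    using j by (intro restrict_measurable[OF \<theta>]) auto
  have "(\<integral>\<^sup>+x. ?f (restrict x {1..j}) \<partial>P \<theta> n) = 0"
    unfolding disintegration_1[OF \<theta> j f] by (intro nn_integral_zero' AE_I2) (simp add: if_distrib cong: if_cong)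
  then have "AE x in P \<theta> n. ?f (restrict x {1..j}) = 0"
    using measurable_compose[OF r f] by (subst (asm) nn_integral_0_iff_AE) auto
  moreover have "AE x in P \<theta> n. 0 \<le> p \<theta> n j (restrict x {1..j})"
    using p_nonneg[OF \<theta> j] measurable_space[OF r] by auto
  ultimately show ?thesis by eventually_elim (auto split: if_splits)
qed

text \<open>Take \<open>a\<close> to be the indicator of \<open>p \<theta>' \<noteq> 0\<close> and \<open>b\<close> the ratio of the densities in the change of
  measure. Division by zero gives \<open>0\<close>, so the product of the ratios vanishes on the exceptional null set
  where some \<open>p \<theta>'\<close> vanishes; only that set carries the singular part.\<close>

lemma ac_density_product:
  assumes \<theta>: "\<theta> \<in> \<Theta>" and \<theta>': "\<theta>' \<in> \<Theta>"
  shows "is_ac_density (P \<theta>' n) (P \<theta> n)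
    (\<lambda>x. \<Prod>j=1..m n. ennreal (p \<theta> n j (restrict x {1..j}) / p \<theta>' n j (restrict x {1..j})))"
  (is "is_ac_density _ _ ?L")
  unfolding is_ac_density_def
proof (intro conjI bexI ballI)
  let ?H = "\<lambda>j. hist n j"
  have r: "(\<lambda>x. restrict x {1..j}) \<in> measurable (P \<theta>'' n) (?H j)" if "j \<in> {1..m n}" "\<theta>'' \<in> \<Theta>" for j \<theta>''
    using that by (intro restrict_measurable) auto
  let ?a = "\<lambda>j z. if p \<theta>' n j z = 0 then 0 else 1 :: ennreal"
  let ?b = "\<lambda>j z. ennreal (p \<theta> n j z / p \<theta>' n j z)"
  have a: "?a j \<in> borel_measurable (?H j)" and b: "?b j \<in> borel_measurable (?H j)" if j: "j \<in> {1..m n}" for j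
    using p_measurable[OF \<theta> j] p_measurable[OF \<theta>' j] by measurable
  show "?L \<in> borel_measurable (P \<theta>' n)"
    using \<theta>' by (intro borel_measurable_prod_ennreal measurable_compose[OF r b]) auto
  define A where "A = {x\<in>space (P \<theta>' n). \<exists>j\<in>{1..m n}. p \<theta>' n j (restrict x {1..j}) = 0}"
  have A_sets: "A \<in> sets (P \<theta>' n)"
    unfolding A_def
  proof (rule sets.sets_Collect_finite_Ex)
    fix j assume j: "j \<in> {1..m n}"
    have [measurable]: "(\<lambda>x. p \<theta>' n j (restrict x {1..j})) \<in> borel_measurable (P \<theta>' n)"
      by (rule measurable_compose[OF r[OF j \<theta>'] p_measurable[OF \<theta>' j]])
    show "{x\<in>space (P \<theta>' n). p \<theta>' n j (restrict x {1..j}) = 0} \<in> sets (P \<theta>' n)" by measurable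
  qed simp
  have "AE x in P \<theta>' n. \<forall>j\<in>{1..m n}. 0 < p \<theta>' n j (restrict x {1..j})"
    using density_positive_AE[OF \<theta>'] by (intro AE_finite_allI) auto
  then have "AE x in P \<theta>' n. x \<notin> A" by eventually_elim (auto simp: A_def)
  then show "A \<in> null_sets (P \<theta>' n)" using A_sets by (simp add: AE_iff_null_sets)
  fix B assume B: "B \<in> sets (P \<theta>' n)"
  then have B_H: "B \<in> sets (?H (m n))" using sets_P[OF \<theta>'] by simp
  have sets_eq: "sets (P \<theta>' n) = sets (P \<theta> n)" using sets_P \<theta> \<theta>' by simp
  have full: "restrict x {1..m n} = x" if "x \<in> space (P \<theta>'' n)" "\<theta>'' \<in> \<Theta>" for x \<theta>''
    using that space_P[of \<theta>'' n] by (auto simp: space_histories PiE_restrict)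
  have ind: "(\<Prod>j=1..m n. ?a j (restrict x {1..j})) = indicator (space (P \<theta>' n) - A) x" if "x \<in> space (P \<theta>' n)" for x
    using that by (auto simp: A_def indicator_def intro!: prod.neutral)
  have "(\<integral>\<^sup>+x. ?L x * indicator B x \<partial>P \<theta>' n)
      = (\<integral>\<^sup>+x. (\<Prod>j=1..m n. ?b j (restrict x {1..j})) * indicator B (restrict x {1..m n}) \<partial>P \<theta>' n)"
    using full \<theta>' by (intro nn_integral_cong) simp
  also have "\<dots> = (\<integral>\<^sup>+x. (\<Prod>j=1..m n. ?a j (restrict x {1..j})) * indicator B (restrict x {1..m n}) \<partial>P \<theta> n)"
  proof (rule change_of_measure[OF \<theta> \<theta>' a b _ order_refl, symmetric])
    fix j z assume j: "j \<in> {1..m n}" and z: "z \<in> space (?H j)"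
    then show "?a j z * ennreal (p \<theta> n j z) = ?b j z * ennreal (p \<theta>' n j z)"
      using p_nonneg[OF \<theta> j z] p_nonneg[OF \<theta>' j z] by (auto simp: ennreal_mult''[symmetric])
  qed (use B_H in auto)
  also have "\<dots> = (\<integral>\<^sup>+x. indicator (B - A) x \<partial>P \<theta> n)"
  proof (rule nn_integral_cong)
    fix x assume "x \<in> space (P \<theta> n)"
    moreover from this have "x \<in> space (P \<theta>' n)" using sets_eq_imp_space_eq[OF sets_eq] by simp
    ultimately show "(\<Prod>j=1..m n. ?a j (restrict x {1..j})) * indicator B (restrict x {1..m n})
        = (indicator (B - A) x :: ennreal)"
      using full[OF _ \<theta>] by (subst ind) (auto simp: indicator_def)
  qed
  also have "\<dots> = emeasure (P \<theta> n) (B - A)"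
    using B A_sets sets_eq by (intro nn_integral_indicator) auto
  finally have "(\<integral>\<^sup>+x. ?L x * indicator B x \<partial>P \<theta>' n) = emeasure (P \<theta> n) (B - A)" .
  moreover have "emeasure (P \<theta> n) B = emeasure (P \<theta> n) (B - A) + emeasure (P \<theta> n) (B \<inter> A)"
    using B A_sets sets_eq by (subst plus_emeasure) (auto intro!: arg_cong[where f="emeasure _"])
  ultimately show "emeasure (P \<theta> n) B = (\<integral>\<^sup>+x. ?L x * indicator B x \<partial>P \<theta>' n) + emeasure (P \<theta> n) (B \<inter> A)" by simp
qed

lemma likelihood_ratio_product:
  assumes \<theta>: "\<theta> \<in> \<Theta>" and \<theta>': "\<theta>' \<in> \<Theta>"
  shows "likelihood_ratio (P \<theta> n) (P \<theta>' n) \<in> borel_measurable (P \<theta>' n)"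
    and "AE x in P \<theta>' n. likelihood_ratio (P \<theta> n) (P \<theta>' n) x
      = (\<Prod>j=1..m n. ennreal (p \<theta> n j (restrict x {1..j}) / p \<theta>' n j (restrict x {1..j})))"
proof -
  have "is_ac_density (P \<theta>' n) (P \<theta> n) (likelihood_ratio (P \<theta> n) (P \<theta>' n))"
    unfolding likelihood_ratio_def by (rule someI[of "is_ac_density (P \<theta>' n) (P \<theta> n)", OF ac_density_product[OF assms]])
  note ac = this
  show "likelihood_ratio (P \<theta> n) (P \<theta>' n) \<in> borel_measurable (P \<theta>' n)"
    using ac by (simp add: is_ac_density_def)
  show "AE x in P \<theta>' n. likelihood_ratio (P \<theta> n) (P \<theta>' n) x
      = (\<Prod>j=1..m n. ennreal (p \<theta> n j (restrict x {1..j}) / p \<theta>' n j (restrict x {1..j})))"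
    by (rule is_ac_density_unique[OF _ _ _ ac ac_density_product[OF assms]])
       (simp_all add: prob_P sets_P \<theta> \<theta>' prob_space.finite_measure)
qed

lemma measurable_history_algebra:
  assumes "j \<le> m n" and f: "f \<in> measurable (hist n j) N"
  shows "(\<lambda>x. f (restrict x {1..j})) \<in> measurable (history_algebra (R n) (m n) j) N"
proof -
  have "(\<lambda>x. restrict x {1..j}) \<in> space (hist n (m n)) \<rightarrow> space (hist n j)"
    using assms(1) by (intro measurable_space[OF restrict_histories, THEN funcsetI]) auto
  then show ?thesis
    unfolding history_algebra_def by (intro measurable_compose[OF measurable_vimage_algebra1 f])
qed

lemma space_history_algebra: "space (history_algebra (R n) (m n) j) = space (hist n (m n))"
  by (simp add: history_algebra_def)

lemma sets_history_algebra:
  assumes "j \<le> m n"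
  shows "sets (history_algebra (R n) (m n) j)
    = {(\<lambda>x. restrict x {1..j}) -` A \<inter> space (hist n (m n)) |A. A \<in> sets (hist n j)}"
  unfolding history_algebra_def
  using assms by (intro sets_vimage_algebra2 measurable_space[OF restrict_histories, THEN funcsetI]) auto

lemma finite_filtration_history:
  assumes \<theta>: "\<theta> \<in> \<Theta>"
  shows "finite_filtration (P \<theta> n) (history_algebra (R n) (m n)) (m n)"
proof (intro finite_filtration.intro finite_filtration_axioms.intro prob_P[OF \<theta>])
  let ?F = "history_algebra (R n) (m n)"
  show "subalgebra (P \<theta> n) (?F j)" if "j \<le> m n" for j
    unfolding subalgebra_def
  proof
    show "space (?F j) = space (P \<theta> n)" by (simp add: space_history_algebra space_P[OF \<theta>])
    show "sets (?F j) \<subseteq> sets (P \<theta> n)"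
      unfolding sets_history_algebra[OF that] space_P[OF \<theta>, symmetric]
      using measurable_sets[OF restrict_measurable[OF \<theta>, of "{1..j}"]] that by auto
  qed
  show "subalgebra (?F j) (?F i)" if ij: "i \<le> j" "j \<le> m n" for i j
    unfolding subalgebra_def
  proof
    show "space (?F i) = space (?F j)" by (simp add: space_history_algebra)
    have "(\<lambda>x. restrict (restrict x {1..j}) {1..i}) \<in> measurable (?F j) (hist n i)"
      using ij by (intro measurable_history_algebra restrict_histories) auto
    moreover have "restrict (restrict x {1..j}) {1..i} = restrict x {1..i}" for x :: "nat \<Rightarrow> 'a"
      using ij by (auto simp: restrict_def fun_eq_iff)
    ultimately have "(\<lambda>x. restrict x {1..i}) \<in> measurable (?F j) (hist n i)" by simp
    then show "sets (?F i) \<subseteq> sets (?F j)"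
      using measurable_sets[of "\<lambda>x. restrict x {1..i}" "?F j"] ij
      by (auto simp: sets_history_algebra[of i] space_history_algebra)
  qed
qed

end


section \<open>Positive definite matrices\<close>

lemma inner_symmetric_matrix:
  fixes A :: "real^'d^'d"
  assumes "transpose A = A"
  shows "x \<bullet> (A *v y) = (A *v x) \<bullet> y"
proof -
  have "x v* A = A *v x" using transpose_matrix_vector[of A x] assms by simp
  then show ?thesis using dot_lmul_matrix[of x A y] by simp
qed

text \<open>A positive definite matrix has trivial kernel.\<close>

lemma pos_definite_surj:
  fixes A :: "real^'d^'d"
  assumes "pos_definite A"
  shows "\<exists>h. A *v h = w"
proof -
  have "inj ((*v) A)"
  proof (rule injI)
    fix x y assume "A *v x = A *v y"
    then have "(x - y) \<bullet> (A *v (x - y)) = 0" by (simp add: matrix_vector_mult_diff_distrib)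
    then show "x = y" using assms unfolding pos_definite_def by (metis less_irrefl right_minus_eq)
  qed
  then have "\<exists>B. B ** A = mat 1" using matrix_left_invertible_injective by blast
  then have "\<exists>B. A ** B = mat 1" using matrix_left_right_inverse by blast
  then have "surj ((*v) A)" using matrix_right_invertible_surjective by blast
  then show ?thesis by (metis surjD)
qed

text \<open>Among symmetric matrices this is the complement of the positive definite ones. Restricting to the unit sphere,
  which is compact, makes the set closed.\<close>

definition degenerate_matrices :: "(real^'d^'d) set" where
  "degenerate_matrices = {A. \<exists>x\<in>sphere 0 1. x \<bullet> (A *v x) \<le> 0}"

lemma closed_degenerate_matrices: "closed (degenerate_matrices :: (real^'d^'d) set)"
proof -
  let ?T = "{z :: (real^'d) \<times> (real^'d^'d). (\<Sum>i\<in>UNIV. fst z $ i * (\<Sum>j\<in>UNIV. snd z $ i $ j * fst z $ j)) \<le> 0}"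
  have "closed ?T" by (intro closed_Collect_le continuous_intros)
  then have "closed {A. \<exists>x. x \<in> sphere 0 1 \<and> (x, A) \<in> ?T}"
    by (intro closed_compact_projection compact_sphere)
  also have "{A. \<exists>x. x \<in> sphere 0 1 \<and> (x, A) \<in> ?T} = degenerate_matrices"
    by (auto simp: degenerate_matrices_def inner_vec_def matrix_vector_mult_def)
  finally show ?thesis .
qed

lemma degenerate_matrices_nonempty: "(degenerate_matrices :: (real^'d^'d) set) \<noteq> {}"
proof -
  obtain x :: "real^'d" where "x \<in> sphere 0 1" by (metis ex_in_conv mem_sphere_0 norm_axis_1)
  then have "(0 :: real^'d^'d) \<in> degenerate_matrices" by (auto simp: degenerate_matrices_def)
  then show ?thesis by blast
qed

lemma pos_definite_iff_not_degenerate: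
  assumes sym: "transpose A = A"
  shows "pos_definite A \<longleftrightarrow> A \<notin> degenerate_matrices"
proof
  assume A: "pos_definite A"
  show "A \<notin> degenerate_matrices"
  proof
    assume "A \<in> degenerate_matrices"
    then obtain x where "norm x = 1" "x \<bullet> (A *v x) \<le> 0" by (auto simp: degenerate_matrices_def)
    then show False using A unfolding pos_definite_def by (metis not_le norm_zero zero_neq_one)
  qed
next
  assume A: "A \<notin> degenerate_matrices"
  have "0 < x \<bullet> (A *v x)" if "x \<noteq> 0" for x
  proof -
    let ?y = "(1 / norm x) *\<^sub>R x"
    have "?y \<in> sphere 0 1" using that by simp
    then have "\<not> ?y \<bullet> (A *v ?y) \<le> 0" using A unfolding degenerate_matrices_def by blast
    then have "0 < ?y \<bullet> (A *v ?y)" by (rule not_le_imp_less)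
    also have "?y \<bullet> (A *v ?y) = (x \<bullet> (A *v x)) / (norm x)\<^sup>2"
      by (simp add: matrix_vector_mult_scaleR power2_eq_square)
    finally show ?thesis using that by (simp add: zero_less_divide_iff)
  qed
  then show "pos_definite A" using sym by (simp add: pos_definite_def)
qed

lemma borel_measurable_vecI:
  fixes f :: "'b \<Rightarrow> 'c::euclidean_space ^ 'd"
  assumes "\<And>i. (\<lambda>x. f x $ i) \<in> borel_measurable M"
  shows "f \<in> borel_measurable M"
proof (rule borel_measurable_euclidean_space[THEN iffD2], rule ballI)
  fix b :: "'c ^ 'd" assume "b \<in> Basis"
  then obtain i u where b: "b = axis i u" by (auto simp: Basis_vec_def)
  show "(\<lambda>x. f x \<bullet> b) \<in> borel_measurable M"
    unfolding b inner_axis using assms[of i] by simp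
qed

lemma sum_matrix_vector_mult:
  fixes A :: "'i \<Rightarrow> real^'d^'d"
  shows "(\<Sum>j\<in>J. A j) *v w = (\<Sum>j\<in>J. A j *v w)"
  by (induction J rule: infinite_finite_induct) (simp_all add: matrix_vector_mult_add_rdistrib)

lemma pos_definite_mat_1: "pos_definite (mat 1 :: real^'d^'d)"
  by (simp add: pos_definite_def)

lemma pos_definite_imp_nonneg_definite: "pos_definite A \<Longrightarrow> nonneg_definite A"
  unfolding pos_definite_def nonneg_definite_def by (metis inner_zero_left order_less_imp_le order_refl)

lemma nonneg_definite_if_dense:
  fixes A :: "real^'d^'d"
  assumes sym: "transpose A = A" and D: "closure D = UNIV" and nonneg: "\<And>x. x \<in> D \<Longrightarrow> 0 \<le> x \<bullet> (A *v x)"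
  shows "nonneg_definite A"
proof -
  have "closed {x. 0 \<le> x \<bullet> (A *v x)}" by (intro closed_Collect_le continuous_intros)
  then have "closure D \<subseteq> {x. 0 \<le> x \<bullet> (A *v x)}" using nonneg by (intro closure_minimal) auto
  then show ?thesis using D sym by (auto simp: nonneg_definite_def)
qed


section \<open>Positive definiteness under weak convergence\<close>

text \<open>The functions \<open>max 0 (1 - k * infdist A degenerate_matrices)\<close> are continuous, equal \<open>1\<close> on degenerate
  matrices and tend to \<open>0\<close> elsewhere as \<open>k\<close> grows. For each \<open>k\<close> the expectation of the function of
  \<open>T n\<close> dominates the probability in question and converges to the expectation under the limit law, which
  tends to \<open>0\<close> as \<open>k\<close> grows by dominated convergence.\<close>

lemma not_pos_definite_vanishes:
  fixes T :: "nat \<Rightarrow> 'b \<Rightarrow> real^'d^'d" and V :: "nat \<Rightarrow> 'b \<Rightarrow> real^'d"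
  assumes prob: "\<And>n. prob_space (M n)"
    and T_meas: "\<And>n. T n \<in> borel_measurable (M n)"
    and T_sym: "\<And>n x. x \<in> space (M n) \<Longrightarrow> transpose (T n x) = T n x"
    and limit: "mixed_normal_limit M V T N Tlim W"
    and pd: "AE w in N. pos_definite (Tlim w)"
  shows "{x\<in>space (M n). \<not> pos_definite (T n x)} \<in> sets (M n)"
    and "(\<lambda>n. measure (M n) {x\<in>space (M n). \<not> pos_definite (T n x)}) \<longlonglongrightarrow> 0"
proof -
  let ?S = "degenerate_matrices :: (real^'d^'d) set"
  have eq: "{x\<in>space (M n). \<not> pos_definite (T n x)} = T n -` ?S \<inter> space (M n)" for n
    using pos_definite_iff_not_degenerate[OF T_sym] by auto
  have S: "T n -` ?S \<inter> space (M n) \<in> sets (M n)" for n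
    by (rule measurable_sets[OF T_meas borel_closed[OF closed_degenerate_matrices]])
  then show "{x\<in>space (M n). \<not> pos_definite (T n x)} \<in> sets (M n)" unfolding eq .
  interpret N: prob_space N using limit by (simp add: mixed_normal_limit_def)
  have Tlim_meas[measurable]: "Tlim \<in> borel_measurable N" using limit by (simp add: mixed_normal_limit_def)
  define f where "f = (\<lambda>(k::nat) (A::real^'d^'d). max 0 (1 - real k * infdist A ?S))"
  have f_cont: "continuous_on UNIV (f k)" for k
    unfolding f_def by (intro continuous_intros)
  have f_bounds: "0 \<le> f k A" "f k A \<le> 1" for k A
    unfolding f_def using infdist_nonneg[of A ?S] by auto
  have f_meas[measurable]: "f k \<in> borel_measurable borel" for k
    using f_cont by (rule borel_measurable_continuous_onI)
  have conv: "(\<lambda>n. \<integral>x. f k (T n x) \<partial>M n) \<longlonglongrightarrow> (\<integral>w. f k (Tlim w) \<partial>N)" for k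
  proof -
    have "continuous_on UNIV (\<lambda>z. f k (snd z :: real^'d^'d) :: real)"
      for z :: "(real^'d) \<times> (real^'d^'d)"
      by (rule continuous_on_compose2[OF f_cont continuous_on_snd]) (auto intro: continuous_on_id)
    moreover have "bounded (range (\<lambda>z :: (real^'d) \<times> (real^'d^'d). f k (snd z)))"
      using f_bounds by (intro boundedI[of _ 1]) auto
    ultimately show ?thesis
      using limit unfolding mixed_normal_limit_def converges_in_law_def by fastforce
  qed
  have small: "(\<lambda>k. \<integral>w. f k (Tlim w) \<partial>N) \<longlonglongrightarrow> (\<integral>w. 0 \<partial>N)"
  proof (rule integral_dominated_convergence[where w="\<lambda>_. 1"])
    show "AE w in N. (\<lambda>k. f k (Tlim w)) \<longlonglongrightarrow> 0"
      using pd
    proof eventually_elim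
      case (elim w)
      then have "Tlim w \<notin> ?S" using pos_definite_iff_not_degenerate pos_definite_def by blast
      then have pos: "0 < infdist (Tlim w) ?S"
        by (rule infdist_pos_not_in_closed[OF closed_degenerate_matrices degenerate_matrices_nonempty])
      obtain K :: nat where K: "1 / infdist (Tlim w) ?S < real K" using reals_Archimedean2 by blast
      have "f k (Tlim w) = 0" if "K \<le> k" for k
      proof -
        have "1 / infdist (Tlim w) ?S < real k" using K that by linarith
        then have "1 < real k * infdist (Tlim w) ?S" using pos by (simp add: field_simps)
        then show ?thesis by (simp add: f_def)
      qed
      then show ?case by (intro tendsto_eventually) (auto simp: eventually_sequentially)
    qed
  qed (use f_bounds in auto)
  show "(\<lambda>n. measure (M n) {x\<in>space (M n). \<not> pos_definite (T n x)}) \<longlonglongrightarrow> 0"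
    unfolding eq
  proof (rule order_tendstoI)
    fix e :: real
    show "\<forall>\<^sub>F n in sequentially. e < measure (M n) (T n -` ?S \<inter> space (M n))" if "e < 0"
      by (rule always_eventually) (use that measure_nonneg less_le_trans in blast)
    assume "0 < e"
    then have "\<forall>\<^sub>F k in sequentially. (\<integral>w. f k (Tlim w) \<partial>N) < e"
      using small by (intro order_tendstoD(2)) auto
    then obtain k where "(\<integral>w. f k (Tlim w) \<partial>N) < e" by (auto simp: eventually_sequentially)
    then have "\<forall>\<^sub>F n in sequentially. (\<integral>x. f k (T n x) \<partial>M n) < e" by (rule order_tendstoD(2)[OF conv])
    then show "\<forall>\<^sub>F n in sequentially. measure (M n) (T n -` ?S \<inter> space (M n)) < e"
    proof eventually_elim
      case (elim n)
      interpret prob_space "M n" by (rule prob)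
      have "measure (M n) (T n -` ?S \<inter> space (M n)) = (\<integral>x. indicator (T n -` ?S \<inter> space (M n)) x \<partial>M n)"
        by simp
      also have "\<dots> \<le> (\<integral>x. f k (T n x) \<partial>M n)"
      proof (rule integral_mono)
        show "integrable (M n) (\<lambda>x. indicator (T n -` ?S \<inter> space (M n)) x :: real)"
          using S by (intro integrable_real_indicator) (auto simp: emeasure_eq_measure)
        show "integrable (M n) (\<lambda>x. f k (T n x))"
          using f_bounds measurable_compose[OF T_meas f_meas] by (intro integrable_const_bound[of _ 1]) auto
        show "indicator (T n -` ?S \<inter> space (M n)) x \<le> f k (T n x)" for x
          using f_bounds by (auto simp: indicator_def f_def)
      qed
      finally show ?case using elim by linarith
    qed
  qed
qed

text \<open>If \<open>\<bar>f\<bar> \<le> C\<close>, the expectations of \<open>f\<close> change by at most \<open>2 C\<close> times the probability of \<open>B n\<close>.\<close>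

lemma mixed_normal_limit_modify:
  fixes T T' :: "nat \<Rightarrow> 'b \<Rightarrow> real^'d^'d" and V :: "nat \<Rightarrow> 'b \<Rightarrow> real^'d"
  assumes prob: "\<And>n. prob_space (M n)"
    and [measurable]: "\<And>n. V n \<in> borel_measurable (M n)" "\<And>n. T n \<in> borel_measurable (M n)"
      "\<And>n. T' n \<in> borel_measurable (M n)" "\<And>n. B n \<in> sets (M n)"
    and limit: "mixed_normal_limit M V T N Tlim W"
    and small: "(\<lambda>n. measure (M n) (B n)) \<longlonglongrightarrow> 0"
    and same: "\<And>n x. x \<in> space (M n) \<Longrightarrow> x \<notin> B n \<Longrightarrow> T' n x = T n x"
  shows "mixed_normal_limit M V T' N Tlim W"
  unfolding mixed_normal_limit_def
proof (intro conjI)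
  show "converges_in_law M (\<lambda>n x. (V n x, T' n x)) N (\<lambda>w. (msqrt (Tlim w) *v W w, Tlim w))"
    unfolding converges_in_law_def
  proof (intro allI impI)
    fix f :: "(real^'d) \<times> (real^'d^'d) \<Rightarrow> real"
    assume f: "continuous_on UNIV f \<and> bounded (range f)"
    then have [measurable]: "f \<in> borel_measurable borel" by (intro borel_measurable_continuous_onI) simp
    obtain C where C: "\<And>z. \<bar>f z\<bar> \<le> C" using f by (auto simp: bounded_iff)
    have "(\<lambda>n. \<integral>x. f (V n x, T n x) \<partial>M n) \<longlonglongrightarrow> (\<integral>w. f (msqrt (Tlim w) *v W w, Tlim w) \<partial>N)"
      using limit f by (simp add: mixed_normal_limit_def converges_in_law_def)
    moreover have "(\<lambda>n. (\<integral>x. f (V n x, T' n x) \<partial>M n) - (\<integral>x. f (V n x, T n x) \<partial>M n)) \<longlonglongrightarrow> 0"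
    proof (rule Lim_null_comparison)
      show "(\<lambda>n. 2 * C * measure (M n) (B n)) \<longlonglongrightarrow> 0" using tendsto_mult_left[OF small] by simp
      show "\<forall>\<^sub>F n in sequentially. norm ((\<integral>x. f (V n x, T' n x) \<partial>M n) - (\<integral>x. f (V n x, T n x) \<partial>M n))
          \<le> 2 * C * measure (M n) (B n)"
      proof (rule always_eventually, rule allI)
        fix n
        interpret prob_space "M n" by (rule prob)
        have int: "integrable (M n) (\<lambda>x. f (V n x, T' n x))" "integrable (M n) (\<lambda>x. f (V n x, T n x))"
          using C by (auto intro!: integrable_const_bound[of _ C])
        have "norm ((\<integral>x. f (V n x, T' n x) \<partial>M n) - (\<integral>x. f (V n x, T n x) \<partial>M n))
            = norm (\<integral>x. f (V n x, T' n x) - f (V n x, T n x) \<partial>M n)"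
          using int by simp
        also have "\<dots> \<le> (\<integral>x. norm (f (V n x, T' n x) - f (V n x, T n x)) \<partial>M n)"
          by (rule integral_norm_bound)
        also have "\<dots> \<le> (\<integral>x. 2 * C * indicator (B n) x \<partial>M n)"
        proof (rule integral_mono)
          show "integrable (M n) (\<lambda>x. 2 * C * indicator (B n) x)"
            by (intro integrable_mult_right integrable_real_indicator) (auto simp: emeasure_eq_measure)
          fix x assume "x \<in> space (M n)"
          then show "norm (f (V n x, T' n x) - f (V n x, T n x)) \<le> 2 * C * indicator (B n) x"
            using same[of x n] C[of "(V n x, T' n x)"] C[of "(V n x, T n x)"] by (cases "x \<in> B n") auto
        qed (use int in auto)
        also have "\<dots> = 2 * C * measure (M n) (B n)" by simp
        finally show "norm ((\<integral>x. f (V n x, T' n x) \<partial>M n) - (\<integral>x. f (V n x, T n x) \<partial>M n))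
          \<le> 2 * C * measure (M n) (B n)" .
      qed
    qed
    ultimately show "(\<lambda>n. \<integral>x. f (V n x, T' n x) \<partial>M n) \<longlonglongrightarrow> (\<integral>w. f (msqrt (Tlim w) *v W w, Tlim w) \<partial>N)"
      by (rule Lim_transform)
  qed
qed (use limit in \<open>simp_all add: mixed_normal_limit_def\<close>)


section \<open>Scores and conditional information\<close>

lemma tendsto_zero_if_ennreal_le:
  fixes a :: "nat \<Rightarrow> real" and b :: "nat \<Rightarrow> ennreal"
  assumes "\<And>n. 0 \<le> a n" "\<And>n. ennreal (a n) \<le> b n" "b \<longlonglongrightarrow> 0"
  shows "a \<longlonglongrightarrow> 0"
proof (rule tendsto_ennrealD)
  show "(\<lambda>n. ennreal (a n)) \<longlonglongrightarrow> ennreal 0"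
    by (rule tendsto_sandwich[OF _ _ tendsto_const, where h=b]) (simp_all add: assms)
qed (simp_all add: assms)

text \<open>Differentiability in quadratic mean of the roots of the conditional densities together with the moment
  conditions on the scores, that is, everything that the expansion of the likelihood ratio depends on.\<close>

locale differentiable_density_array = density_array \<Theta> m R P \<mu> Q p
  for \<Theta> :: "(real^'d) set" and m :: "nat \<Rightarrow> nat" and R :: "nat \<Rightarrow> nat \<Rightarrow> 'a metric"
    and P :: "real^'d \<Rightarrow> nat \<Rightarrow> (nat \<Rightarrow> 'a) measure" and \<mu> :: "nat \<Rightarrow> nat \<Rightarrow> 'a measure"
    and Q :: "real^'d \<Rightarrow> nat \<Rightarrow> nat \<Rightarrow> (nat \<Rightarrow> 'a) \<Rightarrow> 'a measure"
    and p :: "real^'d \<Rightarrow> nat \<Rightarrow> nat \<Rightarrow> (nat \<Rightarrow> 'a) \<Rightarrow> real" +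
  fixes \<theta>\<^sub>0 :: "real^'d" and r :: "nat \<Rightarrow> real^'d^'d" and xd :: "nat \<Rightarrow> nat \<Rightarrow> (nat \<Rightarrow> 'a) \<Rightarrow> real^'d"
  assumes \<theta>\<^sub>0: "\<theta>\<^sub>0 \<in> \<Theta>"
    and r_pos: "pos_definite (r n)"
    and local_parameters: "\<forall>\<^sub>F n in sequentially. \<theta>\<^sub>0 + r n *v h \<in> \<Theta>"
    and xd_measurable: "j \<in> {1..m n} \<Longrightarrow> xd n j \<in> borel_measurable (prod_borel (R n) {1..j})"
    and root_differentiable: "(\<lambda>n. \<Sum>j=1..m n. \<integral>\<^sup>+x. (\<integral>\<^sup>+y.
        ennreal ((xi p \<theta>\<^sub>0 r h n j ((restrict x {1..<j})(j := y))
          - 1/2 * (h \<bullet> (r n *v xd n j ((restrict x {1..<j})(j := y)))))\<^sup>2)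
        \<partial>\<mu> n j) \<partial>P \<theta>\<^sub>0 n) \<longlonglongrightarrow> 0"
    and score_centred: "j \<in> {1..m n} \<Longrightarrow> AE x in P \<theta>\<^sub>0 n.
        real_cond_exp (P \<theta>\<^sub>0 n) (history_algebra (R n) (m n) (j - 1)) (\<lambda>z. eta p \<theta>\<^sub>0 xd n j z $ i) x = 0"
    and score_lindeberg: "0 < \<epsilon> \<Longrightarrow> (\<lambda>n. \<Sum>j=1..m n. \<integral>\<^sup>+x.
        ennreal (\<bar>h \<bullet> (r n *v eta p \<theta>\<^sub>0 xd n j x)\<bar>\<^sup>2
          * indicator {z. \<bar>h \<bullet> (r n *v eta p \<theta>\<^sub>0 xd n j z)\<bar> > \<epsilon>} x) \<partial>P \<theta>\<^sub>0 n) \<longlonglongrightarrow> 0"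
    and score_bounded: "\<exists>K>0. \<forall>n. (\<Sum>j=1..m n. \<integral>\<^sup>+x.
        ennreal (\<bar>h \<bullet> (r n *v eta p \<theta>\<^sub>0 xd n j x)\<bar>\<^sup>2) \<partial>P \<theta>\<^sub>0 n) \<le> ennreal K"
begin

abbreviation shift where "shift h n \<equiv> \<theta>\<^sub>0 + r n *v h"
abbreviation P0 where "P0 \<equiv> P \<theta>\<^sub>0"
abbreviation F where "F n \<equiv> history_algebra (R n) (m n)"
abbreviation \<eta> where "\<eta> \<equiv> eta p \<theta>\<^sub>0 xd"

abbreviation u where "u h n j x \<equiv> h \<bullet> (r n *v \<eta> n j x)"

text \<open>Disintegration needs the score as a function on histories instead of the whole sample space.\<close>

definition eta_history :: "nat \<Rightarrow> nat \<Rightarrow> (nat \<Rightarrow> 'a) \<Rightarrow> real^'d" where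
  "eta_history n j z = (if p \<theta>\<^sub>0 n j z \<noteq> 0 then (1 / sqrt (p \<theta>\<^sub>0 n j z)) *\<^sub>R xd n j z else 0)"

lemma eta_eq: "\<eta> n j x = eta_history n j (restrict x {1..j})"
  by (simp add: eta_def eta_history_def Let_def)

lemma eta_history_measurable:
  assumes j: "j \<in> {1..m n}"
  shows "eta_history n j \<in> borel_measurable (hist n j)"
proof -
  have [measurable]: "p \<theta>\<^sub>0 n j \<in> borel_measurable (hist n j)"
    "xd n j \<in> borel_measurable (hist n j)"
    using p_measurable[OF \<theta>\<^sub>0 j] xd_measurable[OF j] by auto
  show ?thesis unfolding eta_history_def by measurable
qed

lemma eta_adapted: "j \<in> {1..m n} \<Longrightarrow> \<eta> n j \<in> borel_measurable (F n j)"
  unfolding eta_eq by (intro measurable_history_algebra eta_history_measurable) auto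

lemma filtration0: "finite_filtration (P0 n) (F n) (m n)"
  by (rule finite_filtration_history[OF \<theta>\<^sub>0])

lemma sub_F0: "j \<in> {1..m n} \<Longrightarrow> finite_measure_subalgebra (P0 n) (F n (j - 1))"
  by (rule finite_filtration.finite_measure_subalgebra[OF filtration0]) auto

lemma adapted_measurable:
  "j \<le> m n \<Longrightarrow> f \<in> borel_measurable (F n j) \<Longrightarrow> f \<in> borel_measurable (P0 n)"
  by (rule measurable_from_subalg[OF finite_filtration.filtration_subalgebra[OF filtration0]])

lemma eta_measurable: "j \<in> {1..m n} \<Longrightarrow> \<eta> n j \<in> borel_measurable (P0 n)"
  by (rule adapted_measurable[OF _ eta_adapted]) auto

lemma eta_nth_measurable: "j \<in> {1..m n} \<Longrightarrow> (\<lambda>x. \<eta> n j x $ a) \<in> borel_measurable (P0 n)"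
  using eta_measurable[of j n] by (intro borel_measurable_continuous_on[OF _ eta_measurable] continuous_intros) auto

lemma transpose_r: "transpose (r n) = r n"
  using r_pos by (simp add: pos_definite_def)

lemma inner_r: "h \<bullet> (r n *v v) = (r n *v h) \<bullet> v"
  by (rule inner_symmetric_matrix[OF transpose_r])

lemma inner_eta_measurable: "j \<in> {1..m n} \<Longrightarrow> (\<lambda>x. w \<bullet> \<eta> n j x) \<in> borel_measurable (F n j)"
  using eta_adapted by (intro borel_measurable_inner) auto

text \<open>The variance bound concerns directions of the form \<open>r n *v h\<close>, and these are all directions.\<close>

lemma inner_eta_square_integrable:
  assumes j: "j \<in> {1..m n}"
  shows "integrable (P0 n) (\<lambda>x. (w \<bullet> \<eta> n j x)\<^sup>2)"
proof -
  obtain h where h: "r n *v h = w" using pos_definite_surj[OF r_pos] by blast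
  obtain K where "0 < K" and K: "(\<Sum>j=1..m n. \<integral>\<^sup>+x. ennreal (\<bar>u h n j x\<bar>\<^sup>2) \<partial>P0 n) \<le> ennreal K"
    using score_bounded[of h] by blast
  have "(\<integral>\<^sup>+x. ennreal ((w \<bullet> \<eta> n j x)\<^sup>2) \<partial>P0 n)
      \<le> (\<Sum>j=1..m n. \<integral>\<^sup>+x. ennreal (\<bar>u h n j x\<bar>\<^sup>2) \<partial>P0 n)"
    using member_le_sum[OF j, of "\<lambda>j. \<integral>\<^sup>+x. ennreal (\<bar>u h n j x\<bar>\<^sup>2) \<partial>P0 n"]
    by (simp add: inner_r h)
  also have "\<dots> \<le> ennreal K" by (rule K)
  finally have "(\<integral>\<^sup>+x. ennreal ((w \<bullet> \<eta> n j x)\<^sup>2) \<partial>P0 n) < \<infinity>"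
    using ennreal_less_top[of K] by (simp add: le_less_trans)
  moreover have "(\<lambda>x. w \<bullet> \<eta> n j x) \<in> borel_measurable (P0 n)"
    using j by (intro adapted_measurable[OF _ inner_eta_measurable]) auto
  ultimately show ?thesis by (intro integrableI_nonneg) auto
qed

lemma eta_nth_square_integrable: "j \<in> {1..m n} \<Longrightarrow> integrable (P0 n) (\<lambda>x. (\<eta> n j x $ a)\<^sup>2)"
  using inner_eta_square_integrable[of j n "axis a 1"] by (simp add: inner_axis inner_commute[of "axis a 1"])

lemma eta_nth_integrable: "j \<in> {1..m n} \<Longrightarrow> integrable (P0 n) (\<lambda>x. \<eta> n j x $ a)"
  by (intro finite_measure.square_integrable_imp_integrable[OF _ eta_nth_measurable eta_nth_square_integrable]
      prob_space.finite_measure prob_P \<theta>\<^sub>0)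

lemma eta_product_integrable: "j \<in> {1..m n} \<Longrightarrow> integrable (P0 n) (\<lambda>x. \<eta> n j x $ a * \<eta> n j x $ b)"
  by (intro integrable_mult_if_square_integrable eta_nth_measurable eta_nth_square_integrable)

lemma inner_eta_centred:
  assumes j: "j \<in> {1..m n}"
  shows "AE x in P0 n. real_cond_exp (P0 n) (F n (j - 1)) (\<lambda>x. w \<bullet> \<eta> n j x) x = 0"
proof -
  interpret finite_measure_subalgebra "P0 n" "F n (j - 1)" by (rule sub_F0[OF j])
  let ?E = "real_cond_exp (P0 n) (F n (j - 1))"
  have eq: "w \<bullet> \<eta> n j x = (\<Sum>a\<in>UNIV. w $ a * \<eta> n j x $ a)" for x by (simp add: inner_vec_def)
  have "AE x in P0 n. ?E (\<lambda>x. \<Sum>a\<in>UNIV. w $ a * \<eta> n j x $ a) x = (\<Sum>a\<in>UNIV. ?E (\<lambda>x. w $ a * \<eta> n j x $ a) x)"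
    using eta_nth_integrable[OF j] by (intro real_cond_exp_sum) auto
  moreover have "AE x in P0 n. \<forall>a\<in>UNIV. ?E (\<lambda>x. w $ a * \<eta> n j x $ a) x = w $ a * ?E (\<lambda>x. \<eta> n j x $ a) x"
    using eta_nth_integrable[OF j] by (intro AE_finite_allI real_cond_exp_cmult) auto
  moreover have "AE x in P0 n. \<forall>a\<in>UNIV. ?E (\<lambda>x. \<eta> n j x $ a) x = 0"
    using score_centred[OF j] by (intro AE_finite_allI) auto
  ultimately show ?thesis unfolding eq by eventually_elim simp
qed

lemma conditional_quadratic_form:
  assumes j: "j \<in> {1..m n}"
  shows "AE x in P0 n. w \<bullet> ((\<chi> a b. real_cond_exp (P0 n) (F n (j - 1)) (\<lambda>z. \<eta> n j z $ a * \<eta> n j z $ b) x) *v w)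
    = real_cond_exp (P0 n) (F n (j - 1)) (\<lambda>z. (w \<bullet> \<eta> n j z)\<^sup>2) x"
proof -
  interpret finite_measure_subalgebra "P0 n" "F n (j - 1)" by (rule sub_F0[OF j])
  let ?E = "real_cond_exp (P0 n) (F n (j - 1))"
  let ?f = "\<lambda>(a, b) z. \<eta> n j z $ a * \<eta> n j z $ b"
  let ?w = "\<lambda>(a, b). w $ a * w $ b"
  have f_int: "integrable (P0 n) (?f i)" for i using eta_product_integrable[OF j] by (cases i) simp
  have eq: "(w \<bullet> \<eta> n j z)\<^sup>2 = (\<Sum>i\<in>UNIV. ?w i * ?f i z)" for z
  proof -
    have "(w \<bullet> \<eta> n j z)\<^sup>2 = (\<Sum>a\<in>UNIV. \<Sum>b\<in>UNIV. (w $ a * \<eta> n j z $ a) * (w $ b * \<eta> n j z $ b))"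
      by (simp add: inner_vec_def power2_eq_square sum_product)
    also have "\<dots> = (\<Sum>i\<in>UNIV \<times> UNIV. ?w i * ?f i z)"
      by (subst sum.cartesian_product) (auto intro!: sum.cong simp: mult_ac)
    finally show ?thesis by simp
  qed
  have "AE x in P0 n. ?E (\<lambda>z. \<Sum>i\<in>UNIV. ?w i * ?f i z) x = (\<Sum>i\<in>UNIV. ?E (\<lambda>z. ?w i * ?f i z) x)"
    using f_int by (intro real_cond_exp_sum) auto
  moreover have "AE x in P0 n. \<forall>i\<in>UNIV. ?E (\<lambda>z. ?w i * ?f i z) x = ?w i * ?E (?f i) x"
    using f_int by (intro AE_finite_allI real_cond_exp_cmult) auto
  ultimately show ?thesis
    unfolding eq
  proof eventually_elim
    case (elim x)
    have "?E (\<lambda>z. \<Sum>i\<in>UNIV. ?w i * ?f i z) x = (\<Sum>i\<in>UNIV. ?E (\<lambda>z. ?w i * ?f i z) x)"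
      by (rule elim(1))
    also have "\<dots> = (\<Sum>i\<in>UNIV. ?w i * ?E (?f i) x)" by (rule sum.cong[OF refl]) (use elim(2) in blast)
    also have "\<dots> = (\<Sum>i\<in>UNIV \<times> UNIV. ?w i * ?E (?f i) x)" by simp
    also have "\<dots> = (\<Sum>a\<in>UNIV. \<Sum>b\<in>UNIV. w $ a * w $ b * ?E (\<lambda>z. \<eta> n j z $ a * \<eta> n j z $ b) x)"
      by (subst sum.cartesian_product) (auto intro!: sum.cong)
    also have "\<dots> = w \<bullet> ((\<chi> a b. ?E (\<lambda>z. \<eta> n j z $ a * \<eta> n j z $ b) x) *v w)"
      by (simp add: inner_vec_def matrix_vector_mult_def sum_distrib_left mult_ac)
    finally show ?case by (rule sym)
  qed
qed

abbreviation T where "T \<equiv> cond_information m R P p \<theta>\<^sub>0 xd r"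
abbreviation V where "V \<equiv> score m p \<theta>\<^sub>0 xd r"

lemma inner_score: "h \<bullet> V n x = (\<Sum>j=1..m n. u h n j x)"
  by (simp add: score_def inner_r inner_sum_right)

lemma score_measurable: "V n \<in> borel_measurable (P0 n)"
proof -
  have "(\<lambda>x. \<Sum>j=1..m n. \<eta> n j x) \<in> borel_measurable (P0 n)"
    using eta_measurable by (intro borel_measurable_sum) auto
  moreover have "continuous_on UNIV (\<lambda>v. r n *v v)" by (intro continuous_intros)
  ultimately show ?thesis unfolding score_def[abs_def] by (rule borel_measurable_continuous_on[rotated])
qed

lemma cond_information_measurable: "T n \<in> borel_measurable (P0 n)"
proof (intro borel_measurable_vecI)
  fix a b
  show "(\<lambda>x. T n x $ a $ b) \<in> borel_measurable (P0 n)"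
    unfolding cond_information_def matrix_matrix_mult_def vec_lambda_beta sum_component
    by (intro borel_measurable_sum borel_measurable_times borel_measurable_const borel_measurable_cond_exp2)
qed

lemma transpose_cond_information: "transpose (T n x) = T n x"
proof -
  let ?S = "\<Sum>j=1..m n. \<chi> a b. real_cond_exp (P0 n) (F n (j - 1)) (\<lambda>z. \<eta> n j z $ a * \<eta> n j z $ b) x"
  have "transpose ?S = ?S" by (simp add: vec_eq_iff transpose_def mult.commute)
  then show ?thesis by (simp add: cond_information_def matrix_transpose_mul transpose_r matrix_mul_assoc)
qed

lemma quadratic_form_cond_information:
  "AE x in P0 n. h \<bullet> (T n x *v h)
    = (\<Sum>j=1..m n. real_cond_exp (P0 n) (F n (j - 1)) (\<lambda>z. (u h n j z)\<^sup>2) x)"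
proof -
  let ?C = "\<lambda>j x. \<chi> a b. real_cond_exp (P0 n) (F n (j - 1)) (\<lambda>z. \<eta> n j z $ a * \<eta> n j z $ b) x"
  let ?w = "r n *v h"
  have "AE x in P0 n. \<forall>j\<in>{1..m n}. ?w \<bullet> (?C j x *v ?w)
      = real_cond_exp (P0 n) (F n (j - 1)) (\<lambda>z. (?w \<bullet> \<eta> n j z)\<^sup>2) x"
    by (intro AE_finite_allI conditional_quadratic_form) simp
  then show ?thesis
  proof eventually_elim
    case (elim x)
    have "h \<bullet> (T n x *v h) = ?w \<bullet> ((\<Sum>j=1..m n. ?C j x) *v ?w)"
      by (simp add: cond_information_def matrix_vector_mul_assoc[symmetric] inner_r)
    also have "\<dots> = (\<Sum>j=1..m n. ?w \<bullet> (?C j x *v ?w))"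
      by (simp add: sum_matrix_vector_mult inner_sum_right)
    finally show ?case using elim by (simp add: inner_r)
  qed
qed

text \<open>In each fixed direction the quadratic form is almost surely a sum of conditional expectations of squares. The
  exceptional null set depends on the direction, whence the detour through a countable dense set of directions.\<close>

lemma nonneg_definite_cond_information: "AE x in P0 n. nonneg_definite (T n x)"
proof -
  obtain D :: "(real^'d) set" where D: "countable D" "\<And>X. open X \<Longrightarrow> X \<noteq> {} \<Longrightarrow> \<exists>d\<in>D. d \<in> X"
    using countable_dense_setE by metis
  have dense: "closure D = UNIV"
  proof (rule ccontr)
    assume "closure D \<noteq> UNIV"
    then obtain d where "d \<in> D" "d \<in> - closure D" using D(2)[of "- closure D"] by auto
    then show False using closure_subset[of D] by auto
  qed
  have "AE x in P0 n. \<forall>h\<in>D. 0 \<le> h \<bullet> (T n x *v h)"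
  proof (rule AE_ball_countable[OF D(1), THEN iffD2], rule ballI)
    fix h
    have "AE x in P0 n. \<forall>j\<in>{1..m n}. 0 \<le> real_cond_exp (P0 n) (F n (j - 1)) (\<lambda>z. (u h n j z)\<^sup>2) x"
    proof (intro AE_finite_allI)
      fix j assume j: "j \<in> {1..m n}"
      interpret finite_measure_subalgebra "P0 n" "F n (j - 1)" by (rule sub_F0[OF j])
      show "AE x in P0 n. 0 \<le> real_cond_exp (P0 n) (F n (j - 1)) (\<lambda>z. (u h n j z)\<^sup>2) x"
        using inner_eta_square_integrable[OF j, of "r n *v h"]
        by (intro real_cond_exp_pos) (auto simp: inner_r)
    qed simp
    then show "AE x in P0 n. 0 \<le> h \<bullet> (T n x *v h)"
      using quadratic_form_cond_information[of h n] by eventually_elim (auto intro!: sum_nonneg)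
  qed
  then show ?thesis
    by eventually_elim (rule nonneg_definite_if_dense[OF transpose_cond_information dense], blast)
qed

section \<open>Increments of the root likelihood\<close>

text \<open>Where \<open>p \<theta>\<^sub>0\<close> vanishes, division by zero yields the value \<open>-1\<close>; this happens with probability \<open>0\<close>.\<close>

definition Z :: "real^'d \<Rightarrow> nat \<Rightarrow> nat \<Rightarrow> (nat \<Rightarrow> 'a) \<Rightarrow> real" where
  "Z h n j x = sqrt (p (shift h n) n j (restrict x {1..j}) / p \<theta>\<^sub>0 n j (restrict x {1..j})) - 1"

definition root_error :: "real^'d \<Rightarrow> nat \<Rightarrow> nat \<Rightarrow> ennreal" where
  "root_error h n j = (\<integral>\<^sup>+x. (\<integral>\<^sup>+y.
     ennreal ((xi p \<theta>\<^sub>0 r h n j (extend x j y)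
       - 1/2 * (h \<bullet> (r n *v xd n j (extend x j y))))\<^sup>2) \<partial>\<mu> n j) \<partial>P0 n)"

text \<open>This is the part of the alternative conditional law that the likelihood ratio does not see.\<close>

definition singular_mass :: "real^'d \<Rightarrow> nat \<Rightarrow> nat \<Rightarrow> (nat \<Rightarrow> 'a) \<Rightarrow> ennreal" where
  "singular_mass h n j x = (\<integral>\<^sup>+y. (if p \<theta>\<^sub>0 n j (extend x j y) = 0
     then ennreal (p (shift h n) n j (extend x j y)) else 0) \<partial>\<mu> n j)"

text \<open>Multiplying \<open>Z - u / 2\<close> by the root of \<open>p \<theta>\<^sub>0\<close> gives the error of the linear approximation of the root
  densities; integration against \<open>p \<theta>\<^sub>0\<close> only keeps the part of that error where \<open>p \<theta>\<^sub>0\<close> does not vanish.\<close>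

lemma approximation_integral_le:
  assumes \<theta>: "shift h n \<in> \<Theta>" and j: "j \<in> {1..m n}"
  shows "(\<integral>\<^sup>+x. ennreal ((Z h n j x - (u h n j x) / 2)\<^sup>2) \<partial>P0 n) \<le> root_error h n j"
proof -
  let ?p = "p (shift h n) n j" and ?q = "p \<theta>\<^sub>0 n j"
  let ?f = "\<lambda>z. ennreal ((sqrt (?p z / ?q z) - 1 - (h \<bullet> (r n *v eta_history n j z)) / 2)\<^sup>2)"
  have [measurable]: "?p \<in> borel_measurable (hist n j)" "?q \<in> borel_measurable (hist n j)"
    "eta_history n j \<in> borel_measurable (hist n j)"
    using p_measurable[OF \<theta> j] p_measurable[OF \<theta>\<^sub>0 j] eta_history_measurable[OF j] by auto
  have f: "?f \<in> borel_measurable (hist n j)" unfolding inner_r by measurable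
  have key: "?f z * ennreal (?q z) \<le> ennreal ((xi p \<theta>\<^sub>0 r h n j z - 1/2 * (h \<bullet> (r n *v xd n j z)))\<^sup>2)"
    if z: "z \<in> space (hist n j)" for z
  proof (cases "?q z = 0")
    case False
    have q: "0 \<le> ?q z" and p: "0 \<le> ?p z" using p_nonneg \<theta> \<theta>\<^sub>0 j z by auto
    define s where "s = sqrt (?q z)"
    have s: "0 < s" "s\<^sup>2 = ?q z" using q False by (auto simp: s_def)
    have "(sqrt (?p z / ?q z) - 1 - (h \<bullet> (r n *v eta_history n j z)) / 2) * s
        = xi p \<theta>\<^sub>0 r h n j z - 1/2 * (h \<bullet> (r n *v xd n j z))"
      using s(1) False
      by (simp add: xi_def eta_history_def real_sqrt_divide s_def[symmetric] matrix_vector_mult_scaleR field_simps)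
    then have "(xi p \<theta>\<^sub>0 r h n j z - 1/2 * (h \<bullet> (r n *v xd n j z)))\<^sup>2
        = (sqrt (?p z / ?q z) - 1 - (h \<bullet> (r n *v eta_history n j z)) / 2)\<^sup>2 * ?q z"
      by (metis power_mult_distrib s(2))
    then show ?thesis using q by (simp add: ennreal_mult)
  qed simp
  have "(\<integral>\<^sup>+x. ennreal ((Z h n j x - (u h n j x) / 2)\<^sup>2) \<partial>P0 n) = (\<integral>\<^sup>+x. ?f (restrict x {1..j}) \<partial>P0 n)"
    by (simp add: Z_def eta_eq)
  also have "\<dots> = (\<integral>\<^sup>+x. (\<integral>\<^sup>+y. ?f (extend x j y) * ennreal (?q (extend x j y)) \<partial>\<mu> n j) \<partial>P0 n)"
    by (rule disintegration_1[OF \<theta>\<^sub>0 j f])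
  also have "\<dots> \<le> root_error h n j"
    unfolding root_error_def
  proof (intro nn_integral_mono)
    fix x y assume x: "x \<in> space (P0 n)" and y: "y \<in> space (\<mu> n j)"
    show "?f (extend x j y) * ennreal (?q (extend x j y))
        \<le> ennreal ((xi p \<theta>\<^sub>0 r h n j (extend x j y)
          - 1/2 * (h \<bullet> (r n *v xd n j (extend x j y))))\<^sup>2)"
      using j x by (intro key upd_in_histories[OF j _ y] measurable_space[OF restrict_measurable[OF \<theta>\<^sub>0]]) auto
  qed
  finally show ?thesis .
qed

text \<open>The conditional density at \<open>\<theta>\<^sub>0 + r n *v h\<close> has total mass \<open>1\<close>. The part of it on \<open>p \<theta>\<^sub>0 \<noteq> 0\<close> is
  \<open>(1 + Z)\<^sup>2\<close> times \<open>p \<theta>\<^sub>0\<close>.\<close>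

lemma likelihood_mass:
  assumes \<theta>: "shift h n \<in> \<Theta>" and j: "j \<in> {1..m n}"
    and c: "c \<in> borel_measurable (past n j)"
  shows "(\<integral>\<^sup>+x. c (restrict x {1..<j}) * ennreal ((1 + Z h n j x)\<^sup>2) \<partial>P0 n)
      + (\<integral>\<^sup>+x. c (restrict x {1..<j}) * singular_mass h n j x \<partial>P0 n)
    = (\<integral>\<^sup>+x. c (restrict x {1..<j}) \<partial>P0 n)"
proof -
  let ?p = "p (shift h n) n j" and ?q = "p \<theta>\<^sub>0 n j"
  let ?H = "hist n j" and ?H' = "past n j"
  let ?f = "\<lambda>z. ennreal ((1 + (sqrt (?p z / ?q z) - 1))\<^sup>2)"
  let ?x = "\<lambda>x::nat \<Rightarrow> 'a. restrict x {1..<j}"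
  have [measurable]: "?p \<in> borel_measurable ?H" "?q \<in> borel_measurable ?H"
    using p_measurable[OF \<theta> j] p_measurable[OF \<theta>\<^sub>0 j] by auto
  have f: "?f \<in> borel_measurable ?H" by measurable
  have sing: "(\<lambda>z. if ?q z = 0 then ennreal (?p z) else 0) \<in> borel_measurable ?H"
    and abs: "(\<lambda>z. ?f z * ennreal (?q z)) \<in> borel_measurable ?H" by measurable
  have r: "?x \<in> measurable (P0 n) ?H'" using j by (intro restrict_measurable[OF \<theta>\<^sub>0]) auto
  have "(\<integral>\<^sup>+x. c (?x x) * ennreal ((1 + Z h n j x)\<^sup>2) \<partial>P0 n)
      = (\<integral>\<^sup>+x. c (?x x) * (\<integral>\<^sup>+y. ?f ((?x x)(j := y)) * ennreal (?q ((?x x)(j := y))) \<partial>\<mu> n j) \<partial>P0 n)"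
    unfolding Z_def by (rule disintegration[OF \<theta>\<^sub>0 j c f])
  moreover have "(\<integral>\<^sup>+x. c (?x x) * (\<integral>\<^sup>+y. ?f ((?x x)(j := y)) * ennreal (?q ((?x x)(j := y))) \<partial>\<mu> n j) \<partial>P0 n)
      + (\<integral>\<^sup>+x. c (?x x) * singular_mass h n j x \<partial>P0 n)
    = (\<integral>\<^sup>+x. c (?x x) * (\<integral>\<^sup>+y. ?f ((?x x)(j := y)) * ennreal (?q ((?x x)(j := y))) \<partial>\<mu> n j)
      + c (?x x) * singular_mass h n j x \<partial>P0 n)"
    unfolding singular_mass_def
    by (intro nn_integral_add[symmetric] borel_measurable_times_ennreal measurable_compose[OF r c]
        measurable_compose[OF r section_integral_measurable[OF j sing]]
        measurable_compose[OF r section_integral_measurable[OF j abs]])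
  moreover have "\<dots> = (\<integral>\<^sup>+x. c (?x x) \<partial>P0 n)"
  proof (rule nn_integral_cong)
    fix x assume x: "x \<in> space (P0 n)"
    have x': "?x x \<in> space ?H'" by (rule measurable_space[OF r x])
    have "(\<integral>\<^sup>+y. ?f ((?x x)(j := y)) * ennreal (?q ((?x x)(j := y))) \<partial>\<mu> n j) + singular_mass h n j x
        = (\<integral>\<^sup>+y. ?f ((?x x)(j := y)) * ennreal (?q ((?x x)(j := y)))
          + (if ?q ((?x x)(j := y)) = 0 then ennreal (?p ((?x x)(j := y))) else 0) \<partial>\<mu> n j)"
      unfolding singular_mass_def
      by (intro nn_integral_add[symmetric] section_measurable[OF j x' sing] section_measurable[OF j x' abs])
    also have "\<dots> = (\<integral>\<^sup>+y. ennreal (?p ((?x x)(j := y))) \<partial>\<mu> n j)"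
    proof (rule nn_integral_cong)
      fix y assume y: "y \<in> space (\<mu> n j)"
      let ?z = "(?x x)(j := y)"
      have "?z \<in> space ?H" by (rule upd_in_histories[OF j x' y])
      then have q: "0 \<le> ?q ?z" and p: "0 \<le> ?p ?z" using p_nonneg \<theta> \<theta>\<^sub>0 j by auto
      show "?f ?z * ennreal (?q ?z) + (if ?q ?z = 0 then ennreal (?p ?z) else 0) = ennreal (?p ?z)"
        using p q by (simp add: ennreal_mult''[symmetric])
    qed
    also have "\<dots> = 1" by (rule section_density_integral[OF \<theta> j x'])
    finally show "c (?x x) * (\<integral>\<^sup>+y. ?f ((?x x)(j := y)) * ennreal (?q ((?x x)(j := y))) \<partial>\<mu> n j)
      + c (?x x) * singular_mass h n j x = c (?x x)"
      by (simp add: distrib_left[symmetric])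
  qed
  ultimately show ?thesis by simp
qed

text \<open>Let \<open>s\<close> and \<open>s'\<close> be the roots of the densities in directions \<open>h\<close> and \<open>- h\<close> at a point where
  \<open>p \<theta>\<^sub>0\<close> vanishes. The linear approximations there are \<open>a\<close> and \<open>- a\<close>. Since \<open>s\<close> and \<open>s'\<close> are
  nonnegative, one of the two errors is at least \<open>\<bar>a\<bar>\<close>, whichever sign \<open>a\<close> has. Thus the errors
  control \<open>a\<close> and therefore \<open>s\<close>.\<close>

lemma singular_mass_le:
  assumes \<theta>: "shift h n \<in> \<Theta>" and \<theta>': "shift (- h) n \<in> \<Theta>" and j: "j \<in> {1..m n}"
  shows "(\<integral>\<^sup>+x. singular_mass h n j x \<partial>P0 n) \<le> 4 * root_error h n j + 2 * root_error (- h) n j"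
proof -
  let ?H = "hist n j" and ?H' = "past n j"
  let ?x = "\<lambda>x::nat \<Rightarrow> 'a. restrict x {1..<j}"
  let ?e = "\<lambda>h z. ennreal ((xi p \<theta>\<^sub>0 r h n j z - 1/2 * (h \<bullet> (r n *v xd n j z)))\<^sup>2)"
  have e: "?e g \<in> borel_measurable ?H" if g: "shift g n \<in> \<Theta>" for g
  proof -
    have [measurable]: "p (shift g n) n j \<in> borel_measurable ?H" "p \<theta>\<^sub>0 n j \<in> borel_measurable ?H"
      "xd n j \<in> borel_measurable ?H"
      using p_measurable[OF g j] p_measurable[OF \<theta>\<^sub>0 j] xd_measurable[OF j] by auto
    show ?thesis unfolding xi_def inner_r by measurable
  qed
  have key: "(if p \<theta>\<^sub>0 n j z = 0 then ennreal (p (shift h n) n j z) else 0) \<le> 4 * ?e h z + 2 * ?e (- h) z"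
    if z: "z \<in> space ?H" for z
  proof -
    define a where "a = 1/2 * (h \<bullet> (r n *v xd n j z))"
    define s where "s = sqrt (p (shift h n) n j z)"
    define s' where "s' = sqrt (p (shift (- h) n) n j z)"
    have nonneg: "0 \<le> s" "0 \<le> s'" and s2: "s\<^sup>2 = p (shift h n) n j z"
      unfolding s_def s'_def using p_nonneg[OF \<theta> j z] p_nonneg[OF \<theta>' j z] by auto
    show "(if p \<theta>\<^sub>0 n j z = 0 then ennreal (p (shift h n) n j z) else 0) \<le> 4 * ?e h z + 2 * ?e (- h) z"
    proof (cases "p \<theta>\<^sub>0 n j z = 0")
      case True
      have a2: "a\<^sup>2 \<le> (s - a)\<^sup>2 + (s' + a)\<^sup>2"
      proof (cases "a \<le> 0")
        case True
        then have "\<bar>a\<bar> \<le> \<bar>s - a\<bar>" using nonneg by linarith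
        then have "a\<^sup>2 \<le> (s - a)\<^sup>2" by (rule abs_le_square_iff[THEN iffD1])
        then show ?thesis using zero_le_power2[of "s' + a"] by linarith
      next
        case False
        then have "\<bar>a\<bar> \<le> \<bar>s' + a\<bar>" using nonneg by linarith
        then have "a\<^sup>2 \<le> (s' + a)\<^sup>2" by (rule abs_le_square_iff[THEN iffD1])
        then show ?thesis using zero_le_power2[of "s - a"] by linarith
      qed
      \<comment> \<open>The parallelogram identity for \<open>s - a\<close> and \<open>a\<close>.\<close>
      have "s\<^sup>2 + (s - 2 * a)\<^sup>2 = 2 * (s - a)\<^sup>2 + 2 * a\<^sup>2" by (simp add: power2_eq_square algebra_simps)
      then have "s\<^sup>2 \<le> 2 * (s - a)\<^sup>2 + 2 * a\<^sup>2" using zero_le_power2[of "s - 2 * a"] by linarith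
      then have "s\<^sup>2 \<le> 4 * (s - a)\<^sup>2 + 2 * (s' + a)\<^sup>2" using a2 by linarith
      then have "ennreal (s\<^sup>2) \<le> ennreal (4 * (s - a)\<^sup>2 + 2 * (s' + a)\<^sup>2)" by (rule ennreal_leI)
      also have "\<dots> = 4 * ennreal ((s - a)\<^sup>2) + 2 * ennreal ((s' + a)\<^sup>2)"
        by (simp add: ennreal_plus ennreal_mult)
      also have "s - a = xi p \<theta>\<^sub>0 r h n j z - 1/2 * (h \<bullet> (r n *v xd n j z))"
        using True by (simp add: xi_def s_def a_def)
      also have "s' + a = xi p \<theta>\<^sub>0 r (- h) n j z - 1/2 * (- h \<bullet> (r n *v xd n j z))"
        using True by (simp add: xi_def s'_def a_def)
      finally show ?thesis using True s2 by simp
    qed simp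
  qed
  have r: "?x \<in> measurable (P0 n) ?H'" using j by (intro restrict_measurable[OF \<theta>\<^sub>0]) auto
  have "(\<integral>\<^sup>+x. singular_mass h n j x \<partial>P0 n)
      \<le> (\<integral>\<^sup>+x. 4 * (\<integral>\<^sup>+y. ?e h ((?x x)(j := y)) \<partial>\<mu> n j) + 2 * (\<integral>\<^sup>+y. ?e (- h) ((?x x)(j := y)) \<partial>\<mu> n j) \<partial>P0 n)"
  proof (rule nn_integral_mono)
    fix x assume x: "x \<in> space (P0 n)"
    have x': "?x x \<in> space ?H'" by (rule measurable_space[OF r x])
    have m1: "(\<lambda>y. ?e h ((?x x)(j := y))) \<in> borel_measurable (\<mu> n j)"
      and m2: "(\<lambda>y. ?e (- h) ((?x x)(j := y))) \<in> borel_measurable (\<mu> n j)"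
      by (rule section_measurable[OF j x' e[OF \<theta>]], rule section_measurable[OF j x' e[OF \<theta>']])
    have "singular_mass h n j x \<le> (\<integral>\<^sup>+y. 4 * ?e h ((?x x)(j := y)) + 2 * ?e (- h) ((?x x)(j := y)) \<partial>\<mu> n j)"
      unfolding singular_mass_def
    proof (rule nn_integral_mono)
      fix y assume y: "y \<in> space (\<mu> n j)"
      show "(if p \<theta>\<^sub>0 n j ((?x x)(j := y)) = 0 then ennreal (p (shift h n) n j ((?x x)(j := y))) else 0)
          \<le> 4 * ?e h ((?x x)(j := y)) + 2 * ?e (- h) ((?x x)(j := y))"
        by (rule key[OF upd_in_histories[OF j x' y]])
    qed
    also have "\<dots> = 4 * (\<integral>\<^sup>+y. ?e h ((?x x)(j := y)) \<partial>\<mu> n j) + 2 * (\<integral>\<^sup>+y. ?e (- h) ((?x x)(j := y)) \<partial>\<mu> n j)"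
      using m1 m2 by (subst nn_integral_add) (auto simp: nn_integral_cmult)
    finally show "singular_mass h n j x
        \<le> 4 * (\<integral>\<^sup>+y. ?e h ((?x x)(j := y)) \<partial>\<mu> n j) + 2 * (\<integral>\<^sup>+y. ?e (- h) ((?x x)(j := y)) \<partial>\<mu> n j)" .
  qed
  also have "\<dots> = 4 * root_error h n j + 2 * root_error (- h) n j"
  proof -
    have M1: "(\<lambda>x. \<integral>\<^sup>+y. ?e h ((?x x)(j := y)) \<partial>\<mu> n j) \<in> borel_measurable (P0 n)"
      and M2: "(\<lambda>x. \<integral>\<^sup>+y. ?e (- h) ((?x x)(j := y)) \<partial>\<mu> n j) \<in> borel_measurable (P0 n)"
      by (rule measurable_compose[OF r section_integral_measurable[OF j e[OF \<theta>]]],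
          rule measurable_compose[OF r section_integral_measurable[OF j e[OF \<theta>']]])
    then show ?thesis
      unfolding root_error_def by (subst nn_integral_add) (auto simp: nn_integral_cmult)
  qed
  finally show ?thesis .
qed


lemma Z_adapted:
  assumes \<theta>: "shift h n \<in> \<Theta>" and j: "j \<in> {1..m n}"
  shows "Z h n j \<in> borel_measurable (F n j)"
proof -
  have [measurable]: "p (shift h n) n j \<in> borel_measurable (hist n j)"
    "p \<theta>\<^sub>0 n j \<in> borel_measurable (hist n j)"
    using p_measurable[OF \<theta> j] p_measurable[OF \<theta>\<^sub>0 j] by auto
  have "(\<lambda>z. sqrt (p (shift h n) n j z / p \<theta>\<^sub>0 n j z) - 1) \<in> borel_measurable (hist n j)"
    by measurable
  then show ?thesis
    unfolding Z_def[abs_def] using j by (intro measurable_history_algebra[of j n]) auto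
qed

lemma Z_measurable:
  assumes "shift h n \<in> \<Theta>" and "j \<in> {1..m n}"
  shows "Z h n j \<in> borel_measurable (P0 n)"
  using assms by (intro adapted_measurable[OF _ Z_adapted]) auto

lemma likelihood_increment_integrable:
  assumes \<theta>: "shift h n \<in> \<Theta>" and j: "j \<in> {1..m n}"
  shows "integrable (P0 n) (\<lambda>x. (1 + Z h n j x)\<^sup>2)"
proof (rule integrableI_nonneg)
  interpret prob_space "P0 n" by (rule prob_P[OF \<theta>\<^sub>0])
  show "(\<lambda>x. (1 + Z h n j x)\<^sup>2) \<in> borel_measurable (P0 n)" using Z_measurable[OF assms] by measurable
  have "(\<integral>\<^sup>+x. ennreal ((1 + Z h n j x)\<^sup>2) \<partial>P0 n) + (\<integral>\<^sup>+x. singular_mass h n j x \<partial>P0 n) = 1"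
    using likelihood_mass[OF \<theta> j, of "\<lambda>_. 1"] emeasure_space_1 by simp
  then have "(\<integral>\<^sup>+x. ennreal ((1 + Z h n j x)\<^sup>2) \<partial>P0 n) \<le> 1" by (metis le_iff_add)
  then show "(\<integral>\<^sup>+x. ennreal ((1 + Z h n j x)\<^sup>2) \<partial>P0 n) < \<infinity>" using order_le_less_trans by fastforce
qed simp

lemma Z_square_integrable:
  assumes \<theta>: "shift h n \<in> \<Theta>" and j: "j \<in> {1..m n}"
  shows "integrable (P0 n) (\<lambda>x. (Z h n j x)\<^sup>2)"
proof -
  interpret prob_space "P0 n" by (rule prob_P[OF \<theta>\<^sub>0])
  have [measurable]: "Z h n j \<in> borel_measurable (P0 n)" by (rule Z_measurable[OF assms])
  have "integrable (P0 n) (\<lambda>x. ((1 + Z h n j x) - 1)\<^sup>2)"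
    by (intro square_integrable_diff likelihood_increment_integrable[OF assms]) simp_all
  then show ?thesis by simp
qed

lemma mass_loss_set_integral:
  assumes \<theta>: "shift h n \<in> \<Theta>" and j: "j \<in> {1..m n}" and A: "A \<in> sets (F n (j - 1))"
  shows "0 \<le> (\<integral>x\<in>A. 1 - (1 + Z h n j x)\<^sup>2 \<partial>P0 n)"
proof -
  interpret prob_space "P0 n" by (rule prob_P[OF \<theta>\<^sub>0])
  have past: "{1..<j} = {1..j - 1}" using j by auto
  obtain S where S: "S \<in> sets (past n j)"
      "A = (\<lambda>x. restrict x {1..<j}) -` S \<inter> space (P0 n)"
    using A j unfolding past by (auto simp: sets_history_algebra space_P[OF \<theta>\<^sub>0])
  have A_sets: "A \<in> sets (P0 n)"
    unfolding S(2) using j by (intro measurable_sets[OF restrict_measurable[OF \<theta>\<^sub>0] S(1)]) auto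
  have ind: "indicator S (restrict x {1..<j}) = (indicator A x :: ennreal)" if "x \<in> space (P0 n)" for x
    using that by (auto simp: S(2) indicator_def)
  note int = likelihood_increment_integrable[OF \<theta> j]
  have int_A: "integrable (P0 n) (\<lambda>x. indicator A x * (1 + Z h n j x)\<^sup>2)"
    using integrable_mult_indicator[OF A_sets int] by simp
  have "ennreal (\<integral>x. indicator A x * (1 + Z h n j x)\<^sup>2 \<partial>P0 n)
      = (\<integral>\<^sup>+x. ennreal (indicator A x * (1 + Z h n j x)\<^sup>2) \<partial>P0 n)"
    using int_A by (intro nn_integral_eq_integral[symmetric]) auto
  also have "\<dots> = (\<integral>\<^sup>+x. indicator S (restrict x {1..<j}) * ennreal ((1 + Z h n j x)\<^sup>2) \<partial>P0 n)"
  proof (rule nn_integral_cong)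
    fix x assume "x \<in> space (P0 n)"
    then show "ennreal (indicator A x * (1 + Z h n j x)\<^sup>2)
        = indicator S (restrict x {1..<j}) * ennreal ((1 + Z h n j x)\<^sup>2)"
      by (subst ind) (simp_all add: ennreal_mult'' ennreal_indicator)
  qed
  also have "\<dots> \<le> (\<integral>\<^sup>+x. indicator S (restrict x {1..<j}) \<partial>P0 n)"
    by (rule ord_le_eq_trans[OF add_increasing2[OF zero_le order_refl]
          likelihood_mass[OF \<theta> j borel_measurable_indicator[OF S(1)]]])
  also have "\<dots> = (\<integral>\<^sup>+x. indicator A x \<partial>P0 n)" by (intro nn_integral_cong ind)
  also have "\<dots> = ennreal (measure (P0 n) A)" using A_sets by (simp add: emeasure_eq_measure)
  finally have "(\<integral>x. indicator A x * (1 + Z h n j x)\<^sup>2 \<partial>P0 n) \<le> measure (P0 n) A"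
    by (simp add: ennreal_le_iff)
  moreover have "(\<integral>x\<in>A. 1 - (1 + Z h n j x)\<^sup>2 \<partial>P0 n)
      = measure (P0 n) A - (\<integral>x. indicator A x * (1 + Z h n j x)\<^sup>2 \<partial>P0 n)"
  proof -
    have "integrable (P0 n) (indicator A :: _ \<Rightarrow> real)"
      using A_sets by (intro integrable_real_indicator) (auto simp: emeasure_eq_measure)
    then show ?thesis
      using int_A A_sets sets.sets_into_space[OF A_sets]
      by (simp add: set_lebesgue_integral_def right_diff_distrib Int_absorb2)
  qed
  ultimately show ?thesis by simp
qed

lemma mass_loss_integral:
  assumes \<theta>: "shift h n \<in> \<Theta>" and \<theta>': "shift (- h) n \<in> \<Theta>" and j: "j \<in> {1..m n}"
  shows "0 \<le> (\<integral>x. 1 - (1 + Z h n j x)\<^sup>2 \<partial>P0 n)"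
    and "ennreal (\<integral>x. 1 - (1 + Z h n j x)\<^sup>2 \<partial>P0 n) \<le> 4 * root_error h n j + 2 * root_error (- h) n j"
proof -
  interpret prob_space "P0 n" by (rule prob_P[OF \<theta>\<^sub>0])
  note int = likelihood_increment_integrable[OF \<theta> j]
  let ?I = "\<integral>x. (1 + Z h n j x)\<^sup>2 \<partial>P0 n"
  have eq: "(\<integral>x. 1 - (1 + Z h n j x)\<^sup>2 \<partial>P0 n) = 1 - ?I" using int by (simp add: prob_space)
  have I: "ennreal ?I = (\<integral>\<^sup>+x. ennreal ((1 + Z h n j x)\<^sup>2) \<partial>P0 n)"
    using int by (intro nn_integral_eq_integral[symmetric]) auto
  have sum: "ennreal ?I + (\<integral>\<^sup>+x. singular_mass h n j x \<partial>P0 n) = 1"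
    using likelihood_mass[OF \<theta> j, of "\<lambda>_. 1"] emeasure_space_1 I by simp
  then have "ennreal ?I \<le> ennreal 1" by (metis le_iff_add ennreal_1)
  then show "0 \<le> (\<integral>x. 1 - (1 + Z h n j x)\<^sup>2 \<partial>P0 n)" unfolding eq by (simp add: ennreal_le_iff)
  have "ennreal (1 - ?I) = 1 - ennreal ?I" by (subst ennreal_minus[symmetric]) simp_all
  also have "\<dots> = (\<integral>\<^sup>+x. singular_mass h n j x \<partial>P0 n)"
    using sum by (metis ennreal_add_diff_cancel_left ennreal_neq_top infinity_ennreal_def)
  also have "\<dots> \<le> 4 * root_error h n j + 2 * root_error (- h) n j"
    by (rule singular_mass_le[OF assms])
  finally show "ennreal (\<integral>x. 1 - (1 + Z h n j x)\<^sup>2 \<partial>P0 n) \<le> 4 * root_error h n j + 2 * root_error (- h) n j"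
    unfolding eq .
qed

lemma root_error_vanishes: "(\<lambda>n. \<Sum>j=1..m n. root_error h n j) \<longlonglongrightarrow> 0"
  unfolding root_error_def by (rule root_differentiable)

text \<open>The shift by \<open>N\<close> discards the finitely many \<open>n\<close> for which \<open>\<theta>\<^sub>0 + r n *v h\<close> or
  \<open>\<theta>\<^sub>0 - r n *v h\<close> is not a parameter.\<close>

lemma increment_array_tail:
  assumes \<theta>: "\<And>n. N \<le> n \<Longrightarrow> shift h n \<in> \<Theta>" and \<theta>': "\<And>n. N \<le> n \<Longrightarrow> shift (- h) n \<in> \<Theta>"
    and K: "0 < K" "\<And>n. (\<Sum>j=1..m n. \<integral>\<^sup>+x. ennreal (\<bar>u h n j x\<bar>\<^sup>2) \<partial>P0 n) \<le> ennreal K"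
  shows "increment_array (\<lambda>n. P0 (n + N)) (\<lambda>n. F (n + N)) (\<lambda>n. m (n + N)) (\<lambda>n. Z h (n + N))
    (\<lambda>n j x. u h (n + N) j x) K"
proof (rule increment_array.intro)
  fix n j
  let ?n = "n + N"
  note \<theta>n = \<theta>[of ?n, simplified] and \<theta>'n = \<theta>'[of ?n, simplified]
  show "finite_filtration (P0 ?n) (F ?n) (m ?n)" by (rule filtration0)
  assume j: "j \<in> {1..m ?n}"
  show "Z h ?n j \<in> borel_measurable (F ?n j)" by (rule Z_adapted[OF \<theta>n j])
  show "(\<lambda>x. u h ?n j x) \<in> borel_measurable (F ?n j)"
    unfolding inner_r by (rule inner_eta_measurable[OF j])
  show "integrable (P0 ?n) (\<lambda>x. (Z h ?n j x)\<^sup>2)" by (rule Z_square_integrable[OF \<theta>n j])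
  show "integrable (P0 ?n) (\<lambda>x. (u h ?n j x)\<^sup>2)"
    unfolding inner_r by (rule inner_eta_square_integrable[OF j])
  show "AE x in P0 ?n. real_cond_exp (P0 ?n) (F ?n (j - 1)) (\<lambda>x. u h ?n j x) x = 0"
    unfolding inner_r by (rule inner_eta_centred[OF j])
  interpret finite_measure_subalgebra "P0 ?n" "F ?n (j - 1)" by (rule sub_F0[OF j])
  show "AE x in P0 ?n. 0 \<le> real_cond_exp (P0 ?n) (F ?n (j - 1)) (\<lambda>x. 1 - (1 + Z h ?n j x)\<^sup>2) x"
    by (intro real_cond_exp_nonneg_if_set_integrals_nonneg mass_loss_set_integral[OF \<theta>n j]
        Bochner_Integration.integrable_diff likelihood_increment_integrable[OF \<theta>n j]) simp
next
  have tail: "(\<lambda>n. \<Sum>j=1..m (n + N). root_error g (n + N) j) \<longlonglongrightarrow> 0" for g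
    using LIMSEQ_ignore_initial_segment[OF root_error_vanishes[of g], of N] by simp
  show "(\<lambda>n. \<Sum>j=1..m (n + N). \<integral>x. (Z h (n + N) j x - u h (n + N) j x / 2)\<^sup>2 \<partial>P0 (n + N)) \<longlonglongrightarrow> 0"
  proof (rule tendsto_zero_if_ennreal_le[OF _ _ tail[of h]])
    fix n
    let ?n = "n + N"
    note \<theta>n = \<theta>[of ?n, simplified]
    let ?e = "\<lambda>j x. (Z h ?n j x - u h ?n j x / 2)\<^sup>2"
    have "ennreal (\<integral>x. ?e j x \<partial>P0 ?n) \<le> root_error h ?n j"
      if j: "j \<in> {1..m ?n}" for j
    proof -
      have "(\<lambda>x. u h ?n j x) \<in> borel_measurable (P0 ?n)"
        unfolding inner_r using j by (intro adapted_measurable[OF _ inner_eta_measurable]) auto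
      moreover have "integrable (P0 ?n) (\<lambda>x. (u h ?n j x / 2)\<^sup>2)"
        unfolding power_divide inner_r using inner_eta_square_integrable[OF j] by simp
      ultimately have "integrable (P0 ?n) (\<lambda>x. ?e j x)"
        by (intro square_integrable_diff Z_measurable[OF \<theta>n j] Z_square_integrable[OF \<theta>n j]) simp_all
      then have "ennreal (\<integral>x. ?e j x \<partial>P0 ?n)
          = (\<integral>\<^sup>+x. ennreal (?e j x) \<partial>P0 ?n)"
        by (intro nn_integral_eq_integral[symmetric]) auto
      also have "\<dots> \<le> root_error h ?n j" by (rule approximation_integral_le[OF \<theta>n j])
      finally show ?thesis .
    qed
    then have "(\<Sum>j=1..m ?n. ennreal (\<integral>x. ?e j x \<partial>P0 ?n))
        \<le> (\<Sum>j=1..m ?n. root_error h ?n j)"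
      by (rule sum_mono)
    then show "ennreal (\<Sum>j=1..m ?n. \<integral>x. ?e j x \<partial>P0 ?n)
        \<le> (\<Sum>j=1..m ?n. root_error h ?n j)"
      by (subst (asm) sum_ennreal) simp_all
  qed (auto intro!: sum_nonneg)
  show "(\<lambda>n. \<Sum>j=1..m (n + N). \<integral>x. 1 - (1 + Z h (n + N) j x)\<^sup>2 \<partial>P0 (n + N)) \<longlonglongrightarrow> 0"
  proof (rule tendsto_zero_if_ennreal_le)
    have "(\<lambda>n. 4 * (\<Sum>j=1..m (n + N). root_error h (n + N) j) + 2 * (\<Sum>j=1..m (n + N). root_error (- h) (n + N) j))
        \<longlonglongrightarrow> 4 * 0 + 2 * 0"
      by (intro tendsto_add ennreal_tendsto_cmult tail) simp_all
    then show "(\<lambda>n. 4 * (\<Sum>j=1..m (n + N). root_error h (n + N) j) + 2 * (\<Sum>j=1..m (n + N). root_error (- h) (n + N) j))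
        \<longlonglongrightarrow> 0" by simp
    fix n
    let ?n = "n + N"
    note loss = mass_loss_integral[OF \<theta>[of ?n, simplified] \<theta>'[of ?n, simplified]]
    show "0 \<le> (\<Sum>j=1..m ?n. \<integral>x. 1 - (1 + Z h ?n j x)\<^sup>2 \<partial>P0 ?n)"
      using loss(1) by (rule sum_nonneg)
    have "ennreal (\<Sum>j=1..m ?n. \<integral>x. 1 - (1 + Z h ?n j x)\<^sup>2 \<partial>P0 ?n)
        = (\<Sum>j=1..m ?n. ennreal (\<integral>x. 1 - (1 + Z h ?n j x)\<^sup>2 \<partial>P0 ?n))"
      using loss(1) by (rule sum_ennreal[symmetric])
    also have "\<dots> \<le> (\<Sum>j=1..m ?n. 4 * root_error h ?n j + 2 * root_error (- h) ?n j)"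
      using loss(2) by (rule sum_mono)
    also have "\<dots> = 4 * (\<Sum>j=1..m ?n. root_error h ?n j) + 2 * (\<Sum>j=1..m ?n. root_error (- h) ?n j)"
      by (simp only: sum.distrib sum_distrib_left)
    finally show "ennreal (\<Sum>j=1..m ?n. \<integral>x. 1 - (1 + Z h ?n j x)\<^sup>2 \<partial>P0 ?n)
        \<le> 4 * (\<Sum>j=1..m ?n. root_error h ?n j) + 2 * (\<Sum>j=1..m ?n. root_error (- h) ?n j)" .
  qed
next
  fix n
  let ?n = "n + N" and ?u = "\<lambda>n j x. u h n j x"
  have "ennreal (\<Sum>j=1..m ?n. \<integral>x. (?u ?n j x)\<^sup>2 \<partial>P0 ?n)
      = (\<Sum>j=1..m ?n. ennreal (\<integral>x. (?u ?n j x)\<^sup>2 \<partial>P0 ?n))"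
    by (rule sum_ennreal[symmetric]) simp
  also have "\<dots> = (\<Sum>j=1..m ?n. \<integral>\<^sup>+x. ennreal (\<bar>?u ?n j x\<bar>\<^sup>2) \<partial>P0 ?n)"
    unfolding inner_r power2_abs using inner_eta_square_integrable
    by (intro sum.cong refl nn_integral_eq_integral[symmetric]) auto
  also have "\<dots> \<le> ennreal K" by (rule K(2))
  finally show "(\<Sum>j=1..m ?n. \<integral>x. (?u ?n j x)\<^sup>2 \<partial>P0 ?n) \<le> K"
    using K(1) by (simp add: ennreal_le_iff)
next
  fix \<epsilon> :: real assume \<epsilon>: "0 < \<epsilon>"
  let ?u = "\<lambda>n j x. u h n j x"
  show "(\<lambda>n. \<Sum>j=1..m (n + N). \<integral>x. (if \<epsilon> < \<bar>?u (n + N) j x\<bar> then (?u (n + N) j x)\<^sup>2 else 0) \<partial>P0 (n + N)) \<longlonglongrightarrow> 0"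
  proof (rule tendsto_zero_if_ennreal_le)
    show "(\<lambda>n. \<Sum>j=1..m (n + N). \<integral>\<^sup>+x. ennreal (\<bar>?u (n + N) j x\<bar>\<^sup>2
        * indicator {z. \<bar>?u (n + N) j z\<bar> > \<epsilon>} x) \<partial>P0 (n + N)) \<longlonglongrightarrow> 0"
      using LIMSEQ_ignore_initial_segment[OF score_lindeberg[OF \<epsilon>, of h], of N] by simp
    fix n
    let ?n = "n + N"
    let ?f = "\<lambda>j x. if \<epsilon> < \<bar>?u ?n j x\<bar> then (?u ?n j x)\<^sup>2 else 0"
    let ?g = "\<lambda>j x. ennreal (\<bar>?u ?n j x\<bar>\<^sup>2 * indicator {z. \<bar>?u ?n j z\<bar> > \<epsilon>} x)"
    have "ennreal (\<integral>x. (?f j x) \<partial>P0 ?n)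
        = (\<integral>\<^sup>+x. ?g j x \<partial>P0 ?n)" if j: "j \<in> {1..m ?n}" for j
    proof -
      have [measurable]: "(\<lambda>x. ?u ?n j x) \<in> borel_measurable (P0 ?n)"
        unfolding inner_r using j by (intro adapted_measurable[OF _ inner_eta_measurable]) auto
      have sq: "integrable (P0 ?n) (\<lambda>x. (?u ?n j x)\<^sup>2)"
        unfolding inner_r by (rule inner_eta_square_integrable[OF j])
      have "integrable (P0 ?n) (\<lambda>x. (?f j x))"
        by (rule Bochner_Integration.integrable_bound[OF sq]) auto
      then have "ennreal (\<integral>x. (?f j x) \<partial>P0 ?n)
          = (\<integral>\<^sup>+x. ennreal (?f j x) \<partial>P0 ?n)"
        by (intro nn_integral_eq_integral[symmetric]) auto
      also have "\<dots> = (\<integral>\<^sup>+x. ?g j x \<partial>P0 ?n)"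
        by (intro nn_integral_cong) (simp add: indicator_def)
      finally show ?thesis .
    qed
    then have e1: "(\<Sum>j=1..m ?n. ennreal (\<integral>x. (?f j x) \<partial>P0 ?n))
        = (\<Sum>j=1..m ?n. \<integral>\<^sup>+x. ?g j x \<partial>P0 ?n)"
      by (rule sum.cong[OF refl])
    have e2: "(\<Sum>j=1..m ?n. ennreal (\<integral>x. (?f j x) \<partial>P0 ?n))
        = ennreal (\<Sum>j=1..m ?n. \<integral>x. (?f j x) \<partial>P0 ?n)"
      by (rule sum_ennreal) simp
    show "ennreal (\<Sum>j=1..m ?n. \<integral>x. (?f j x) \<partial>P0 ?n)
        \<le> (\<Sum>j=1..m ?n. \<integral>\<^sup>+x. ?g j x \<partial>P0 ?n)"
      by (rule eq_refl[OF trans[OF e2[symmetric] e1]])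
  qed (auto intro!: sum_nonneg)
qed

section \<open>Expansion of the log-likelihood ratio\<close>

text \<open>If some \<open>Z\<close> equals \<open>-1\<close>, the likelihood ratio vanishes and its logarithm is infinite. The bound
  \<open>1/2\<close> excludes this.\<close>

lemma log_likelihood_ratio_eq:
  assumes \<theta>: "shift h n \<in> \<Theta>"
  shows "AE x in P0 n. (\<forall>j\<in>{1..m n}. \<bar>Z h n j x\<bar> \<le> 1/2) \<longrightarrow>
    log_ennreal (likelihood_ratio (P (shift h n) n) (P0 n) x) = ereal (\<Sum>j=1..m n. 2 * ln (1 + Z h n j x))"
proof -
  have nonneg: "0 \<le> p \<theta> n j (restrict x {1..j})" if "\<theta> \<in> \<Theta>" "j \<in> {1..m n}" "x \<in> space (P0 n)" for \<theta> j x
    using that by (intro p_nonneg measurable_space[OF restrict_measurable[OF \<theta>\<^sub>0]]) auto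
  show ?thesis
    using likelihood_ratio_product(2)[OF \<theta> \<theta>\<^sub>0, of n] AE_space
  proof eventually_elim
    case (elim x)
    show ?case
    proof
      assume small: "\<forall>j\<in>{1..m n}. \<bar>Z h n j x\<bar> \<le> 1/2"
      have pos: "0 < 1 + Z h n j x" if "j \<in> {1..m n}" for j using small that by force
      have ratio: "p (shift h n) n j (restrict x {1..j}) / p \<theta>\<^sub>0 n j (restrict x {1..j}) = (1 + Z h n j x)\<^sup>2"
        if "j \<in> {1..m n}" for j
        using nonneg[OF \<theta> that elim(2)] nonneg[OF \<theta>\<^sub>0 that elim(2)] by (simp add: Z_def)
      have "likelihood_ratio (P (shift h n) n) (P0 n) x = (\<Prod>j=1..m n. ennreal ((1 + Z h n j x)\<^sup>2))"
        unfolding elim(1) by (rule prod.cong[OF refl]) (simp only: ratio)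
      also have "\<dots> = ennreal (\<Prod>j=1..m n. (1 + Z h n j x)\<^sup>2)" by (rule prod_ennreal) simp
      finally have L: "likelihood_ratio (P (shift h n) n) (P0 n) x = ennreal (\<Prod>j=1..m n. (1 + Z h n j x)\<^sup>2)" .
      have prod_pos: "0 < (\<Prod>j=1..m n. (1 + Z h n j x)\<^sup>2)"
        by (intro prod_pos zero_less_power pos)
      have "ln (\<Prod>j=1..m n. (1 + Z h n j x)\<^sup>2) = (\<Sum>j=1..m n. ln ((1 + Z h n j x)\<^sup>2))"
      proof (rule ln_prod)
        show "(1 + Z h n j x)\<^sup>2 \<noteq> 0" if "j \<in> {1..m n}" for j
          using pos[OF that] by (metis less_irrefl power_eq_0_iff)
      qed simp
      also have "\<dots> = (\<Sum>j=1..m n. 2 * ln (1 + Z h n j x))"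
        using pos by (intro sum.cong refl) (simp add: ln_realpow)
      finally show "log_ennreal (likelihood_ratio (P (shift h n) n) (P0 n) x)
          = ereal (\<Sum>j=1..m n. 2 * ln (1 + Z h n j x))"
        using prod_pos unfolding L log_ennreal_def by (simp add: less_imp_le ennreal_eq_0_iff)
    qed
  qed
qed

text \<open>Allowing \<open>T'\<close> to differ from \<open>T\<close> on events of vanishing probability covers the conditional information
  and its positive definite modification at once.\<close>

lemma log_likelihood_expansion:
  fixes T' :: "nat \<Rightarrow> (nat \<Rightarrow> 'a) \<Rightarrow> real^'d^'d"
  assumes B: "\<And>n. B n \<in> sets (P0 n)" and small: "(\<lambda>n. measure (P0 n) (B n)) \<longlonglongrightarrow> 0"
    and same: "\<And>n x. x \<in> space (P0 n) \<Longrightarrow> x \<notin> B n \<Longrightarrow> T' n x = T n x"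
  shows "tendsto_zero_in_prob P0 (\<lambda>n x. log_ennreal (likelihood_ratio (P (shift h n) n) (P0 n) x)
    - ereal (h \<bullet> V n x) + ereal (1/2 * (h \<bullet> (T' n x *v h))))"
  unfolding tendsto_zero_in_prob_def
proof (intro allI impI)
  fix \<epsilon> :: real assume \<epsilon>: "0 < \<epsilon>"
  have "\<forall>\<^sub>F n in sequentially. shift h n \<in> \<Theta> \<and> shift (- h) n \<in> \<Theta>"
    using local_parameters by (intro eventually_conj)
  then obtain N where \<theta>: "\<And>n. N \<le> n \<Longrightarrow> shift h n \<in> \<Theta>"
      and \<theta>': "\<And>n. N \<le> n \<Longrightarrow> shift (- h) n \<in> \<Theta>"
    by (auto simp: eventually_sequentially)
  obtain K where K: "0 < K" "\<And>n. (\<Sum>j=1..m n. \<integral>\<^sup>+x. ennreal (\<bar>u h n j x\<bar>\<^sup>2) \<partial>P0 n) \<le> ennreal K"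
    using score_bounded[of h] by blast
  note tail = increment_array_tail[OF \<theta> \<theta>' K]
  define X where "X = (\<lambda>n x. (\<Sum>j=1..m n. 2 * ln (1 + Z h n j x)) - (\<Sum>j=1..m n. u h n j x)
    + 1/2 * (\<Sum>j=1..m n. real_cond_exp (P0 n) (F n (j - 1)) (\<lambda>x. (u h n j x)\<^sup>2) x))"
  let ?G = "\<lambda>n. {x\<in>space (P0 n). \<epsilon> < \<bar>X n x\<bar>}"
  let ?L = "\<lambda>n. {x\<in>space (P0 n). \<exists>j\<in>{1..m n}. 1/2 < \<bar>Z h n j x\<bar>}"
  let ?Y = "\<lambda>n x. log_ennreal (likelihood_ratio (P (shift h n) n) (P0 n) x)
    - ereal (h \<bullet> V n x) + ereal (1/2 * (h \<bullet> (T' n x *v h)))"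
  let ?E = "\<lambda>n. {x\<in>space (P0 n). ereal \<epsilon> < \<bar>?Y n x\<bar>}"
  have X: "vanishes_in_prob (\<lambda>n. P0 (n + N)) (\<lambda>n. X (n + N))"
    unfolding X_def by (rule increment_array.logarithm_expansion[OF tail])
  have lim: "(\<lambda>n. measure (P0 (n + N)) (?G (n + N)) + measure (P0 (n + N)) (?L (n + N))
      + measure (P0 (n + N)) (B (n + N))) \<longlonglongrightarrow> 0"
    by (intro tendsto_add_zero vanishes_in_probD[OF X \<epsilon>] increment_array.large_increment_vanishes[OF tail]
        LIMSEQ_ignore_initial_segment[OF small]) simp_all
  have "(\<lambda>n. measure (P0 (n + N)) (?E (n + N))) \<longlonglongrightarrow> 0"
  proof (rule tendsto_zero_le[OF measure_nonneg _ lim])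
    fix k
    let ?n = "k + N"
    have \<theta>n: "shift h ?n \<in> \<Theta>" using \<theta>[of ?n] by simp
    interpret prob_space "P0 ?n" by (rule prob_P[OF \<theta>\<^sub>0])
    have [measurable]: "X ?n \<in> borel_measurable (P0 ?n)" using X by (simp add: vanishes_in_prob_def)
    have G: "?G ?n \<in> sets (P0 ?n)" by measurable
    have L: "?L ?n \<in> sets (P0 ?n)"
    proof (rule sets.sets_Collect_finite_Ex)
      fix j assume "j \<in> {1..m ?n}"
      from Z_measurable[OF \<theta>n this] show "{x\<in>space (P0 ?n). 1/2 < \<bar>Z h ?n j x\<bar>} \<in> sets (P0 ?n)" by measurable
    qed simp
    have "AE x in P0 ?n. x \<in> (?E ?n) \<longrightarrow> x \<in> ?G ?n \<union> ?L ?n \<union> B ?n"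
      using log_likelihood_ratio_eq[OF \<theta>n] quadratic_form_cond_information[of h ?n]
    proof eventually_elim
      case (elim x)
      show ?case
      proof (rule impI, rule ccontr)
        assume x: "x \<in> (?E ?n)" and out: "x \<notin> ?G ?n \<union> ?L ?n \<union> B ?n"
        then have "\<forall>j\<in>{1..m ?n}. \<bar>Z h ?n j x\<bar> \<le> 1/2" by (auto simp: not_less)
        then have "?Y ?n x = ereal (X ?n x)"
          using elim same[of x ?n] x out by (simp add: X_def inner_score)
        then show False using x out by simp
      qed
    qed
    then have "measure (P0 ?n) (?E ?n) \<le> measure (P0 ?n) (?G ?n \<union> ?L ?n \<union> B ?n)"
      using G L B by (intro finite_measure_mono_AE) auto
    also have "\<dots> \<le> measure (P0 ?n) (?G ?n) + measure (P0 ?n) (?L ?n) + measure (P0 ?n) (B ?n)"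
      by (rule order_trans[OF measure_Un_le[OF sets.Un[OF G L] B] add_right_mono[OF measure_Un_le[OF G L]]])
    finally show "measure (P0 ?n) (?E ?n)
      \<le> measure (P0 ?n) (?G ?n) + measure (P0 ?n) (?L ?n) + measure (P0 ?n) (B ?n)" .
  qed
  then show "(\<lambda>n. measure (P0 n) {x\<in>space (P0 n). ereal \<epsilon> < \<bar>?Y n x\<bar>}) \<longlonglongrightarrow> 0"
    by (rule LIMSEQ_offset)
qed


lemma condition_L_score:
  assumes limit: "mixed_normal_limit P0 V T N Tlim W"
  shows "condition_L P \<theta>\<^sub>0 r V T N Tlim W"
  unfolding condition_L_def
proof (intro conjI allI ballI)
  fix h
  show "tendsto_zero_in_prob P0 (\<lambda>n x. log_ennreal (likelihood_ratio (P (shift h n) n) (P0 n) x)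
    - ereal (h \<bullet> V n x) + ereal (1/2 * (h \<bullet> (T n x *v h))))"
    by (rule log_likelihood_expansion[where B="\<lambda>_. {}"]) simp_all
qed (rule r_pos score_measurable cond_information_measurable transpose_cond_information
      nonneg_definite_cond_information limit)+

lemma lamn_condition_score:
  assumes limit: "mixed_normal_limit P0 V T N Tlim W" and pd: "AE w in N. pos_definite (Tlim w)"
  shows "lamn_condition P \<theta>\<^sub>0 r V (\<lambda>n x. if pos_definite (T n x) then T n x else mat 1) N Tlim W"
    (is "lamn_condition P \<theta>\<^sub>0 r V ?T N Tlim W")
proof -
  let ?B = "\<lambda>n. {x\<in>space (P0 n). \<not> pos_definite (T n x)}"
  have prob: "prob_space (P0 n)" for n by (rule prob_P[OF \<theta>\<^sub>0])
  note B = not_pos_definite_vanishes[OF prob cond_information_measurable transpose_cond_information limit pd]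
  have pos: "pos_definite (?T n x)" for n x by (simp add: pos_definite_mat_1)
  have meas: "?T n \<in> borel_measurable (P0 n)" for n
  proof (rule measurable_If)
    have "{x\<in>space (P0 n). pos_definite (T n x)} = space (P0 n) - ?B n" by auto
    then show "{x\<in>space (P0 n). pos_definite (T n x)} \<in> sets (P0 n)" using B(1)[of n] by simp
  qed (simp_all add: cond_information_measurable)
  have same: "?T n x = T n x" if "x \<in> space (P0 n)" "x \<notin> ?B n" for n x using that by simp
  have "condition_L P \<theta>\<^sub>0 r V ?T N Tlim W"
    unfolding condition_L_def
  proof (intro conjI allI ballI)
    fix h
    show "tendsto_zero_in_prob P0 (\<lambda>n x. log_ennreal (likelihood_ratio (P (shift h n) n) (P0 n) x)
      - ereal (h \<bullet> V n x) + ereal (1/2 * (h \<bullet> (?T n x *v h))))"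
      by (rule log_likelihood_expansion[OF B same])
  next
    show "transpose (?T n x) = ?T n x" for n x using pos[of n x] by (simp only: pos_definite_def)
    show "AE x in P0 n. nonneg_definite (?T n x)" for n
      by (intro AE_I2 pos_definite_imp_nonneg_definite pos)
    show "mixed_normal_limit P0 V ?T N Tlim W"
      by (rule mixed_normal_limit_modify[OF prob score_measurable cond_information_measurable meas B(1) limit B(2) same])
  qed (rule r_pos score_measurable meas)+
  moreover have "AE x in P0 n. pos_definite (?T n x)" for n by (rule AE_I2) (rule pos)
  ultimately show ?thesis unfolding lamn_condition_def using pd by blast
qed

end

theorem theorem2p1:
  fixes \<Theta> :: "(real^'d) set"
    and \<theta>\<^sub>0 :: "real^'d"
    and m :: "nat \<Rightarrow> nat"
    and R :: "nat \<Rightarrow> nat \<Rightarrow> 'a metric"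
    and P :: "real^'d \<Rightarrow> nat \<Rightarrow> (nat \<Rightarrow> 'a) measure"
    and \<mu> :: "nat \<Rightarrow> nat \<Rightarrow> 'a measure"
    and Q :: "real^'d \<Rightarrow> nat \<Rightarrow> nat \<Rightarrow> (nat \<Rightarrow> 'a) \<Rightarrow> 'a measure"
    and p :: "real^'d \<Rightarrow> nat \<Rightarrow> nat \<Rightarrow> (nat \<Rightarrow> 'a) \<Rightarrow> real"
    and r :: "nat \<Rightarrow> real^'d^'d"
    and xd :: "nat \<Rightarrow> nat \<Rightarrow> (nat \<Rightarrow> 'a) \<Rightarrow> real^'d"
    and N :: "'w measure"
    and Tlim :: "'w \<Rightarrow> real^'d^'d"
    and W :: "'w \<Rightarrow> real^'d"
  defines "\<eta> \<equiv> eta p \<theta>\<^sub>0 xd"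
    and "V \<equiv> score m p \<theta>\<^sub>0 xd r"
    and "T \<equiv> cond_information m R P p \<theta>\<^sub>0 xd r"
  assumes setting: "density_array \<Theta> m R P \<mu> Q p"
    and \<theta>\<^sub>0: "\<theta>\<^sub>0 \<in> \<Theta>"
    and r_pos: "\<forall>n. pos_definite (r n)"
    and local_parameters: "\<forall>h. \<forall>\<^sub>F n in sequentially. \<theta>\<^sub>0 + r n *v h \<in> \<Theta>"
    and xd_measurable:
      "\<forall>n. \<forall>j\<in>{1..m n}. xd n j \<in> borel_measurable (prod_borel (R n) {1..j})"
    and A1: "\<forall>h. (\<lambda>n. \<Sum>j\<in>{1..m n}. \<integral>\<^sup>+x. (\<integral>\<^sup>+y.
        ennreal ((xi p \<theta>\<^sub>0 r h n j ((restrict x {1..<j})(j := y))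
          - 1/2 * (h \<bullet> (r n *v xd n j ((restrict x {1..<j})(j := y)))))\<^sup>2)
        \<partial>\<mu> n j) \<partial>P \<theta>\<^sub>0 n) \<longlonglongrightarrow> 0"
    and A2: "\<forall>n. \<forall>j\<in>{1..m n}. AE x in P \<theta>\<^sub>0 n.
        nn_cond_exp (P \<theta>\<^sub>0 n) (history_algebra (R n) (m n) (j - 1))
          (\<lambda>z. ennreal ((norm (\<eta> n j z))\<^sup>2)) x < \<infinity> \<and>
        (\<forall>i. real_cond_exp (P \<theta>\<^sub>0 n) (history_algebra (R n) (m n) (j - 1))
          (\<lambda>z. \<eta> n j z $ i) x = 0)"
    and A3: "\<forall>\<epsilon>>0. \<forall>h. (\<lambda>n. \<Sum>j\<in>{1..m n}. \<integral>\<^sup>+x.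
        ennreal (\<bar>h \<bullet> (r n *v \<eta> n j x)\<bar>\<^sup>2 * indicator {z. \<bar>h \<bullet> (r n *v \<eta> n j z)\<bar> > \<epsilon>} x)
        \<partial>P \<theta>\<^sub>0 n) \<longlonglongrightarrow> 0"
    and A4: "\<forall>h. \<exists>K>0. (SUP n. \<Sum>j\<in>{1..m n}. \<integral>\<^sup>+x.
        ennreal (\<bar>h \<bullet> (r n *v \<eta> n j x)\<bar>\<^sup>2) \<partial>P \<theta>\<^sub>0 n) \<le> ennreal K"
    and A5: "mixed_normal_limit (P \<theta>\<^sub>0) V T N Tlim W"
  shows "condition_L P \<theta>\<^sub>0 r V T N Tlim W \<and>
    ((AE w in N. pos_definite (Tlim w)) \<longrightarrow>
      lamn_condition P \<theta>\<^sub>0 r V (\<lambda>n x. if pos_definite (T n x) then T n x else mat 1) N Tlim W)"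
proof -
  have "differentiable_density_array \<Theta> m R P \<mu> Q p \<theta>\<^sub>0 r xd"
  proof (intro differentiable_density_array.intro differentiable_density_array_axioms.intro)
    show "density_array \<Theta> m R P \<mu> Q p" by (rule setting)
    show "AE x in P \<theta>\<^sub>0 n. real_cond_exp (P \<theta>\<^sub>0 n) (history_algebra (R n) (m n) (j - 1))
        (\<lambda>z. eta p \<theta>\<^sub>0 xd n j z $ i) x = 0" if "j \<in> {1..m n}" for n j i
      using A2[rule_format, OF that] unfolding \<eta>_def by eventually_elim blast
    show "\<exists>K>0. \<forall>n. (\<Sum>j\<in>{1..m n}. \<integral>\<^sup>+x. ennreal (\<bar>h \<bullet> (r n *v eta p \<theta>\<^sub>0 xd n j x)\<bar>\<^sup>2) \<partial>P \<theta>\<^sub>0 n) \<le> ennreal K" for h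
      using A4[rule_format, of h] unfolding \<eta>_def SUP_le_iff by simp
    show "(\<lambda>n. \<Sum>j\<in>{1..m n}. \<integral>\<^sup>+x. ennreal (\<bar>h \<bullet> (r n *v eta p \<theta>\<^sub>0 xd n j x)\<bar>\<^sup>2
          * indicator {z. \<bar>h \<bullet> (r n *v eta p \<theta>\<^sub>0 xd n j z)\<bar> > \<epsilon>} x) \<partial>P \<theta>\<^sub>0 n) \<longlonglongrightarrow> 0"
      if "0 < \<epsilon>" for \<epsilon> h
      using A3[rule_format, OF that] unfolding \<eta>_def .
  qed (rule \<theta>\<^sub>0 r_pos[rule_format] local_parameters[rule_format] xd_measurable[rule_format] A1[rule_format]
      | assumption)+
  then interpret differentiable_density_array \<Theta> m R P \<mu> Q p \<theta>\<^sub>0 r xd .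
  show ?thesis
    using condition_L_score[OF A5[unfolded V_def T_def]] lamn_condition_score[OF A5[unfolded V_def T_def]]
    unfolding V_def T_def by (intro conjI impI)
qed

end
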